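(* Let $n\ge1$ and let $\alpha,\beta\in\mathbb C^n$ satisfy $\Re\alpha_j+\Re\beta_j>-1$ and $\alpha_j,\beta_j\notin\{-1,-2,\ldots\}$ for all $1\le j\le n$. Let $f\in L^1(\mathbb T^n)$ and $u=P_{\alpha,\beta}[f]$. Then $$RNT\text{-}\lim_{z\to\eta}u(z)=f(\eta)\quad\text{for almost every }\eta\in\mathbb T^n.$$
   Context: $\mathbb D$ is the open unit disc and $\mathbb T$ the unit circle; $m_n$ is the normalized Haar measure on $\mathbb T^n$. The $(\alpha,\beta)$-Poisson kernel is, for $z\in\mathbb D^n$, $\zeta\in\mathbb T^n$ (principal branches of powers), $$P_{\alpha,\beta}(z,\zeta)=\prod_{j=1}^n c_{\alpha_j,\beta_j}\frac{(1-|z_j|^2)^{\alpha_j+\beta_j+1}}{(1-z_j\overline{\zeta_j})^{\alpha_j+1}(1-\overline{z_j}\zeta_j)^{\beta_j+1}},\qquad c_{a,b}=\frac{\Gamma(a+1)\Gamma(b+1)}{\Gamma(a+b+1)},$$ and $P_{\alpha,\beta}[f](z)=\int_{\mathbb T^n}P_{\alpha,\beta}(z,\zeta)f(\zeta)\,dm_n(\zeta)$, $z\in\mathbb D^n$. The Stolz region at $e^{i\varphi}\in\mathbb T$ is $S_A(e^{i\varphi})=\{re^{i(\varphi-\theta)}:0\le r<1,\ |\theta|\le A(1-r)\}$. For $\eta\in\mathbb T^n$, $0<A<\infty$, $1\le B<\infty$, $S_A(\eta)=\prod_{j=1}^nS_A(\eta_j)$ and $$S_{A,B}(\eta)=\Big\{(z_1,\ldots,z_n)\in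 S_A(\eta):\max_{j,k}\frac{1-|z_j|}{1-|z_k|}\le B\Big\}.$$ $RNT$-$\lim_{z\to\eta}u(z)=l$ (restricted non-tangential limit) means: for every $0<A<\infty$ and $1\le B<\infty$ and every $\varepsilon>0$ there is $\delta>0$ such that $|u(z)-l|<\varepsilon$ whenever $|z-\eta|<\delta$ and $z\in S_{A,B}(\eta)$. *)

theory Defs
  imports "HOL-Probability.Probability"
begin

definition torus :: "(complex ^ 'n::finite) set" where
  "torus = {\<zeta>. \<forall>j. norm (\<zeta> $ j) = 1}"

text \<open>The measure \<open>m\<^sub>n\<close>: the image of the normalized Lebesgue measure on the cube
  \<open>[0, 2\<pi>]\<^sup>n\<close> under \<open>t \<mapsto> (e\<^bsup>i t\<^sub>j\<^esup>)\<^sub>j\<close>. Its space is exactly \<^const>\<open>torus\<close>. It is completed, so that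
  Lebesgue measurable (not just Borel measurable) representatives of \<open>L\<^sup>1\<close> functions are covered.\<close>

definition haar_torus :: "(complex ^ 'n::finite) measure" where
  "haar_torus = completion
     (distr (uniform_measure lborel (cbox 0 (\<chi> j. 2 * pi) :: (real ^ 'n) set))
        (restrict_space borel torus) (\<lambda>t. \<chi> j. cis (t $ j)))"

definition poisson_const :: "complex \<Rightarrow> complex \<Rightarrow> complex" where
  "poisson_const a b = Gamma (a + 1) * Gamma (b + 1) / Gamma (a + b + 1)"

definition poisson_kernel ::
  "complex ^ 'n::finite \<Rightarrow> complex ^ 'n \<Rightarrow> complex ^ 'n \<Rightarrow> complex ^ 'n \<Rightarrow> complex" where
  "poisson_kernel \<alpha> \<beta> z \<zeta> =
     (\<Prod>j\<in>UNIV. poisson_const (\<alpha> $ j) (\<beta> $ j) *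
        (complex_of_real (1 - (norm (z $ j))\<^sup>2) powr (\<alpha> $ j + \<beta> $ j + 1) /
         ((1 - z $ j * cnj (\<zeta> $ j)) powr (\<alpha> $ j + 1) *
          (1 - cnj (z $ j) * \<zeta> $ j) powr (\<beta> $ j + 1))))"

text \<open>Only the values at points \<open>z\<close> of the open unit polydisc are meaningful.\<close>

definition poisson_integral ::
  "complex ^ 'n::finite \<Rightarrow> complex ^ 'n \<Rightarrow> (complex ^ 'n \<Rightarrow> complex) \<Rightarrow> complex ^ 'n \<Rightarrow> complex" where
  "poisson_integral \<alpha> \<beta> f z = (LINT \<zeta>|haar_torus. poisson_kernel \<alpha> \<beta> z \<zeta> * f \<zeta>)"

text \<open>For \<open>w = e\<^bsup>i\<phi>\<^esup>\<close> the point \<open>r w e\<^bsup>-i\<theta>\<^esup>\<close> is \<open>r e\<^bsup>i(\<phi>-\<theta>)\<^esup>\<close>.\<close>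

definition stolz :: "real \<Rightarrow> complex \<Rightarrow> complex set" where
  "stolz A w = {of_real r * (w * cis (- \<theta>)) | r \<theta>. 0 \<le> r \<and> r < 1 \<and> \<bar>\<theta>\<bar> \<le> A * (1 - r)}"

definition stolz_prod :: "real \<Rightarrow> complex ^ 'n::finite \<Rightarrow> (complex ^ 'n) set" where
  "stolz_prod A \<eta> = {z. \<forall>j. z $ j \<in> stolz A (\<eta> $ j)}"

definition restricted_stolz :: "real \<Rightarrow> real \<Rightarrow> complex ^ 'n::finite \<Rightarrow> (complex ^ 'n) set" where
  "restricted_stolz A B \<eta> =
     {z \<in> stolz_prod A \<eta>. (MAX (j, k)\<in>UNIV. (1 - norm (z $ j)) / (1 - norm (z $ k))) \<le> B}"

definition RNT_lim :: "(complex ^ 'n::finite \<Rightarrow> complex) \<Rightarrow> complex ^ 'n \<Rightarrow> complex \<Rightarrow> bool" where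
  "RNT_lim u \<eta> l \<longleftrightarrow>
     (\<forall>A>0. \<forall>B\<ge>1. \<forall>\<epsilon>>0. \<exists>\<delta>>0. \<forall>z\<in>restricted_stolz A B \<eta>.
        norm (z - \<eta>) < \<delta> \<longrightarrow> norm (u z - l) < \<epsilon>)"

lemma space_haar_torus [simp]: "space haar_torus = torus"
  by (simp add: haar_torus_def space_restrict_space)

lemma prob_space_haar_torus: "prob_space haar_torus"
proof -
  let ?C = "cbox 0 (\<chi> j. 2 * pi) :: (real ^ 'n) set"
  let ?U = "uniform_measure lborel ?C"
  let ?D = "distr ?U (restrict_space borel torus) (\<lambda>t. \<chi> j. cis (t $ j))"
  have C: "emeasure lborel ?C \<noteq> 0" "emeasure lborel ?C \<noteq> \<infinity>"
    by (auto simp: emeasure_lborel_cbox_eq Basis_vec_def inner_axis prod_zero_iff ennreal_eq_0_iff not_le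
             intro!: prod_pos)
  interpret U: prob_space ?U
    by (rule prob_space_uniform_measure) (use C in auto)
  have "continuous_on UNIV (\<lambda>t :: real ^ 'n. \<chi> j. cis (t $ j))"
    by (intro continuous_intros)
  then have "(\<lambda>t :: real ^ 'n. \<chi> j. cis (t $ j)) \<in> borel \<rightarrow>\<^sub>M borel"
    by (rule borel_measurable_continuous_onI)
  then have "(\<lambda>t. \<chi> j. cis (t $ j)) \<in> ?U \<rightarrow>\<^sub>M restrict_space borel torus"
    by (intro measurable_restrict_space2) (auto simp: torus_def measurable_def)
  then interpret D: prob_space ?D
    by (rule U.prob_space_distr)
  show ?thesis
    unfolding haar_torus_def by (rule D.prob_space_completion)
qed

end

theory Submission
  imports Defs
begin

text \<open>Each \<open>\<eta>\<close> is written as \<open>(e\<^bsup>i \<phi>\<^sub>j\<^esup>)\<^sub>j\<close> with \<open>\<phi>\<close> in the cube \<open>[0, 2\<pi>]\<^sup>n\<close>, and the Poisson integral becomes an integral operator on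
functions on that cube. The kernel behaves like an approximate identity there, for three reasons.

(1) Its total mass tends to 1 when all \<open>\<bar>z\<^sub>j\<bar> \<rightarrow> 1\<close>. Expanding both powers of the one-variable kernel in binomial
series and integrating term by term gives
\<open>c (1 - \<bar>z\<bar>\<^sup>2)\<^bsup>a+b+1\<^esup> \<Sum>\<^sub>k (a+1)\<^sub>k (b+1)\<^sub>k / k!\<^sup>2 \<bar>z\<bar>\<^bsup>2k\<^esup>\<close>. The coefficients are asymptotic to a multiple of those of
\<open>(1 - x)\<^bsup>-(a+b+1)\<^esup>\<close>, so an Abelian argument gives the limit; the constant \<open>c\<close> is chosen to make it 1
(\<open>hypergeometric_boundary_tendsto\<close>, \<open>poisson_mass_tendsto\<close>).

(2) Its modulus is small away from the diagonal. If \<open>z\<close> lies in \<open>S\<^sub>A\<^sub>,\<^sub>B(\<eta>)\<close> then all the numbers \<open>1 - \<bar>z\<^sub>j\<bar>\<close> are comparable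
to one number \<open>h\<close>, and the modulus of the kernel is at most a constant times
\<open>\<Prod>\<^sub>j h\<^sup>\<sigma> / (h + \<bar>\<phi>\<^sub>j - t\<^sub>j\<bar>)\<^bsup>\<sigma>+1\<^esup>\<close>, where \<open>\<sigma>\<close> is the smallest of the \<open>Re \<alpha>\<^sub>j + Re \<beta>\<^sub>j + 1\<close>
(\<open>poisson_kernel_le_majorant\<close>). The restriction by \<open>B\<close> is what provides this common \<open>h\<close>.

(3) The maximal operator of this majorant over \<open>h > 0\<close> is of weak type (1,1) (\<open>majorant_weak_type\<close>). The majorant is
dominated by a sum, over exponent vectors \<open>g\<close>, of averages over boxes with sides proportional to \<open>2\<^bsup>g j\<^esup> h\<close>, with weights
\<open>2\<^bsup>-\<sigma> \<Sum> g\<^esup>\<close>. For a fixed \<open>g\<close> the boxes form a one-parameter family of similar shapes; a linear rescaling turns them into cubes,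
and the covering lemma of Vitali gives a weak type bound that does not depend on \<open>g\<close>. Comparing the boxes with cubes instead
would lose a factor that the weights cannot absorb when \<open>\<sigma>\<close> is small. The bounds are added up by giving the box
average for \<open>g\<close> a level proportional to \<open>2\<^bsup>\<sigma> \<Sum> g / 2\<^esup> \<Lambda>\<close>: then both the exceptional sets and the averages have geometric sums.

From (1) and (2) the limit exists with the right value wherever a bounded function is continuous. By (3) the class of functions with
the right limits almost everywhere is closed under \<open>L\<^sup>1\<close> convergence (\<open>fatou_property_L1_limit\<close>). It contains the indicators of
boxes, hence by a Dynkin class argument those of Borel sets, hence every integrable function.\<close>

section \<open>Power series of the kernel at the boundary\<close>

text \<open>The coefficient of \<open>w\<^sup>n\<close> in the binomial series of \<open>(1 - w)\<^bsup>-a\<^esup>\<close>.\<close>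

definition neg_binomial_coeff :: "'a::{real_normed_field} \<Rightarrow> nat \<Rightarrow> 'a" where
  "neg_binomial_coeff a n = pochhammer a n / fact n"

lemma neg_binomial_coeff_eq_gbinomial: "neg_binomial_coeff a n = (-1) ^ n * ((- a) gchoose n)"
  for a :: "'a::{real_normed_field}"
  by (simp add: neg_binomial_coeff_def gbinomial_pochhammer power_mult_distrib [symmetric] flip: mult.assoc)

lemma neg_binomial_coeff_sums:
  fixes w a :: complex
  assumes "norm w < 1"
  shows "(\<lambda>n. neg_binomial_coeff a n * w ^ n) sums (1 - w) powr (- a)"
proof -
  have "(\<lambda>n. ((- a) gchoose n) * (- w) ^ n) sums (1 + (- w)) powr (- a)"
    using assms by (intro gen_binomial_complex) auto
  moreover have "((- a) gchoose n) * (- w) ^ n = neg_binomial_coeff a n * w ^ n" for n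
    by (simp add: neg_binomial_coeff_eq_gbinomial power_minus [of w] mult_ac)
  ultimately show ?thesis by simp
qed

lemma of_real_neg_binomial_coeff: "of_real (neg_binomial_coeff a n) = (neg_binomial_coeff (of_real a) n :: complex)"
  by (simp add: neg_binomial_coeff_def pochhammer_of_real)

lemma neg_binomial_coeff_sums_real:
  fixes x a :: real
  assumes "0 \<le> x" "x < 1"
  shows "(\<lambda>n. neg_binomial_coeff a n * x ^ n) sums (1 - x) powr (- a)"
proof -
  have "(\<lambda>n. neg_binomial_coeff (of_real a) n * of_real x ^ n) sums (1 - complex_of_real x) powr (- of_real a)"
    using assms by (intro neg_binomial_coeff_sums) auto
  also have "(\<lambda>n. neg_binomial_coeff (of_real a) n * complex_of_real x ^ n) = (\<lambda>n. of_real (neg_binomial_coeff a n * x ^ n))"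
    by (simp add: of_real_neg_binomial_coeff)
  also have "(1 - complex_of_real x) powr (- of_real a) = of_real ((1 - x) powr (- a))"
    using assms by (simp add: powr_of_real [symmetric])
  finally show ?thesis by (simp only: sums_of_real_iff)
qed

text \<open>The series still converges at a point between \<open>\<bar>w\<bar>\<close> and 1, which forces absolute convergence at \<open>w\<close>.\<close>

lemma neg_binomial_coeff_abs_summable:
  fixes w a :: complex
  assumes "norm w < 1"
  shows "summable (\<lambda>n. norm (neg_binomial_coeff a n * w ^ n))"
proof -
  obtain K where K: "norm w < K" "K < 1" using assms dense by blast
  then have K0: "0 < K" using norm_ge_zero[of w] by linarith
  have "summable (\<lambda>n. neg_binomial_coeff a n * (of_real K :: complex) ^ n)"
    using K K0 by (intro sums_summable[OF neg_binomial_coeff_sums]) auto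
  then show ?thesis
    by (rule powser_insidea) (use K K0 in auto)
qed

lemma neg_binomial_coeff_pos: "0 < a \<Longrightarrow> 0 < neg_binomial_coeff (a::real) n"
  by (simp add: neg_binomial_coeff_def pochhammer_pos)

text \<open>Euler's product for \<open>1/\<Gamma>\<close> makes the growth \<open>n\<^bsup>a-1\<^esup> / \<Gamma>(a)\<close> of the coefficients explicit. It enters for
complex and for real parameters, hence the two versions.\<close>

lemma neg_binomial_coeff_Suc_eq_rGamma_series:
  fixes a :: complex
  assumes "n > 0"
  shows "neg_binomial_coeff a (Suc n) = rGamma_series a n * exp (a * of_real (ln (real n))) / of_nat (Suc n)"
  using assms by (simp add: neg_binomial_coeff_def rGamma_series_def field_simps)

lemma neg_binomial_coeff_Suc_eq_rGamma_series_real: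
  fixes a :: real
  assumes "n > 0"
  shows "neg_binomial_coeff a (Suc n) = rGamma_series a n * exp (a * (ln (real n))) / of_nat (Suc n)"
  using assms by (simp add: neg_binomial_coeff_def rGamma_series_def field_simps)

text \<open>The product of the coefficients for \<open>a\<close> and \<open>b\<close> grows like \<open>n\<^bsup>a+b-2\<^esup> / (\<Gamma>(a) \<Gamma>(b))\<close>, the coefficient for \<open>a + b - 1\<close> like
\<open>n\<^bsup>a+b-2\<^esup> / \<Gamma>(a+b-1)\<close>. After multiplication by the quotient of the constants only lower order terms remain, measured
against the positive coefficients with the real exponent \<open>Re (a + b - 1)\<close>.\<close>

lemma neg_binomial_coeff_product_ratio_tendsto:
  fixes a b :: complex
  assumes s: "Re (a + b) > 1"
  shows "(\<lambda>n. (neg_binomial_coeff a n * neg_binomial_coeff b n - rGamma a * rGamma b * Gamma (a + b - 1) * neg_binomial_coeff (a + b - 1) n)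
            / of_real (neg_binomial_coeff (Re (a + b - 1)) n)) \<longlonglongrightarrow> 0"
proof -
  define t where "t = a + b - 1"
  define \<sigma> where "\<sigma> = Re t"
  define c where "c = rGamma a * rGamma b * Gamma t"
  have \<sigma>: "\<sigma> > 0" using s by (simp add: \<sigma>_def t_def)
  have t: "t \<notin> \<int>\<^sub>\<le>\<^sub>0" using \<sigma> by (auto simp: \<sigma>_def elim!: nonpos_Ints_cases)
  \<comment> \<open>The quotient of \<open>n\<^bsup>t\<^esup>\<close> and \<open>n\<^bsup>Re t\<^esup>\<close>, a factor of modulus 1; \<open>R\<close> below is the rest.\<close>
  define E where "E = (\<lambda>n. exp (t * of_real (ln (real n))) / of_real (exp (\<sigma> * ln (real n))))"
  have normE: "norm (E n) = 1" for n
    by (simp add: E_def norm_divide \<sigma>_def)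
  define R where "R = (\<lambda>n. (rGamma_series a n * rGamma_series b n * (of_nat n / of_nat (Suc n)) - c * rGamma_series t n)
             / of_real (rGamma_series \<sigma> n))"
  have rG\<sigma>: "rGamma \<sigma> \<noteq> 0" using \<sigma> by (auto simp: rGamma_eq_zero_iff elim!: nonpos_Ints_cases)
  have "R \<longlonglongrightarrow> (rGamma a * rGamma b * 1 - c * rGamma t) / of_real (rGamma \<sigma>)"
    unfolding R_def
    by (intro tendsto_intros rGamma_series_LIMSEQ LIMSEQ_n_over_Suc_n) (use rG\<sigma> in auto)
  also have "rGamma a * rGamma b * 1 - c * rGamma t = 0"
    using t by (simp add: c_def Gamma_def rGamma_eq_zero_iff)
  finally have R: "R \<longlonglongrightarrow> 0" by simp
  have "(\<lambda>n. E n * R n) \<longlonglongrightarrow> 0"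
  proof (rule Lim_null_comparison)
    show "\<forall>\<^sub>F n in sequentially. norm (E n * R n) \<le> norm (R n)"
      by (simp add: norm_mult normE)
    show "(\<lambda>n. norm (R n)) \<longlonglongrightarrow> 0" using R by (rule tendsto_norm_zero)
  qed
  moreover have "\<forall>\<^sub>F n in sequentially. E n * R n = (neg_binomial_coeff a (Suc n) * neg_binomial_coeff b (Suc n) - c * neg_binomial_coeff t (Suc n))
            / of_real (neg_binomial_coeff \<sigma> (Suc n))"
  proof (rule eventually_mono[OF eventually_gt_at_top[of 0]])
    fix n :: nat assume n: "0 < n"
    have exp1: "exp (a * of_real (ln (real n))) * exp (b * of_real (ln (real n))) = of_nat n * exp (t * of_real (ln (real n)))"
    proof -
      have "of_nat n = exp (of_real (ln (real n)) :: complex)"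
        using n by (simp add: exp_of_real)
      then show ?thesis
        by (simp add: t_def algebra_simps flip: exp_add)
    qed
    define L where "L = complex_of_real (ln (real n))"
    have nz: "(of_nat (Suc n)::complex) \<noteq> 0" by (simp del: of_nat_Suc)
    have "neg_binomial_coeff a (Suc n) * neg_binomial_coeff b (Suc n) = rGamma_series a n * rGamma_series b n * (exp (a * L) * exp (b * L)) / (of_nat (Suc n) * of_nat (Suc n))"
      by (simp add: neg_binomial_coeff_Suc_eq_rGamma_series[OF n] L_def del: of_nat_Suc)
    also have "\<dots> = rGamma_series a n * rGamma_series b n * (of_nat n / of_nat (Suc n)) * exp (t * L) / of_nat (Suc n)"
      by (simp add: exp1 L_def del: of_nat_Suc)
    finally have ab: "neg_binomial_coeff a (Suc n) * neg_binomial_coeff b (Suc n) = \<dots>" .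
    have tt: "c * neg_binomial_coeff t (Suc n) = c * rGamma_series t n * exp (t * L) / of_nat (Suc n)"
      by (simp add: neg_binomial_coeff_Suc_eq_rGamma_series[OF n] L_def del: of_nat_Suc)
    have dd: "complex_of_real (neg_binomial_coeff \<sigma> (Suc n)) = of_real (rGamma_series \<sigma> n) * of_real (exp (\<sigma> * ln (real n))) / of_nat (Suc n)"
      by (simp add: neg_binomial_coeff_Suc_eq_rGamma_series_real[OF n] del: of_nat_Suc)
    show "E n * R n = (neg_binomial_coeff a (Suc n) * neg_binomial_coeff b (Suc n) - c * neg_binomial_coeff t (Suc n)) / of_real (neg_binomial_coeff \<sigma> (Suc n))"
      unfolding ab tt dd E_def R_def L_def[symmetric] diff_divide_distrib[symmetric] left_diff_distrib[symmetric]
      using nz by (simp add: mult_ac del: of_nat_Suc)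
  qed
  ultimately have "(\<lambda>n. (neg_binomial_coeff a (Suc n) * neg_binomial_coeff b (Suc n) - c * neg_binomial_coeff t (Suc n)) / of_real (neg_binomial_coeff \<sigma> (Suc n))) \<longlonglongrightarrow> 0"
    by (simp cong: tendsto_cong)
  then show ?thesis
    unfolding c_def t_def \<sigma>_def by (rule LIMSEQ_imp_Suc)
qed

text \<open>An Abelian theorem: coefficients that are \<open>o(n\<^bsup>\<sigma>-1\<^esup>)\<close> give a sum that is \<open>o((1 - x)\<^bsup>-\<sigma>\<^esup>)\<close>. Finitely many terms
contribute a bounded amount, which \<open>(1 - x)\<^sup>\<sigma>\<close> kills, and the rest is at most \<open>\<epsilon>\<close> times the binomial series.\<close>

lemma powser_little_o_tendsto:
  fixes e :: "nat \<Rightarrow> complex"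
  assumes \<sigma>: "\<sigma> > 0" and e: "(\<lambda>n. e n / of_real (neg_binomial_coeff \<sigma> n)) \<longlonglongrightarrow> 0"
  shows "((\<lambda>x. of_real ((1 - x) powr \<sigma>) * (\<Sum>n. e n * of_real x ^ n)) \<longlongrightarrow> 0) (at_left 1)"
proof (rule tendstoI)
  fix \<epsilon> :: real assume \<epsilon>: "\<epsilon> > 0"
  have pos: "neg_binomial_coeff \<sigma> n > 0" for n using \<sigma> by (rule neg_binomial_coeff_pos)
  have "\<forall>\<^sub>F n in sequentially. norm (e n / of_real (neg_binomial_coeff \<sigma> n)) < \<epsilon>/2"
    using tendstoD[OF e, of "\<epsilon>/2"] \<epsilon> by (simp add: dist_norm)
  then obtain N where N: "\<And>n. n \<ge> N \<Longrightarrow> norm (e n / of_real (neg_binomial_coeff \<sigma> n)) < \<epsilon>/2"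
    by (auto simp: eventually_sequentially)
  define S where "S = (\<Sum>n<N. norm (e n))"
  have eb: "norm (e n) \<le> (if n < N then norm (e n) else 0) + \<epsilon>/2 * neg_binomial_coeff \<sigma> n" for n
    using N[of n] pos[of n] \<epsilon> by (auto simp: norm_divide field_simps not_less intro: less_imp_le)
  have bound: "norm (of_real ((1 - x) powr \<sigma>) * (\<Sum>n. e n * of_real x ^ n)) \<le> S * (1 - x) powr \<sigma> + \<epsilon>/2"
    if x: "0 < x" "x < 1" for x
  proof -
    define g where "g = (\<lambda>n. (if n < N then norm (e n) else 0) + \<epsilon>/2 * (neg_binomial_coeff \<sigma> n * x ^ n))"
    have "(\<lambda>n. if n < N then norm (e n) else 0) sums S"
      unfolding S_def using sums_If_finite_set[of "{..<N}" "\<lambda>n. norm (e n)"] by simp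
    then have gs: "g sums (S + \<epsilon>/2 * (1 - x) powr (-\<sigma>))"
      unfolding g_def using x by (intro sums_add sums_mult neg_binomial_coeff_sums_real) auto
    have le: "norm (e n * of_real x ^ n) \<le> g n" for n
    proof -
      have "norm (e n * of_real x ^ n) = norm (e n) * x ^ n"
        using x by (simp add: norm_mult norm_power)
      also have "\<dots> \<le> ((if n < N then norm (e n) else 0) + \<epsilon>/2 * neg_binomial_coeff \<sigma> n) * x ^ n"
        using x by (intro mult_right_mono eb) auto
      also have "\<dots> \<le> g n"
        using x power_le_one[of x n] by (auto simp: g_def algebra_simps intro!: mult_left_le_one_le)
      finally show ?thesis .
    qed
    have "norm (\<Sum>n. e n * of_real x ^ n) \<le> (\<Sum>n. g n)"
      by (rule norm_suminf_le[OF le sums_summable[OF gs]])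
    also have "\<dots> = S + \<epsilon>/2 * (1 - x) powr (-\<sigma>)" using gs by (rule sums_unique[symmetric])
    finally have "norm (of_real ((1 - x) powr \<sigma>) * (\<Sum>n. e n * of_real x ^ n))
        \<le> (1 - x) powr \<sigma> * (S + \<epsilon>/2 * (1 - x) powr (-\<sigma>))"
      by (simp add: norm_mult mult_left_mono)
    also have "\<dots> = S * (1 - x) powr \<sigma> + \<epsilon>/2"
      using x by (simp add: powr_minus field_simps)
    finally show ?thesis .
  qed
  have "((\<lambda>x. S * (1 - x) powr \<sigma>) \<longlongrightarrow> S * (1 - 1) powr \<sigma>) (at_left 1)"
    using \<sigma> by (intro tendsto_intros) (auto simp: eventually_at_filter)
  then have "\<forall>\<^sub>F x in at_left 1. dist (S * (1 - x) powr \<sigma>) (S * (1 - 1) powr \<sigma>) < \<epsilon>/2"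
    using \<epsilon> by (intro tendstoD) auto
  moreover have "\<forall>\<^sub>F x in at_left (1::real). 0 < x \<and> x < 1"
    by (auto simp: eventually_at_left[of 0] intro!: exI[of _ 0])
  ultimately show "\<forall>\<^sub>F x in at_left 1. dist (of_real ((1 - x) powr \<sigma>) * (\<Sum>n. e n * of_real x ^ n)) 0 < \<epsilon>"
  proof eventually_elim
    case (elim x)
    have "S * (1 - x) powr \<sigma> < \<epsilon>/2" using elim \<sigma> by (simp add: dist_norm)
    with bound[of x] elim show ?case by simp
  qed
qed

text \<open>The boundary behaviour of the hypergeometric function \<open>\<^sub>2F\<^sub>1(a, b; 1; x)\<close> as \<open>x \<rightarrow> 1\<close>: up to an error covered by the
Abelian theorem it equals a constant times \<open>(1 - x)\<^bsup>-(a+b-1)\<^esup>\<close>.\<close>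

lemma hypergeometric_boundary_tendsto:
  fixes a b :: complex
  assumes s: "Re (a + b) > 1"
  shows "((\<lambda>x. of_real (1 - x) powr (a + b - 1) * (\<Sum>n. neg_binomial_coeff a n * neg_binomial_coeff b n * of_real x ^ n))
     \<longlongrightarrow> rGamma a * rGamma b * Gamma (a + b - 1)) (at_left 1)"
proof -
  define t where "t = a + b - 1"
  define c where "c = rGamma a * rGamma b * Gamma t"
  define e where "e n = neg_binomial_coeff a n * neg_binomial_coeff b n - c * neg_binomial_coeff t n" for n
  have \<sigma>: "Re t > 0" using s by (simp add: t_def)
  have e: "(\<lambda>n. e n / of_real (neg_binomial_coeff (Re t) n)) \<longlonglongrightarrow> 0"
    using neg_binomial_coeff_product_ratio_tendsto[OF s] by (simp add: e_def c_def t_def)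
  have lim: "((\<lambda>x. norm (of_real ((1 - x) powr Re t) * (\<Sum>n. e n * of_real x ^ n))) \<longlongrightarrow> 0) (at_left 1)"
    by (intro tendsto_norm_zero powser_little_o_tendsto \<sigma> e)
  have "((\<lambda>x. of_real (1 - x) powr t * (\<Sum>n. neg_binomial_coeff a n * neg_binomial_coeff b n * of_real x ^ n) - c) \<longlongrightarrow> 0) (at_left 1)"
  proof (rule Lim_null_comparison[OF _ lim])
    have "\<forall>\<^sub>F x in at_left (1::real). 0 < x \<and> x < 1"
      by (auto simp: eventually_at_left[of 0] intro!: exI[of _ 0])
    then show "\<forall>\<^sub>F x in at_left 1. norm (of_real (1 - x) powr t * (\<Sum>n. neg_binomial_coeff a n * neg_binomial_coeff b n * of_real x ^ n) - c)
       \<le> norm (of_real ((1 - x) powr Re t) * (\<Sum>n. e n * of_real x ^ n))"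
    proof eventually_elim
      case (elim x)
      \<comment> \<open>Split \<open>x\<^sup>n\<close> as \<open>(\<surd>x)\<^sup>n (\<surd>x)\<^sup>n\<close>: one factor makes the first series summable, the other bounds the second.\<close>
      have sm1: "summable (\<lambda>n. neg_binomial_coeff a n * neg_binomial_coeff b n * of_real x ^ n)"
      proof -
        have r: "sqrt x < 1" "0 < sqrt x" "sqrt x * sqrt x = x" using elim by auto
        have "summable (\<lambda>n. norm (neg_binomial_coeff b n * of_real (sqrt x) ^ n))"
          using r elim by (intro neg_binomial_coeff_abs_summable) auto
        then have "(\<lambda>n. norm (neg_binomial_coeff b n * of_real (sqrt x) ^ n)) \<longlonglongrightarrow> 0"
          by (rule summable_LIMSEQ_zero)
        then have "Bseq (\<lambda>n. norm (neg_binomial_coeff b n * of_real (sqrt x) ^ n))"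
          using Bseq_eq_bounded convergent_imp_Bseq convergentI by blast
        then obtain M where M: "\<And>n. norm (neg_binomial_coeff b n * of_real (sqrt x) ^ n) \<le> M"
          by (auto simp: Bseq_def)
        show ?thesis
        proof (rule summable_comparison_test')
          show "summable (\<lambda>n. M * norm (neg_binomial_coeff a n * of_real (sqrt x) ^ n))"
            using r elim by (intro summable_mult neg_binomial_coeff_abs_summable) auto
          fix n :: nat assume "n \<ge> 0"
          have "neg_binomial_coeff a n * neg_binomial_coeff b n * complex_of_real x ^ n = 
             (neg_binomial_coeff b n * of_real (sqrt x) ^ n) * (neg_binomial_coeff a n * of_real (sqrt x) ^ n)"
            using r(3) by (simp add: mult_ac flip: of_real_mult power_mult_distrib of_real_power)
          then show "norm (neg_binomial_coeff a n * neg_binomial_coeff b n * complex_of_real x ^ n) \<le> M * norm (neg_binomial_coeff a n * of_real (sqrt x) ^ n)"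
            using M[of n] by (simp only: norm_mult[of "neg_binomial_coeff b n * _"] mult_right_mono norm_ge_zero)
        qed
      qed
      have st: "(\<lambda>n. neg_binomial_coeff t n * of_real x ^ n) sums (1 - of_real x) powr (- t)"
        using elim by (intro neg_binomial_coeff_sums) auto
      have "(\<lambda>n. neg_binomial_coeff a n * neg_binomial_coeff b n * of_real x ^ n - c * (neg_binomial_coeff t n * of_real x ^ n)) sums
        ((\<Sum>n. neg_binomial_coeff a n * neg_binomial_coeff b n * of_real x ^ n) - c * (1 - of_real x) powr (- t))"
        by (intro sums_diff sums_mult st summable_sums sm1)
      moreover have "(\<lambda>n. neg_binomial_coeff a n * neg_binomial_coeff b n * of_real x ^ n - c * (neg_binomial_coeff t n * of_real x ^ n)) = (\<lambda>n. e n * of_real x ^ n)"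
        by (simp add: e_def algebra_simps)
      ultimately have E: "(\<Sum>n. e n * of_real x ^ n) = (\<Sum>n. neg_binomial_coeff a n * neg_binomial_coeff b n * of_real x ^ n) - c * (1 - of_real x) powr (- t)"
        by (simp add: sums_iff)
      have nz: "(1 - complex_of_real x) \<noteq> 0" using elim by (metis eq_iff_diff_eq_0 less_irrefl of_real_1 of_real_eq_iff)
      have "of_real (1 - x) powr t * (\<Sum>n. neg_binomial_coeff a n * neg_binomial_coeff b n * of_real x ^ n) - c = of_real (1 - x) powr t * (\<Sum>n. e n * of_real x ^ n)"
        unfolding E right_diff_distrib using nz by (simp add: powr_minus field_simps)
      moreover have "norm (complex_of_real (1 - x) powr t) = (1 - x) powr Re t"
        using elim by (subst norm_powr_real_powr) auto
      ultimately show ?case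
        using elim by (simp add: norm_mult)
    qed
  qed
  then show ?thesis
    unfolding c_def t_def by (rule Lim_null[THEN iffD2])
qed

section \<open>Total mass of the kernel\<close>

definition poisson_factor :: "complex \<Rightarrow> complex \<Rightarrow> complex \<Rightarrow> complex \<Rightarrow> complex" where
  "poisson_factor a b z w = poisson_const a b *
        (complex_of_real (1 - (norm z)\<^sup>2) powr (a + b + 1) /
         ((1 - z * cnj w) powr (a + 1) * (1 - cnj z * w) powr (b + 1)))"

lemma poisson_kernel_eq_prod: "poisson_kernel \<alpha> \<beta> z \<zeta> = (\<Prod>j\<in>UNIV. poisson_factor (\<alpha> $ j) (\<beta> $ j) (z $ j) (\<zeta> $ j))"
  by (simp add: poisson_kernel_def poisson_factor_def)

lemma (in finite_measure) integral_sums_dominated: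
  fixes f :: "nat \<Rightarrow> 'a \<Rightarrow> complex"
  assumes [measurable]: "\<And>n. f n \<in> borel_measurable M"
    and b: "\<And>n x. x \<in> space M \<Longrightarrow> norm (f n x) \<le> c n" and c: "summable c"
  shows "(\<lambda>n. \<integral>x. f n x \<partial>M) sums (\<integral>x. (\<Sum>n. f n x) \<partial>M)"
proof (rule sums_integral)
  show int: "integrable M (f n)" for n
    by (rule integrable_const_bound[where B = "c n"]) (auto simp: b)
  have s: "summable (\<lambda>n. norm (f n x))" if "x \<in> space M" for x
    by (rule summable_comparison_test'[OF c, of 0]) (use b that in auto)
  show "AE x in M. summable (\<lambda>n. norm (f n x))"
    by (intro AE_I2 s)
  show "summable (\<lambda>n. \<integral>x. norm (f n x) \<partial>M)"
  proof (rule summable_comparison_test'[of "\<lambda>n. c n * measure M (space M)" 0])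
    show "summable (\<lambda>n. c n * measure M (space M))" using c by (rule summable_mult2)
    fix n
    have "(\<integral>x. norm (f n x) \<partial>M) \<le> (\<integral>x. c n \<partial>M)"
      by (intro integral_mono integrable_norm int) (auto simp: b)
    then show "norm (\<integral>x. norm (f n x) \<partial>M) \<le> c n * measure M (space M)"
      by (simp add: mult.commute)
  qed
qed

abbreviation period_measure :: "real measure" where
  "period_measure \<equiv> restrict_space lborel {0..2*pi}"

lemma finite_period_measure: "finite_measure period_measure"
  by (rule finite_measureI) (simp add: emeasure_restrict_space)

lemma integral_cis_period:
  "(\<integral>t. cis (real_of_int k * t) \<partial>period_measure) = (if k = 0 then of_real (2*pi) else 0)"
proof (cases "k = 0")
  case True
  then show ?thesis by (simp add: measure_restrict_space scaleR_conv_of_real)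
next
  case False
  define F where "F t = cis (real_of_int k * t) / (\<i> * of_int k)" for t
  have "has_bochner_integral lborel (\<lambda>x. indicator {0..2*pi} x *\<^sub>R cis (real_of_int k * x)) (F (2*pi) - F 0)"
  proof (rule has_bochner_integral_FTC_Icc)
    show "(F has_vector_derivative cis (real_of_int k * x)) (at x within {0..2*pi})" for x
    proof -
      have "((\<lambda>w. exp (\<i> * of_int k * w) / (\<i> * of_int k)) has_field_derivative exp (\<i> * of_int k * of_real x)) (at (of_real x))"
        using False by (auto intro!: derivative_eq_intros)
      from has_vector_derivative_real_field[OF this, of "{0..2*pi}"] show ?thesis
        by (simp add: F_def[abs_def] cis_conv_exp mult.assoc)
    qed
    show "continuous_on {0..2*pi} (\<lambda>x. cis (real_of_int k * x))"
      by (intro continuous_intros)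
  qed auto
  moreover have "F (2*pi) = F 0"
    using cis_multiple_2pi[of "of_int k"] by (simp add: F_def mult.commute)
  ultimately show ?thesis
    using False by (subst integral_restrict_space) (auto dest: has_bochner_integral_integral_eq)
qed

lemma period_integral_power_product:
  "(\<integral>t. cnj (cis t) ^ n * cis t ^ m \<partial>period_measure) = (if m = n then of_real (2*pi) else 0)"
proof -
  have "cnj (cis t) ^ n * cis t ^ m = cis (real_of_int (int m - int n) * t)" for t
  proof -
    have "cnj (cis t) ^ n * cis t ^ m = cis (real n * (- t)) * cis (real m * t)"
      by (simp only: cis_cnj Complex.DeMoivre)
    also have "\<dots> = cis (real_of_int (int m - int n) * t)"
      by (simp add: cis_mult left_diff_distrib)
    finally show ?thesis .
  qed
  then show ?thesis by (simp only: integral_cis_period) simp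
qed

text \<open>Orthogonality of the characters leaves only the diagonal terms of the double series. Absolute summability allows the two
interchanges of sum and integral.\<close>

lemma parseval:
  fixes A B :: "nat \<Rightarrow> complex"
  assumes A: "summable (\<lambda>n. norm (A n))" and B: "summable (\<lambda>n. norm (B n))"
  shows "(\<integral>t. (\<Sum>n. A n * cnj (cis t) ^ n) * (\<Sum>m. B m * cis t ^ m) \<partial>period_measure)
    = of_real (2*pi) * (\<Sum>n. A n * B n)"
proof -
  interpret finite_measure period_measure by (rule finite_period_measure)
  define g where "g t = (\<Sum>m. B m * cis t ^ m)" for t
  have nb: "norm (B m * cis t ^ m) \<le> norm (B m)" for m t by (simp add: norm_mult norm_power)
  have g_sums: "(\<lambda>m. B m * cis t ^ m) sums g t" for t
    unfolding g_def by (intro summable_sums summable_comparison_test'[OF B, of 0]) (simp add: norm_mult norm_power)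
  have gb: "norm (g t) \<le> (\<Sum>m. norm (B m))" for t
    unfolding g_def by (rule norm_suminf_le[OF nb B])
  have cisM [measurable]: "cis \<in> borel_measurable period_measure"
    by (intro measurable_restrict_space1) (simp, intro borel_measurable_continuous_onI continuous_intros)
  have cisM' [measurable]: "(\<lambda>t. cnj (cis t)) \<in> borel_measurable period_measure"
    by (intro measurable_restrict_space1) (simp, intro borel_measurable_continuous_onI continuous_intros)
  have gM [measurable]: "g \<in> borel_measurable period_measure"
    unfolding g_def by measurable
  have inner: "(\<integral>t. cnj (cis t) ^ n * g t \<partial>period_measure) = of_real (2*pi) * B n" for n
  proof -
    have "(\<lambda>m. \<integral>t. cnj (cis t) ^ n * (B m * cis t ^ m) \<partial>period_measure) sums (\<integral>t. (\<Sum>m. cnj (cis t) ^ n * (B m * cis t ^ m)) \<partial>period_measure)"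
      by (rule integral_sums_dominated[OF _ _ B]) (auto simp: norm_mult norm_power)
    also have "(\<lambda>m. \<integral>t. cnj (cis t) ^ n * (B m * cis t ^ m) \<partial>period_measure) = (\<lambda>m. if m = n then of_real (2*pi) * B n else 0)"
    proof
      fix m
      have "(\<integral>t. cnj (cis t) ^ n * (B m * cis t ^ m) \<partial>period_measure) = (\<integral>t. B m * (cnj (cis t) ^ n * cis t ^ m) \<partial>period_measure)"
        by (intro Bochner_Integration.integral_cong refl) (rule mult.left_commute)
      also have "\<dots> = B m * (if m = n then of_real (2*pi) else 0)"
        by (simp only: integral_mult_right_zero period_integral_power_product)
      finally show "(\<integral>t. cnj (cis t) ^ n * (B m * cis t ^ m) \<partial>period_measure) = (if m = n then of_real (2*pi) * B n else 0)"
        by (simp add: mult.commute)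
    qed
    also have "(\<integral>t. (\<Sum>m. cnj (cis t) ^ n * (B m * cis t ^ m)) \<partial>period_measure) = (\<integral>t. cnj (cis t) ^ n * g t \<partial>period_measure)"
      using g_sums by (intro Bochner_Integration.integral_cong refl) (metis sums_mult sums_unique)
    finally have "(\<lambda>m. if m = n then of_real (2*pi) * B n else 0) sums (\<integral>t. cnj (cis t) ^ n * g t \<partial>period_measure)" .
    moreover have "(\<lambda>m. if m = n then of_real (2*pi) * B n else 0) sums (of_real (2*pi) * B n)"
      by (rule sums_single)
    ultimately show ?thesis by (rule sums_unique2)
  qed
  have fs: "summable (\<lambda>n. norm (A n) * (\<Sum>m. norm (B m)))" using A by (rule summable_mult2)
  have "(\<lambda>n. \<integral>t. A n * cnj (cis t) ^ n * g t \<partial>period_measure) sums (\<integral>t. (\<Sum>n. A n * cnj (cis t) ^ n * g t) \<partial>period_measure)"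
    by (rule integral_sums_dominated[OF _ _ fs]) (auto simp: norm_mult norm_power intro!: mult_left_mono gb)
  moreover have "(\<integral>t. A n * cnj (cis t) ^ n * g t \<partial>period_measure) = of_real (2*pi) * (A n * B n)" for n
    unfolding mult.assoc integral_mult_right_zero inner by (rule mult.left_commute)
  moreover have "(\<integral>t. (\<Sum>n. A n * cnj (cis t) ^ n * g t) \<partial>period_measure) = (\<integral>t. (\<Sum>n. A n * cnj (cis t) ^ n) * g t \<partial>period_measure)"
  proof (intro Bochner_Integration.integral_cong refl)
    fix t
    have "summable (\<lambda>n. A n * cnj (cis t) ^ n)"
      by (intro summable_comparison_test'[OF A, of 0]) (simp add: norm_mult norm_power)
    then show "(\<Sum>n. A n * cnj (cis t) ^ n * g t) = (\<Sum>n. A n * cnj (cis t) ^ n) * g t"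
      by (rule suminf_mult2[symmetric])
  qed
  ultimately have sm: "(\<lambda>n. of_real (2*pi) * (A n * B n)) sums (\<integral>t. (\<Sum>n. A n * cnj (cis t) ^ n) * g t \<partial>period_measure)"
    by simp
  have "summable (\<lambda>n. A n * B n)"
    using sums_summable[OF sm] by (subst (asm) summable_cmult_iff) auto
  then show ?thesis using sm by (simp add: g_def sums_iff suminf_mult)
qed

lemma period_integral_poisson_factor:
  assumes z: "norm z < 1"
  shows "(\<integral>t. poisson_factor a b z (cis t) \<partial>period_measure) = of_real (2*pi) * (poisson_const a b *
    (of_real (1 - (norm z)\<^sup>2) powr (a + b + 1) * (\<Sum>n. neg_binomial_coeff (a+1) n * neg_binomial_coeff (b+1) n * of_real ((norm z)\<^sup>2) ^ n)))"
proof -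
  define q where "q = poisson_const a b * of_real (1 - (norm z)\<^sup>2) powr (a + b + 1)"
  have eq: "poisson_factor a b z (cis t) = q * ((\<Sum>n. (neg_binomial_coeff (a+1) n * z ^ n) * cnj (cis t) ^ n) * (\<Sum>m. (neg_binomial_coeff (b+1) m * cnj z ^ m) * cis t ^ m))" for t
  proof -
    have "(\<Sum>n. (neg_binomial_coeff (a+1) n * z ^ n) * cnj (cis t) ^ n) = (1 - z * cnj (cis t)) powr (- (a+1))"
      using neg_binomial_coeff_sums[of "z * cnj (cis t)" "a+1"] z
      by (simp add: sums_iff power_mult_distrib mult.assoc norm_mult)
    moreover have "(\<Sum>n. (neg_binomial_coeff (b+1) n * cnj z ^ n) * cis t ^ n) = (1 - cnj z * cis t) powr (- (b+1))"
      using neg_binomial_coeff_sums[of "cnj z * cis t" "b+1"] z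
      by (simp add: sums_iff power_mult_distrib mult.assoc norm_mult)
    ultimately show ?thesis
      by (simp only: poisson_factor_def q_def powr_minus) (simp add: field_simps)
  qed
  have "(\<integral>t. poisson_factor a b z (cis t) \<partial>period_measure) = q * (of_real (2*pi) * (\<Sum>n. (neg_binomial_coeff (a+1) n * z ^ n) * (neg_binomial_coeff (b+1) n * cnj z ^ n)))"
    unfolding eq integral_mult_right_zero
    by (subst parseval) (use z in \<open>auto intro!: neg_binomial_coeff_abs_summable\<close>)
  also have "(\<lambda>n. (neg_binomial_coeff (a+1) n * z ^ n) * (neg_binomial_coeff (b+1) n * cnj z ^ n)) = (\<lambda>n. neg_binomial_coeff (a+1) n * neg_binomial_coeff (b+1) n * of_real ((norm z)\<^sup>2) ^ n)"
    by (simp only: complex_norm_square power_mult_distrib) (simp add: mult_ac)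
  finally show ?thesis by (simp add: q_def mult_ac)
qed

text \<open>The mass of the one-variable kernel is \<open>c\<close> times the expression in the hypergeometric limit, and \<open>c\<close> is the
reciprocal of that limit. The parameters avoid the negative integers, so no \<open>\<Gamma>\<close> value involved is a pole.\<close>

lemma period_integral_poisson_factor_tendsto:
  assumes ab: "Re a + Re b > -1" and a: "a \<notin> {- of_nat k | k::nat. k \<ge> 1}" and b: "b \<notin> {- of_nat k | k::nat. k \<ge> 1}"
    and e: "\<epsilon> > 0"
  shows "\<exists>\<delta>>0. \<forall>z. 1 - \<delta> < norm z \<longrightarrow> norm z < 1 \<longrightarrow>
     norm ((\<integral>t. poisson_factor a b z (cis t) \<partial>period_measure) / of_real (2*pi) - 1) < \<epsilon>"
proof -
  have nonpole: "c + 1 \<notin> \<int>\<^sub>\<le>\<^sub>0" if c: "c \<notin> {- of_nat k | k::nat. k \<ge> 1}" for c :: complex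
  proof
    assume "c + 1 \<in> \<int>\<^sub>\<le>\<^sub>0"
    then obtain n where "c + 1 = - of_nat n" by (rule nonpos_Ints_cases')
    moreover have "c = (c + 1) - 1" by simp
    ultimately have "c = - of_nat (Suc n)" by simp
    moreover have "Suc n \<ge> 1" by simp
    ultimately show False using c by blast
  qed
  have s: "a + b + 1 \<notin> \<int>\<^sub>\<le>\<^sub>0" using ab by (auto elim!: nonpos_Ints_cases simp: complex_eq_iff)
  have one: "poisson_const a b * (rGamma (a + 1) * rGamma (b + 1) * Gamma (a + 1 + (b + 1) - 1)) = 1"
    using nonpole[OF a] nonpole[OF b] s
    by (simp add: poisson_const_def rGamma_inverse_Gamma Gamma_eq_zero_iff add_ac field_simps)
  have "((\<lambda>x. poisson_const a b * (of_real (1 - x) powr (a + 1 + (b + 1) - 1) * (\<Sum>n. neg_binomial_coeff (a+1) n * neg_binomial_coeff (b+1) n * of_real x ^ n)))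
     \<longlongrightarrow> poisson_const a b * (rGamma (a+1) * rGamma (b+1) * Gamma (a + 1 + (b + 1) - 1))) (at_left 1)"
    by (intro tendsto_mult_left hypergeometric_boundary_tendsto) (use ab in auto)
  then have "((\<lambda>x. poisson_const a b * (of_real (1 - x) powr (a + b + 1) * (\<Sum>n. neg_binomial_coeff (a+1) n * neg_binomial_coeff (b+1) n * of_real x ^ n))) \<longlongrightarrow> 1) (at_left 1)"
    unfolding one by (simp add: add_ac)
  from tendstoD[OF this e] obtain d where d: "d < 1" and
    D: "\<And>x. d < x \<Longrightarrow> x < 1 \<Longrightarrow> norm (poisson_const a b * (of_real (1 - x) powr (a + b + 1) * (\<Sum>n. neg_binomial_coeff (a+1) n * neg_binomial_coeff (b+1) n * of_real x ^ n)) - 1) < \<epsilon>"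
    by (auto simp: eventually_at_left_field dist_norm)
  define d' where "d' = max d 0"
  have d': "0 \<le> d'" "d' < 1" "d \<le> d'" using d by (auto simp: d'_def)
  show ?thesis
  proof (intro exI[of _ "1 - sqrt d'"] conjI allI impI)
    show "0 < 1 - sqrt d'" using d' by simp
    fix z :: complex assume z: "1 - (1 - sqrt d') < norm z" "norm z < 1"
    then have "sqrt d' ^ 2 < (norm z)^2" using d' by (intro power_strict_mono) auto
    then have 1: "d < (norm z)\<^sup>2" using d' by simp
    have 2: "(norm z)\<^sup>2 < 1" using z by (simp add: power_less_one_iff)
    show "norm ((\<integral>t. poisson_factor a b z (cis t) \<partial>period_measure) / of_real (2*pi) - 1) < \<epsilon>"
      unfolding period_integral_poisson_factor[OF z(2)] using D[OF 1 2] by simp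
  qed
qed

abbreviation cube :: "(real ^ 'n::finite) set" where
  "cube \<equiv> cbox 0 (\<chi> j. 2 * pi)"

abbreviation cube_measure :: "(real ^ 'n::finite) measure" where
  "cube_measure \<equiv> uniform_measure lborel cube"

definition cis_vec :: "real ^ 'n::finite \<Rightarrow> complex ^ 'n" where
  "cis_vec t = (\<chi> j. cis (t $ j))"

lemma cis_vec_nth [simp]: "cis_vec t $ j = cis (t $ j)"
  by (simp add: cis_vec_def)

lemma emeasure_lborel_cbox_cart:
  fixes a b :: "real ^ 'n::finite"
  assumes "\<And>j. a $ j \<le> b $ j"
  shows "emeasure lborel (cbox a b) = ennreal (\<Prod>j\<in>UNIV. b $ j - a $ j)"
proof -
  have "a \<in> cbox a b" using assms by (simp add: mem_box_cart)
  then have ne: "cbox a b \<noteq> {}" by blast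
  have "emeasure lborel (cbox a b) = ennreal (measure lborel (cbox a b))"
    by (rule emeasure_eq_ennreal_measure) (simp add: emeasure_lborel_cbox_eq)
  then show ?thesis
    using content_cbox_cart[OF ne] by simp
qed

lemma emeasure_cube: "emeasure lborel (cube :: (real ^ 'n::finite) set) = ennreal ((2 * pi) ^ CARD('n))"
  by (subst emeasure_lborel_cbox_cart) auto

lemma prob_space_cube_measure: "prob_space (cube_measure :: (real ^ 'n::finite) measure)"
  by (rule prob_space_uniform_measure) (auto simp: emeasure_cube)

lemma cube_measure_eq_density:
  "(cube_measure :: (real ^ 'n::finite) measure) = density lborel (\<lambda>t. ennreal (indicator cube t / (2 * pi) ^ CARD('n)))"
proof -
  have "indicator cube t / ennreal ((2 * pi) ^ CARD('n)) = ennreal (indicator cube t / (2 * pi) ^ CARD('n))" for t :: "real ^ 'n"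
    by (auto simp: indicator_def divide_ennreal ennreal_1[symmetric] simp del: ennreal_1)
  then show ?thesis by (simp add: uniform_measure_def emeasure_cube)
qed

text \<open>Fubini for products, transported from the product over the standard basis to coordinates.\<close>

lemma integral_lborel_prod_cart:
  fixes G :: "'n::finite \<Rightarrow> real \<Rightarrow> complex"
  assumes G: "\<And>j. integrable lborel (G j)"
  shows "(\<integral>t. (\<Prod>j\<in>UNIV. G j (t $ j)) \<partial>(lborel :: (real ^ 'n) measure)) = (\<Prod>j\<in>UNIV. \<integral>s. G j s \<partial>lborel)"
proof -
  interpret product_sigma_finite "\<lambda>b :: real ^ 'n. lborel :: real measure" ..
  have [measurable]: "G j \<in> borel_measurable borel" for j using G[of j] by simp
  define e where "e j = (axis j 1 :: real ^ 'n)" for j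
  have inj: "inj e" by (auto simp: e_def inj_on_def axis_eq_axis)
  have Basis: "Basis = range e" by (auto simp: Basis_vec_def e_def)
  define H where "H b = G (inv e b)" for b
  have He: "H (e j) = G j" for j using inj by (simp add: H_def)
  have coord: "(\<Sum>b\<in>Basis. f b *\<^sub>R b) $ j = f (e j)" for f :: "real ^ 'n \<Rightarrow> real" and j
  proof -
    have "(\<Sum>b\<in>Basis. f b *\<^sub>R b) $ j = (\<Sum>b\<in>Basis. f b *\<^sub>R b) \<bullet> e j"
      by (simp add: e_def cart_eq_inner_axis)
    also have "\<dots> = f (e j)" by (rule inner_sum_left_Basis) (simp add: Basis)
    finally show ?thesis .
  qed
  have "(\<integral>t. (\<Prod>j\<in>UNIV. G j (t $ j)) \<partial>(lborel :: (real ^ 'n) measure))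
      = (\<integral>f. (\<Prod>j\<in>UNIV. G j ((\<Sum>b\<in>Basis. f b *\<^sub>R b) $ j)) \<partial>(\<Pi>\<^sub>M b\<in>(Basis :: (real ^ 'n) set). lborel))"
    by (subst lborel_eq, subst integral_distr) measurable
  also have "\<dots> = (\<integral>f. (\<Prod>b\<in>Basis. H b (f b)) \<partial>(\<Pi>\<^sub>M b\<in>(Basis :: (real ^ 'n) set). lborel))"
    unfolding coord by (simp add: Basis prod.reindex[OF inj] He)
  also have "\<dots> = (\<Prod>b\<in>Basis. \<integral>s. H b s \<partial>lborel)"
    by (rule product_integral_prod) (auto simp: H_def G)
  also have "\<dots> = (\<Prod>j\<in>UNIV. \<integral>s. G j s \<partial>lborel)"
    by (simp add: Basis prod.reindex[OF inj] He)
  finally show ?thesis .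
qed

text \<open>Both bases have positive real part, so the branch cut is never met.\<close>

lemma continuous_on_poisson_factor:
  assumes z: "norm z < 1"
  shows "continuous_on {w. norm w = 1} (poisson_factor a b z)"
proof -
  have 1: "0 < Re (1 - w)" if "norm w < 1" for w :: complex
    using that complex_Re_le_cmod[of w] by simp
  have 2: "0 < Re (1 - z * cnj w)" "0 < Re (1 - cnj z * w)" if "w \<in> {w. norm w = 1}" for w
    by (rule 1, use that in \<open>simp add: norm_mult z\<close>)+
  have pw: "continuous_on {w. norm w = 1} (\<lambda>t. f t powr c)" "\<And>t. norm t = 1 \<Longrightarrow> f t powr c \<noteq> 0"
    if f: "\<And>t. t \<in> {w. norm w = 1} \<Longrightarrow> 0 < Re (f t)" "continuous_on {w. norm w = 1} f" for f :: "complex \<Rightarrow> complex" and c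
  proof -
    have nz: "f t \<noteq> 0" if "norm t = 1" for t using f(1)[of t] that by auto
    show "continuous_on {w. norm w = 1} (\<lambda>t. f t powr c)"
    proof (rule continuous_on_powr_complex[OF _ _ f(2) continuous_on_const])
      show "{w. norm w = 1} \<subseteq> {t. 0 \<le> Re (f t) \<or> Im (f t) \<noteq> 0}" using f(1) less_imp_le by blast
    qed (use nz in blast)
    show "f t powr c \<noteq> 0" if "norm t = 1" for t using nz that by (simp add: powr_def)
  qed
  have 3: "continuous_on {w. norm w = 1} (\<lambda>t. 1 - z * cnj t)" "continuous_on {w. norm w = 1} (\<lambda>t. 1 - cnj z * t)"
    by (intro continuous_intros)+
  have 4: "continuous_on {w. norm w = 1} (\<lambda>w. (1 - z * cnj w) powr (a + 1) * (1 - cnj z * w) powr (b + 1))"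
    by (intro continuous_on_mult pw(1) 2 3)
  have 5: "(1 - z * cnj w) powr (a + 1) * (1 - cnj z * w) powr (b + 1) \<noteq> 0" if "norm w = 1" for w
    using pw(2)[of "\<lambda>w. 1 - z * cnj w" w, OF 2(1) 3(1) that] pw(2)[of "\<lambda>w. 1 - cnj z * w" w, OF 2(2) 3(2) that]
    by (simp only: mult_eq_0_iff) blast
  show ?thesis unfolding poisson_factor_def[abs_def]
    by (intro continuous_on_mult[OF continuous_on_const] continuous_on_divide[OF continuous_on_const 4]) (use 5 in blast)
qed

lemma continuous_on_poisson_kernel:
  assumes z: "\<And>j. norm (z $ j) < 1"
  shows "continuous_on torus (poisson_kernel \<alpha> \<beta> z)"
  unfolding poisson_kernel_eq_prod[abs_def]
proof (intro continuous_on_prod)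
  fix j
  show "continuous_on torus (\<lambda>\<zeta>. poisson_factor (\<alpha> $ j) (\<beta> $ j) (z $ j) (\<zeta> $ j))"
    by (rule continuous_on_compose2[OF continuous_on_poisson_factor[OF z[of j]]]) (auto simp: torus_def intro!: continuous_intros)
qed

lemma cis_vec_in_torus: "cis_vec t \<in> torus"
  by (simp add: torus_def)

lemma continuous_cis_vec: "continuous_on A cis_vec"
  unfolding cis_vec_def[abs_def] by (intro continuous_intros)

lemma continuous_on_poisson_kernel_cis:
  assumes z: "\<And>j. norm (z $ j) < 1"
  shows "continuous_on A (\<lambda>t. poisson_kernel \<alpha> \<beta> z (cis_vec t))"
  by (rule continuous_on_compose2[OF continuous_on_poisson_kernel[OF z] continuous_cis_vec])
    (auto simp: cis_vec_in_torus)

lemma borel_measurable_poisson_kernel: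
  assumes "\<And>j. norm (z $ j) < 1"
  shows "(\<lambda>t :: real ^ 'n::finite. poisson_kernel \<alpha> \<beta> z (cis_vec t)) \<in> borel_measurable borel"
  by (intro borel_measurable_continuous_onI continuous_on_poisson_kernel_cis assms)

lemma cube_integral_poisson_kernel:
  fixes \<alpha> \<beta> z :: "complex ^ 'n::finite"
  assumes z: "\<And>j. norm (z $ j) < 1"
  shows "(\<integral>t. poisson_kernel \<alpha> \<beta> z (cis_vec t) \<partial>cube_measure) =
    (\<Prod>j\<in>UNIV. (\<integral>t. poisson_factor (\<alpha> $ j) (\<beta> $ j) (z $ j) (cis t) \<partial>period_measure) / of_real (2*pi))"
proof -
  define G where "G j s = indicator {0..2*pi} s *\<^sub>R poisson_factor (\<alpha> $ j) (\<beta> $ j) (z $ j) (cis s)" for j s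
  have G: "integrable lborel (G j)" for j
    unfolding G_def
    by (rule borel_integrable_compact) (auto intro!: continuous_on_compose2[OF continuous_on_poisson_factor[OF z]] continuous_intros)
  have ind: "indicator cube t = (\<Prod>j\<in>UNIV. indicator {0..2*pi} (t $ j) :: real)" for t :: "real ^ 'n"
    by (auto simp: indicator_def mem_box_cart prod_zero_iff)
  have "(\<integral>t. poisson_kernel \<alpha> \<beta> z (cis_vec t) \<partial>cube_measure) =
     (\<integral>t. (indicator cube t / (2 * pi) ^ CARD('n)) *\<^sub>R poisson_kernel \<alpha> \<beta> z (cis_vec t) \<partial>(lborel :: (real ^ 'n) measure))"
    unfolding cube_measure_eq_density
    by (rule integral_density) (auto intro!: borel_measurable_poisson_kernel z)
  also have "\<dots> = (\<integral>t. (\<Prod>j\<in>UNIV. G j (t $ j)) / of_real (2 * pi) ^ CARD('n) \<partial>(lborel :: (real ^ 'n) measure))"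
    by (intro Bochner_Integration.integral_cong refl)
      (simp add: ind G_def poisson_kernel_eq_prod scaleR_conv_of_real prod.distrib of_real_prod)
  also have "\<dots> = (\<Prod>j\<in>UNIV. \<integral>s. G j s \<partial>lborel) / of_real (2 * pi) ^ CARD('n)"
    by (simp only: integral_divide_zero integral_lborel_prod_cart[OF G])
  also have "\<dots> = (\<Prod>j\<in>UNIV. (\<integral>s. G j s \<partial>lborel) / of_real (2*pi))"
    by (simp only: prod_dividef prod_constant)
  finally show ?thesis
    by (simp add: G_def integral_restrict_space)
qed

text \<open>By Fubini the mass is the product of the one-variable masses, and the product is continuous at \<open>(1, \<dots>, 1)\<close>.\<close>

lemma poisson_mass_tendsto:
  fixes \<alpha> \<beta> :: "complex ^ 'n::finite"
  assumes ab: "\<And>j. Re (\<alpha> $ j) + Re (\<beta> $ j) > -1"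
    and a: "\<And>j. \<alpha> $ j \<notin> {- of_nat k | k::nat. k \<ge> 1}"
    and b: "\<And>j. \<beta> $ j \<notin> {- of_nat k | k::nat. k \<ge> 1}"
    and e: "\<epsilon> > 0"
  shows "\<exists>\<delta>>0. \<forall>z. (\<forall>j. 1 - \<delta> < norm (z $ j) \<and> norm (z $ j) < 1) \<longrightarrow>
     norm ((\<integral>t. poisson_kernel \<alpha> \<beta> z (cis_vec t) \<partial>cube_measure) - 1) < \<epsilon>"
proof -
  have "continuous_on UNIV (\<lambda>w :: complex ^ 'n. \<Prod>j\<in>UNIV. w $ j)"
    by (intro continuous_on_prod continuous_on_component continuous_on_id)
  then have "continuous (at (\<chi> j. 1)) (\<lambda>w :: complex ^ 'n. \<Prod>j\<in>UNIV. w $ j)"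
    by (simp add: continuous_on_eq_continuous_at)
  then obtain d where d: "d > 0" "\<And>w :: complex ^ 'n. dist w (\<chi> j. 1) < d \<Longrightarrow> dist (\<Prod>j\<in>UNIV. w $ j) 1 < \<epsilon>"
    using e by (fastforce simp: continuous_at_eps_delta)
  define d' where "d' = d / real CARD('n)"
  have d': "d' > 0" using d by (simp add: d'_def)
  define I where "I j x = (\<integral>t. poisson_factor (\<alpha> $ j) (\<beta> $ j) x (cis t) \<partial>period_measure) / of_real (2*pi)" for j x
  have "\<forall>j. \<exists>\<delta>>0. \<forall>x. 1 - \<delta> < norm x \<longrightarrow> norm x < 1 \<longrightarrow> norm (I j x - 1) < d'"
    unfolding I_def by (intro allI period_integral_poisson_factor_tendsto ab a b d')
  then obtain \<delta> where \<delta>: "\<And>j. \<delta> j > 0" "\<And>j x. 1 - \<delta> j < norm x \<Longrightarrow> norm x < 1 \<Longrightarrow> norm (I j x - 1) < d'"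
    by metis
  show ?thesis
  proof (intro exI[of _ "Min (range \<delta>)"] conjI allI impI)
    show "0 < Min (range \<delta>)" using \<delta>(1) by (subst Min_gr_iff) auto
    fix z :: "complex ^ 'n" assume z: "\<forall>j. 1 - Min (range \<delta>) < norm (z $ j) \<and> norm (z $ j) < 1"
    have "norm (I j (z $ j) - 1) < d'" for j
    proof (rule \<delta>(2))
      have "Min (range \<delta>) \<le> \<delta> j" by simp
      then show "1 - \<delta> j < norm (z $ j)" using z[rule_format, of j] by linarith
    qed (use z in auto)
    then have "(\<Sum>j\<in>UNIV. norm (I j (z $ j) - 1)) < (\<Sum>j\<in>(UNIV :: 'n set). d')"
      by (intro sum_strict_mono) auto
    moreover have "dist (\<chi> j. I j (z $ j)) (\<chi> j. 1) \<le> (\<Sum>j\<in>UNIV. norm (I j (z $ j) - 1))"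
      unfolding dist_norm norm_vec_def by (rule order.trans[OF L2_set_le_sum]) auto
    ultimately have "dist (\<chi> j. I j (z $ j)) (\<chi> j. 1) < d"
      by (simp add: d'_def)
    then have "dist (\<Prod>j\<in>UNIV. (\<chi> j. I j (z $ j)) $ j) 1 < \<epsilon>" by (rule d(2))
    then show "norm ((\<integral>t. poisson_kernel \<alpha> \<beta> z (cis_vec t) \<partial>cube_measure) - 1) < \<epsilon>"
      using z by (simp add: cube_integral_poisson_kernel I_def dist_norm)
  qed
qed

section \<open>A weak type inequality for boxes of fixed shape\<close>

text \<open>The closed box around \<open>x\<close> with half side lengths \<open>a j * h\<close>: a fixed shape \<open>a\<close>, scaled by \<open>h\<close>.\<close>

definition scaled_box :: "('n \<Rightarrow> real) \<Rightarrow> real ^ 'n::finite \<Rightarrow> real \<Rightarrow> (real ^ 'n) set" where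
  "scaled_box a x h = {t. \<forall>j. \<bar>x $ j - t $ j\<bar> \<le> a j * h}"

lemma scaled_box_eq_cbox: "scaled_box a x h = cbox (\<chi> j. x $ j - a j * h) (\<chi> j. x $ j + a j * h)"
  by (auto simp: scaled_box_def mem_box_cart abs_le_iff algebra_simps)

lemma scaled_box_borel [measurable]: "scaled_box a x h \<in> sets borel"
  by (simp add: scaled_box_eq_cbox)

lemma emeasure_scaled_box:
  fixes x :: "real ^ 'n::finite"
  assumes "\<And>j. 0 \<le> a j" "0 \<le> h"
  shows "emeasure lborel (scaled_box a x h) = ennreal ((2 * h) ^ CARD('n) * (\<Prod>j\<in>UNIV. a j))"
proof -
  have "emeasure lborel (scaled_box a x h) = ennreal (\<Prod>j\<in>UNIV. (x $ j + a j * h) - (x $ j - a j * h))"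
    unfolding scaled_box_eq_cbox using assms by (subst emeasure_lborel_cbox_cart) auto
  also have "(\<Prod>j\<in>UNIV. (x $ j + a j * h) - (x $ j - a j * h)) = (\<Prod>j\<in>UNIV. (2 * h) * a j)"
    by (intro prod.cong) auto
  finally show ?thesis by (simp add: prod.distrib)
qed

text \<open>A weak type (1,1) inequality with a constant that does not depend on the shape \<open>a\<close>. Dividing the coordinates by \<open>a\<close> turns the boxes
where the bound fails into cubes; these lie in balls of radius \<open>n h\<close>, to which the covering lemma applies. The balls are selected disjoint,
so the corresponding boxes are disjoint and their \<open>\<nu>\<close> masses add up to at most the total mass, while the enlarged boxes cover every bad centre.\<close>

lemma scaled_box_weak_type:
  fixes a :: "'n::finite \<Rightarrow> real" and \<nu> :: "(real ^ 'n) measure"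
  assumes "finite_measure \<nu>" and sets [measurable_cong]: "sets \<nu> = sets borel"
    and a: "\<And>j. 0 < a j" and \<Lambda>: "0 < \<Lambda>"
  shows "\<exists>U\<in>sets borel. emeasure lborel U \<le> ennreal ((10 * real CARD('n)) ^ CARD('n) * measure \<nu> (space \<nu>) / \<Lambda>) \<and>
     (\<forall>x h. 0 < h \<longrightarrow> x \<notin> U \<longrightarrow> measure \<nu> (scaled_box a x h) \<le> \<Lambda> * (h ^ CARD('n) * (\<Prod>j\<in>UNIV. a j)))"
proof -
  interpret finite_measure \<nu> by fact
  define n where "n = CARD('n)"
  define p where "p = (\<Prod>j\<in>UNIV. a j)"
  define M where "M = measure \<nu> (space \<nu>)"
  have p: "p > 0" unfolding p_def using a by (intro prod_pos) auto
  have n: "n > 0" by (simp add: n_def)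
  have M0: "M \<ge> 0" by (simp add: M_def)
  define K where "K = {(x, h). 0 < h \<and> \<Lambda> * (h ^ n * p) < measure \<nu> (scaled_box a x h)}"
  define c where "c = (\<lambda>(x, h::real). \<chi> j. (x :: real ^ 'n) $ j / a j)"
  define r where "r = (\<lambda>(x :: real ^ 'n, h::real). real n * h)"
  \<comment> \<open>A bound for the radii: a box of large scale would need more mass than \<open>\<nu>\<close> has.\<close>
  define B where "B = real n * (1 + M / (\<Lambda> * p))"
  have rB: "0 < r i \<and> r i \<le> B" if "i \<in> K" for i
  proof -
    obtain x h where i: "i = (x, h)" by fastforce
    with that have h: "0 < h" and lt: "\<Lambda> * (h ^ n * p) < measure \<nu> (scaled_box a x h)" by (auto simp: K_def)
    have "measure \<nu> (scaled_box a x h) \<le> M"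
      unfolding M_def by (rule bounded_measure)
    with lt have "h ^ n < M / (\<Lambda> * p)" using \<Lambda> p by (simp add: field_simps)
    moreover have "h \<le> 1 + h ^ n"
    proof (cases "h \<le> 1")
      case True
      then show ?thesis using h by (simp add: add_increasing2)
    next
      case False
      then have "h ^ 1 \<le> h ^ n" using n by (intro power_increasing) auto
      then show ?thesis by simp
    qed
    ultimately have "h \<le> 1 + M / (\<Lambda> * p)" by linarith
    then show ?thesis using h n by (auto simp: i r_def B_def)
  qed
  obtain C where C: "countable C" "C \<subseteq> K"
     and disj: "pairwise (\<lambda>i j. disjnt (cball (c i) (r i)) (cball (c j) (r j))) C"
     and cov: "(\<Union>i\<in>K. cball (c i) (r i)) \<subseteq> (\<Union>i\<in>C. cball (c i) (5 * r i))"
    using Vitali_covering_lemma_cballs[where S = "\<Union>i\<in>K. cball (c i) (r i)" and K = K and a = c and r = r and B = B] rB by blast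
  define S where "S = (\<lambda>(x, h). scaled_box a x h)"
  \<comment> \<open>A ball enlarged five times, of radius \<open>5 n h\<close>, is again covered by a box of the given shape.\<close>
  define T where "T = (\<lambda>(x, h). scaled_box a x (5 * real n * h))"
  have in_ball: "(\<chi> j. t $ j / a j) \<in> cball (c (x, h)) (r (x, h))" if "t \<in> scaled_box a x h" for x t h
  proof -
    have "dist (c (x, h)) (\<chi> j. t $ j / a j) \<le> (\<Sum>j\<in>UNIV. \<bar>(c (x, h) - (\<chi> j. t $ j / a j)) $ j\<bar>)"
      unfolding dist_norm by (rule norm_le_l1_cart)
    also have "\<dots> \<le> (\<Sum>j\<in>(UNIV::'n set). h)"
    proof (rule sum_mono)
      fix j
      have "\<bar>(c (x, h) - (\<chi> j. t $ j / a j)) $ j\<bar> = \<bar>x $ j - t $ j\<bar> / a j"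
        using a[of j] by (simp add: c_def abs_divide flip: diff_divide_distrib)
      also have "\<dots> \<le> h" using that a[of j] by (auto simp: scaled_box_def field_simps)
      finally show "\<bar>(c (x, h) - (\<chi> j. t $ j / a j)) $ j\<bar> \<le> h" .
    qed
    finally show ?thesis by (simp add: r_def n_def)
  qed
  have disjS: "disjoint_family_on S C"
    unfolding disjoint_family_on_def
  proof (intro ballI impI)
    fix i k assume ik: "i \<in> C" "k \<in> C" "i \<noteq> k"
    then have "disjnt (cball (c i) (r i)) (cball (c k) (r k))" using disj by (auto simp: pairwise_def)
    moreover have "(\<chi> j. t $ j / a j) \<in> cball (c i) (r i)" if "t \<in> S i" for t i
      using that in_ball[of t "fst i" "snd i"] by (simp add: S_def split_beta)
    ultimately have "\<not> (t \<in> S i \<and> t \<in> S k)" for t unfolding disjnt_iff by metis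
    then show "S i \<inter> S k = {}" by blast
  qed
  define U where "U = (\<Union>i\<in>C. T i)"
  have Tm: "T i \<in> sets borel" for i by (cases i) (simp add: T_def)
  have Um: "U \<in> sets borel"
    unfolding U_def using C(1) Tm by (intro sets.countable_UN') auto
  have bound: "emeasure lborel (T i) \<le> ennreal ((10 * real n) ^ n / \<Lambda>) * emeasure \<nu> (S i)" if iC: "i \<in> C" for i
  proof -
    obtain x h where i: "i = (x, h)" by fastforce
    with iC C(2) have h: "0 < h" and lt: "\<Lambda> * (h ^ n * p) < measure \<nu> (scaled_box a x h)" by (auto simp: K_def)
    have "emeasure lborel (T i) = ennreal ((2 * (5 * real n * h)) ^ n * p)"
      unfolding i T_def prod.case n_def p_def using a h by (intro emeasure_scaled_box) (auto intro: less_imp_le)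
    also have "2 * (5 * real n * h) = (10 * real n) * h" by simp
    also have "((10 * real n) * h) ^ n * p = (10 * real n) ^ n / \<Lambda> * (\<Lambda> * (h ^ n * p))"
      using \<Lambda> by (simp add: power_mult_distrib[of "10 * real n" h])
    also have "\<dots> \<le> (10 * real n) ^ n / \<Lambda> * measure \<nu> (scaled_box a x h)"
      using lt \<Lambda> by (intro mult_left_mono) auto
    finally show ?thesis
      using \<Lambda> by (simp add: i S_def emeasure_eq_measure ennreal_mult' [symmetric] ennreal_leI flip: times_divide_eq_left)
  qed
  \<comment> \<open>An enumeration of \<open>C\<close> without repetitions, so that disjointness survives.\<close>
  define I where "I = to_nat_on C ` C"
  define g where "g = from_nat_into C"
  have gC: "g m \<in> C" if "m \<in> I" for m
    using that C(1) by (auto simp: I_def g_def)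
  have g_inj: "m = m'" if "m \<in> I" "m' \<in> I" "g m = g m'" for m m'
    using that C(1) by (auto simp: I_def g_def)
  have gsurj: "\<exists>m\<in>I. g m = i" if "i \<in> C" for i
    using that C(1) by (auto simp: I_def g_def)
  define T' where "T' m = (if m \<in> I then T (g m) else {})" for m
  define S' where "S' m = (if m \<in> I then S (g m) else {})" for m
  have "U = (\<Union>m. T' m)"
  proof (intro set_eqI iffI)
    fix y assume "y \<in> U"
    then obtain i where "i \<in> C" "y \<in> T i" by (auto simp: U_def)
    moreover then obtain m where "m \<in> I" "g m = i" using gsurj by blast
    ultimately have "y \<in> T' m" by (simp add: T'_def)
    then show "y \<in> (\<Union>m. T' m)" by blast
  next
    fix y assume "y \<in> (\<Union>m. T' m)"
    then obtain m where "y \<in> T' m" by blast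
    then have "m \<in> I" "y \<in> T (g m)" by (auto simp: T'_def split: if_splits)
    then show "y \<in> U" using gC by (auto simp: U_def)
  qed
  moreover have "range T' \<subseteq> sets lborel" by (rule image_subsetI) (metis T'_def Tm sets.empty_sets sets_lborel)
  ultimately have "emeasure lborel U \<le> (\<Sum>m. emeasure lborel (T' m))"
    by (simp only: emeasure_subadditive_countably)
  also have "\<dots> \<le> (\<Sum>m. ennreal ((10 * real n) ^ n / \<Lambda>) * emeasure \<nu> (S' m))"
    by (intro suminf_le summableI) (metis T'_def S'_def bound gC emeasure_empty zero_le)
  also have "\<dots> = ennreal ((10 * real n) ^ n / \<Lambda>) * (\<Sum>m. emeasure \<nu> (S' m))"
    by simp
  also have "(\<Sum>m. emeasure \<nu> (S' m)) = emeasure \<nu> (\<Union>m. S' m)"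
  proof (rule suminf_emeasure)
    show "range S' \<subseteq> sets \<nu>" by (auto simp: S'_def S_def sets split: prod.splits)
    show "disjoint_family S'"
      using disjS g_inj gC unfolding disjoint_family_on_def S'_def by (metis Int_empty_left Int_empty_right)
  qed
  also have "\<dots> \<le> ennreal M"
    unfolding M_def by (metis emeasure_eq_measure emeasure_space)
  finally have Ub: "emeasure lborel U \<le> ennreal ((10 * real n) ^ n * M / \<Lambda>)"
    using \<Lambda> M0 by (simp add: mult_left_mono ennreal_mult'[symmetric])
  have "measure \<nu> (scaled_box a x h) \<le> \<Lambda> * (h ^ n * p)" if h: "0 < h" and x: "x \<notin> U" for x h
  proof (rule ccontr)
    assume "\<not> ?thesis"
    then have k: "(x, h) \<in> K" using h by (auto simp: K_def)
    have "c (x, h) \<in> cball (c (x, h)) (r (x, h))" using rB[OF k] by simp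
    then obtain i where i: "i \<in> C" "c (x, h) \<in> cball (c i) (5 * r i)" using cov k by blast
    obtain x' h' where i': "i = (x', h')" by fastforce
    have "\<bar>x' $ j - x $ j\<bar> \<le> a j * (5 * real n * h')" for j
    proof -
      have "\<bar>(c i - c (x, h)) $ j\<bar> \<le> norm (c i - c (x, h))" by (rule component_le_norm_cart)
      also have "\<dots> \<le> 5 * r i" using i(2) by (simp add: dist_norm)
      finally have "\<bar>x' $ j - x $ j\<bar> / a j \<le> 5 * real n * h'"
        using a[of j] by (simp add: i' c_def r_def abs_divide flip: diff_divide_distrib)
      then show ?thesis using a[of j] by (simp add: field_simps)
    qed
    then have "x \<in> T i" by (simp add: T_def i' scaled_box_def)
    with i(1) x show False by (auto simp: U_def)
  qed
  then show ?thesis using Um Ub unfolding n_def p_def M_def by blast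
qed

section \<open>The dyadic majorant\<close>

text \<open>The product of the one-dimensional profiles \<open>h\<^sup>\<sigma> / (h + \<bar>x\<^sub>j\<bar>)\<^bsup>\<sigma>+1\<^esup>\<close>, an approximate identity at scale \<open>h\<close> that is common
to all coordinates.\<close>

definition majorant :: "real \<Rightarrow> real \<Rightarrow> real ^ 'n::finite \<Rightarrow> real" where
  "majorant \<sigma> h x = (\<Prod>j\<in>UNIV. h powr \<sigma> / (h + \<bar>x $ j\<bar>) powr (\<sigma> + 1))"

lemma majorant_nonneg: "0 \<le> majorant \<sigma> h x"
  unfolding majorant_def by (intro prod_nonneg) auto

lemma borel_measurable_majorant [measurable]: "majorant \<sigma> h \<in> borel_measurable borel"
  unfolding majorant_def[abs_def] by measurable

lemma two_powr_less_one: "x < 0 \<Longrightarrow> 2 powr x < (1::real)"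
  using powr_less_mono[of x 0 2] by simp

text \<open>The smallest \<open>k\<close> with \<open>s \<le> 2\<^sup>k h\<close> works, since then \<open>h + s\<close> is at least half of \<open>2\<^sup>k h\<close>.\<close>

lemma dyadic_scale_exists:
  fixes h s \<sigma> :: real
  assumes h: "0 < h" and s: "0 \<le> s" and \<sigma>: "0 < \<sigma>"
  shows "\<exists>k::nat. s \<le> 2 ^ k * h \<and>
     h powr \<sigma> / (h + s) powr (\<sigma> + 1) \<le> 2 powr (\<sigma> + 1) * ((2 powr (- \<sigma>)) ^ k / (2 ^ k * h))"
proof -
  obtain k0 :: nat where "s / h < 2 ^ k0" using real_arch_pow[of 2 "s / h"] by auto
  then have ex: "s \<le> 2 ^ k0 * h" using h by (simp add: field_simps)
  define k where "k = (LEAST k::nat. s \<le> 2 ^ k * h)"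
  have k: "s \<le> 2 ^ k * h" unfolding k_def using ex by (rule LeastI)
  have ge: "2 ^ k * h / 2 \<le> h + s"
  proof (cases k)
    case 0
    then show ?thesis using h s by simp
  next
    case (Suc m)
    then have "\<not> s \<le> 2 ^ m * h" unfolding k_def using not_less_Least[of m "\<lambda>k. s \<le> 2 ^ k * h"] by simp
    then show ?thesis using Suc h by simp
  qed
  have "h powr \<sigma> / (h + s) powr (\<sigma> + 1) \<le> h powr \<sigma> / (2 ^ k * h / 2) powr (\<sigma> + 1)"
    using h s \<sigma> ge by (intro divide_left_mono powr_mono2 mult_pos_pos) auto
  also have "\<dots> = 2 powr (\<sigma> + 1) * ((2 powr (- \<sigma>)) ^ k / (2 ^ k * h))"
  proof -
    have "(2 ^ k :: real) powr \<sigma> = (2 powr real k) powr \<sigma>" by (simp add: powr_realpow)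
    also have "\<dots> = (2 powr \<sigma>) powr real k" by (simp only: powr_powr mult.commute)
    also have "\<dots> = (2 powr \<sigma>) ^ k" by (rule powr_realpow) simp
    finally have e: "(2 ^ k :: real) powr \<sigma> = (2 powr \<sigma>) ^ k" .
    have "(2 ^ k * h / 2) powr (\<sigma> + 1) = (2 powr \<sigma>) ^ k * 2 ^ k * (h powr \<sigma> * h) / 2 powr (\<sigma> + 1)"
      using h by (simp add: powr_divide powr_mult e powr_add)
    then show ?thesis using h by (simp add: powr_minus field_simps power_inverse)
  qed
  finally show ?thesis using k by blast
qed

lemma majorant_le_dyadic:
  fixes x t :: "real ^ 'n::finite"
  assumes h: "0 < h" and \<sigma>: "0 < \<sigma>"
  shows "\<exists>g :: 'n \<Rightarrow> nat. t \<in> scaled_box (\<lambda>j. 2 ^ g j) x h \<and>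
    majorant \<sigma> h (x - t) \<le> (2 powr (\<sigma> + 1)) ^ CARD('n) * (\<Prod>j\<in>UNIV. (2 powr (- \<sigma>)) ^ g j / (2 ^ g j * h))"
proof -
  have "\<forall>j. \<exists>k::nat. \<bar>(x - t) $ j\<bar> \<le> 2 ^ k * h \<and>
     h powr \<sigma> / (h + \<bar>(x - t) $ j\<bar>) powr (\<sigma> + 1) \<le> 2 powr (\<sigma> + 1) * ((2 powr (- \<sigma>)) ^ k / (2 ^ k * h))"
    by (intro allI dyadic_scale_exists h \<sigma>) auto
  then obtain g :: "'n \<Rightarrow> nat" where g: "\<And>j. \<bar>(x - t) $ j\<bar> \<le> 2 ^ g j * h"
     "\<And>j. h powr \<sigma> / (h + \<bar>(x - t) $ j\<bar>) powr (\<sigma> + 1) \<le> 2 powr (\<sigma> + 1) * ((2 powr (- \<sigma>)) ^ g j / (2 ^ g j * h))"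
    by metis
  have "majorant \<sigma> h (x - t) \<le> (\<Prod>j\<in>UNIV. 2 powr (\<sigma> + 1) * ((2 powr (- \<sigma>)) ^ g j / (2 ^ g j * h)))"
    unfolding majorant_def by (intro prod_mono) (use g(2) in auto)
  also have "\<dots> = (2 powr (\<sigma> + 1)) ^ CARD('n) * (\<Prod>j\<in>UNIV. (2 powr (- \<sigma>)) ^ g j / (2 ^ g j * h))"
    by (simp only: prod.distrib prod_constant)
  finally show ?thesis using g(1) by (intro exI[of _ g]) (auto simp: scaled_box_def)
qed

text \<open>The vectors of dyadic exponents up to \<open>N\<close>. Sums over all exponent vectors are taken as limits of sums over these finite sets.\<close>

abbreviation exponents :: "nat \<Rightarrow> ('n::finite \<Rightarrow> nat) set" where
  "exponents N \<equiv> Pi\<^sub>E UNIV (\<lambda>_. {..N})"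

lemma finite_exponents: "finite (exponents N :: ('n::finite \<Rightarrow> nat) set)"
  by (intro finite_PiE) auto

lemma exponents_mono: "N \<le> N' \<Longrightarrow> exponents N \<subseteq> (exponents N' :: ('n::finite \<Rightarrow> nat) set)"
  by (intro PiE_mono) auto

lemma in_exponents: "(g :: 'n::finite \<Rightarrow> nat) \<in> exponents (Max (range g))"
  by (auto simp: PiE_def)

text \<open>The sum over vectors factors into a product of geometric sums.\<close>

lemma sum_exponents_le:
  fixes q :: real
  assumes q: "0 \<le> q" "q < 1"
  shows "(\<Sum>g\<in>(exponents N :: ('n::finite \<Rightarrow> nat) set). \<Prod>j\<in>UNIV. q ^ g j) \<le> (1 / (1 - q)) ^ CARD('n)"
proof -
  have "(\<Sum>g\<in>(exponents N :: ('n::finite \<Rightarrow> nat) set). \<Prod>j\<in>UNIV. q ^ g j) = (\<Prod>j\<in>(UNIV :: 'n set). \<Sum>k\<in>{..N}. q ^ k)"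
    by (rule prod_sum_PiE[symmetric]) auto
  also have "\<dots> = (\<Sum>k\<le>N. q ^ k) ^ CARD('n)" by simp
  also have "\<dots> \<le> (1 / (1 - q)) ^ CARD('n)"
  proof (intro power_mono sum_nonneg)
    have "(\<Sum>k\<le>N. q ^ k) \<le> (\<Sum>k. q ^ k)"
      using q by (intro sum_le_suminf summable_geometric) auto
    then show "(\<Sum>k\<le>N. q ^ k) \<le> 1 / (1 - q)" using q by (simp add: suminf_geometric)
  qed (use q in auto)
  finally show ?thesis .
qed

text \<open>If the averages of \<open>\<nu>\<close> over the dyadic boxes around \<open>x\<close> grow with a rate \<open>\<tau>\<close> below \<open>\<sigma>\<close>, the weights of the dyadic decomposition
of the majorant win and the sum converges. For Lebesgue measure this is used with \<open>\<tau> = 0\<close>, for the maximal inequality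
with \<open>\<tau> = \<sigma> / 2\<close>.\<close>

lemma nn_integral_majorant_le:
  fixes x :: "real ^ 'n::finite" and \<nu> :: "(real ^ 'n) measure"
  assumes sets [measurable_cong]: "sets \<nu> = sets borel"
    and h: "0 < h" and \<sigma>: "0 < \<sigma>" and \<tau>: "\<tau> < \<sigma>" and L: "0 \<le> L"
    and scaled_box: "\<And>g :: 'n \<Rightarrow> nat. emeasure \<nu> (scaled_box (\<lambda>j. 2 ^ g j) x h)
        \<le> ennreal (L * (\<Prod>j\<in>UNIV. (2 powr \<tau>) ^ g j) * (h ^ CARD('n) * (\<Prod>j\<in>UNIV. 2 ^ g j)))"
  shows "(\<integral>\<^sup>+t. ennreal (majorant \<sigma> h (x - t)) \<partial>\<nu>)
     \<le> ennreal ((2 powr (\<sigma> + 1)) ^ CARD('n) * L * (1 / (1 - 2 powr (\<tau> - \<sigma>))) ^ CARD('n))"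
proof -
  define D where "D = (2 powr (\<sigma> + 1)) ^ CARD('n)"
  define p where "p = 2 powr (\<tau> - \<sigma>)"
  have D: "D \<ge> 0" by (simp add: D_def)
  have p: "0 \<le> p" "p < 1" using \<tau> by (auto simp: p_def two_powr_less_one)
  define c where "c g = D * (\<Prod>j\<in>UNIV. (2 powr (- \<sigma>)) ^ g j / (2 ^ g j * h))" for g :: "'n \<Rightarrow> nat"
  have c0: "c g \<ge> 0" for g unfolding c_def using D h by (intro mult_nonneg_nonneg prod_nonneg) auto
  define F where "F N t = (\<Sum>g\<in>exponents N. ennreal (c g) * indicator (scaled_box (\<lambda>j. 2 ^ g j) x h) t)" for N t
  have Fm [measurable]: "F N \<in> borel_measurable \<nu>" for N unfolding F_def by measurable
  have "incseq F"
    unfolding F_def by (intro incseq_SucI le_funI sum_mono2 finite_exponents exponents_mono) auto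
  have le: "ennreal (majorant \<sigma> h (x - t)) \<le> (SUP N. F N t)" for t
  proof -
    obtain g :: "'n \<Rightarrow> nat" where g: "t \<in> scaled_box (\<lambda>j. 2 ^ g j) x h" "majorant \<sigma> h (x - t) \<le> c g"
      using majorant_le_dyadic[OF h \<sigma>, of t x] unfolding c_def D_def by blast
    have "ennreal (majorant \<sigma> h (x - t)) \<le> ennreal (c g) * indicator (scaled_box (\<lambda>j. 2 ^ g j) x h) t"
      using g by (simp add: ennreal_leI)
    also have "\<dots> \<le> F (Max (range g)) t"
      unfolding F_def by (rule member_le_sum[OF in_exponents _ finite_exponents]) simp
    also have "\<dots> \<le> (SUP N. F N t)" by (rule SUP_upper) simp
    finally show ?thesis .
  qed
  have int: "(\<integral>\<^sup>+t. F N t \<partial>\<nu>) \<le> ennreal (D * L * (1 / (1 - p)) ^ CARD('n))" for N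
  proof -
    have "(\<integral>\<^sup>+t. F N t \<partial>\<nu>) = (\<Sum>g\<in>exponents N. ennreal (c g) * emeasure \<nu> (scaled_box (\<lambda>j. 2 ^ g j) x h))"
      unfolding F_def by (subst nn_integral_sum) (auto simp: nn_integral_cmult_indicator)
    also have "\<dots> \<le> (\<Sum>g\<in>(exponents N :: ('n \<Rightarrow> nat) set). ennreal (D * L * (\<Prod>j\<in>UNIV. p ^ g j)))"
    proof (rule sum_mono)
      fix g :: "'n \<Rightarrow> nat"
      have "ennreal (c g) * emeasure \<nu> (scaled_box (\<lambda>j. 2 ^ g j) x h)
        \<le> ennreal (c g) * ennreal (L * (\<Prod>j\<in>UNIV. (2 powr \<tau>) ^ g j) * (h ^ CARD('n) * (\<Prod>j\<in>UNIV. 2 ^ g j)))"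
        by (intro mult_left_mono scaled_box) simp
      also have "\<dots> = ennreal (c g * (L * (\<Prod>j\<in>UNIV. (2 powr \<tau>) ^ g j) * (h ^ CARD('n) * (\<Prod>j\<in>UNIV. 2 ^ g j))))"
        using c0 by (simp add: ennreal_mult')
      also have "c g * (L * (\<Prod>j\<in>UNIV. (2 powr \<tau>) ^ g j) * (h ^ CARD('n) * (\<Prod>j\<in>UNIV. 2 ^ g j)))
         = D * L * (\<Prod>j\<in>UNIV. (2 powr (- \<sigma>)) ^ g j / (2 ^ g j * h) * (2 powr \<tau>) ^ g j * (h * 2 ^ g j))"
        by (simp add: c_def prod.distrib prod_dividef)
      also have "(\<Prod>j\<in>UNIV. (2 powr (- \<sigma>)) ^ g j / (2 ^ g j * h) * (2 powr \<tau>) ^ g j * (h * 2 ^ g j)) = (\<Prod>j\<in>UNIV. p ^ g j)"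
      proof (rule prod.cong)
        fix j
        have "p = 2 powr (-\<sigma>) * 2 powr \<tau>" by (simp add: p_def flip: powr_add)
        then show "(2 powr (- \<sigma>)) ^ g j / (2 ^ g j * h) * (2 powr \<tau>) ^ g j * (h * 2 ^ g j) = p ^ g j"
          using h by (simp add: power_mult_distrib)
      qed simp
      finally show "ennreal (c g) * emeasure \<nu> (scaled_box (\<lambda>j. 2 ^ g j) x h) \<le> ennreal (D * L * (\<Prod>j\<in>UNIV. p ^ g j))" .
    qed
    also have "\<dots> = ennreal (D * L * (\<Sum>g\<in>(exponents N :: ('n \<Rightarrow> nat) set). \<Prod>j\<in>UNIV. p ^ g j))"
      using D L p by (subst sum_ennreal) (auto simp: sum_distrib_left intro!: mult_nonneg_nonneg prod_nonneg)
    also have "\<dots> \<le> ennreal (D * L * (1 / (1 - p)) ^ CARD('n))"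
      using D L p by (intro ennreal_leI mult_left_mono sum_exponents_le) auto
    finally show ?thesis .
  qed
  have "(\<integral>\<^sup>+t. ennreal (majorant \<sigma> h (x - t)) \<partial>\<nu>) \<le> (\<integral>\<^sup>+t. (SUP N. F N t) \<partial>\<nu>)"
    by (intro nn_integral_mono le)
  also have "\<dots> = (SUP N. \<integral>\<^sup>+t. F N t \<partial>\<nu>)"
    by (rule nn_integral_monotone_convergence_SUP[OF \<open>incseq F\<close>]) measurable
  also have "\<dots> \<le> ennreal (D * L * (1 / (1 - p)) ^ CARD('n))"
    by (intro SUP_least int)
  finally show ?thesis unfolding D_def p_def .
qed

lemma nn_integral_majorant_lborel_bounded:
  assumes \<sigma>: "0 < \<sigma>"
  shows "\<exists>C\<ge>0. \<forall>(x :: real ^ 'n::finite) h. 0 < h \<longrightarrow> (\<integral>\<^sup>+t. ennreal (majorant \<sigma> h (x - t)) \<partial>lborel) \<le> ennreal C"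
proof (intro exI conjI allI impI)
  let ?C = "(2 powr (\<sigma> + 1)) ^ CARD('n) * 2 ^ CARD('n) * (1 / (1 - 2 powr (0 - \<sigma>))) ^ CARD('n)"
  show "?C \<ge> 0" using \<sigma> two_powr_less_one[of "- \<sigma>"] by (intro mult_nonneg_nonneg zero_le_power) auto
  fix x :: "real ^ 'n" and h :: real assume h: "0 < h"
  show "(\<integral>\<^sup>+t. ennreal (majorant \<sigma> h (x - t)) \<partial>lborel) \<le> ennreal ?C"
  proof (rule nn_integral_majorant_le[OF _ h \<sigma> \<sigma>])
    fix g :: "'n \<Rightarrow> nat"
    show "emeasure lborel (scaled_box (\<lambda>j. 2 ^ g j) x h)
        \<le> ennreal (2 ^ CARD('n) * (\<Prod>j\<in>UNIV. (2 powr 0) ^ g j) * (h ^ CARD('n) * (\<Prod>j\<in>UNIV. 2 ^ g j)))"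
      using h by (subst emeasure_scaled_box) (auto simp: power_mult_distrib mult_ac)
  qed auto
qed

text \<open>The maximal inequality. The exceptional set is the union over all exponent vectors \<open>g\<close> of the exceptional sets for the boxes of
shape \<open>2\<^bsup>g\<^esup>\<close> at level \<open>L 2\<^bsup>\<tau> \<Sum> g\<^esup>\<close> with \<open>\<tau> = \<sigma> / 2\<close>. Half of the decay \<open>\<sigma>\<close> pays for the measure of the
union, the other half for the sum of the averages.\<close>

theorem majorant_weak_type:
  assumes \<sigma>: "0 < \<sigma>"
  shows "\<exists>C\<ge>0. \<forall>(\<nu> :: (real ^ 'n::finite) measure) \<Lambda>. finite_measure \<nu> \<longrightarrow> sets \<nu> = sets borel \<longrightarrow> 0 < \<Lambda> \<longrightarrow>
    (\<exists>U\<in>sets borel. emeasure lborel U \<le> ennreal (C * measure \<nu> (space \<nu>) / \<Lambda>) \<and>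
       (\<forall>x h. 0 < h \<longrightarrow> x \<notin> U \<longrightarrow> (\<integral>\<^sup>+t. ennreal (majorant \<sigma> h (x - t)) \<partial>\<nu>) \<le> ennreal \<Lambda>))"
proof -
  define n where "n = CARD('n)"
  define \<tau> where "\<tau> = \<sigma> / 2"
  have \<tau>: "\<tau> < \<sigma>" "0 < \<tau>" using \<sigma> by (auto simp: \<tau>_def)
  define p where "p = 2 powr (- \<tau>)"
  have p: "0 < p" "p < 1" using \<tau> by (auto simp: p_def two_powr_less_one)
  have p': "2 powr (\<tau> - \<sigma>) = p" by (simp add: p_def \<tau>_def)
  define E where "E = (1 / (1 - p)) ^ n"
  define D where "D = (2 powr (\<sigma> + 1)) ^ n * E"
  have E: "E > 0" using p by (simp add: E_def)
  have D: "D > 0" using E by (simp add: D_def)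
  define C where "C = (10 * real n) ^ n * D * E"
  show ?thesis
  proof (intro exI[of _ C] conjI allI impI)
    show "0 \<le> C" using D E by (simp add: C_def)
    fix \<nu> :: "(real ^ 'n) measure" and \<Lambda> :: real
    assume fin: "finite_measure \<nu>" and sets: "sets \<nu> = sets borel" and \<Lambda>: "0 < \<Lambda>"
    interpret finite_measure \<nu> by fact
    \<comment> \<open>\<open>D\<close> is the constant lost in the summation of the averages, so the final bound is \<open>\<Lambda>\<close>.\<close>
    define L where "L = \<Lambda> / D"
    have L: "L > 0" using \<Lambda> D by (simp add: L_def)
    define M where "M = measure \<nu> (space \<nu>)"
    have M: "0 \<le> M" by (simp add: M_def)
    have "\<forall>g :: 'n \<Rightarrow> nat. \<exists>U. U \<in> sets borel \<and>
       emeasure lborel U \<le> ennreal ((10 * real n) ^ n * M / (L * (\<Prod>j\<in>UNIV. (2 powr \<tau>) ^ g j))) \<and>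
     (\<forall>x h. 0 < h \<longrightarrow> x \<notin> U \<longrightarrow> measure \<nu> (scaled_box (\<lambda>j. 2 ^ g j) x h) \<le> L * (\<Prod>j\<in>UNIV. (2 powr \<tau>) ^ g j) * (h ^ CARD('n) * (\<Prod>j\<in>UNIV. 2 ^ g j)))"
    proof
      fix g :: "'n \<Rightarrow> nat"
      have "0 < L * (\<Prod>j\<in>UNIV. (2 powr \<tau>) ^ g j)" using L by (intro mult_pos_pos prod_pos) auto
      from scaled_box_weak_type[OF fin sets _ this, of "\<lambda>j. 2 ^ g j"]
      show "\<exists>U. U \<in> sets borel \<and>
       emeasure lborel U \<le> ennreal ((10 * real n) ^ n * M / (L * (\<Prod>j\<in>UNIV. (2 powr \<tau>) ^ g j))) \<and>
     (\<forall>x h. 0 < h \<longrightarrow> x \<notin> U \<longrightarrow> measure \<nu> (scaled_box (\<lambda>j. 2 ^ g j) x h) \<le> L * (\<Prod>j\<in>UNIV. (2 powr \<tau>) ^ g j) * (h ^ CARD('n) * (\<Prod>j\<in>UNIV. 2 ^ g j)))"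
        unfolding n_def M_def by auto
    qed
    then obtain U where U: "\<And>g :: 'n \<Rightarrow> nat. U g \<in> sets borel"
       and Ub: "\<And>g. emeasure lborel (U g) \<le> ennreal ((10 * real n) ^ n * M / (L * (\<Prod>j\<in>UNIV. (2 powr \<tau>) ^ g j)))"
       and Us: "\<And>g x h. 0 < h \<Longrightarrow> x \<notin> U g \<Longrightarrow> measure \<nu> (scaled_box (\<lambda>j. 2 ^ g j) x h) \<le> L * (\<Prod>j\<in>UNIV. (2 powr \<tau>) ^ g j) * (h ^ CARD('n) * (\<Prod>j\<in>UNIV. 2 ^ g j))"
      by metis
    define V where "V N = (\<Union>g\<in>exponents N. U g)" for N
    have Vm: "V N \<in> sets borel" for N
      unfolding V_def using U by (intro sets.finite_UN finite_exponents)
    have inc: "incseq V"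
      unfolding V_def by (intro incseq_SucI UN_mono exponents_mono) auto
    have Veq: "(\<Union>N. V N) = (\<Union>g. U g)"
      unfolding V_def using in_exponents by blast
    have Vb: "emeasure lborel (V N) \<le> ennreal (C * M / \<Lambda>)" for N
    proof -
      have "emeasure lborel (V N) \<le> (\<Sum>g\<in>exponents N. emeasure lborel (U g))"
        unfolding V_def using U by (intro emeasure_subadditive_finite finite_exponents) auto
      also have "\<dots> \<le> (\<Sum>g\<in>(exponents N :: ('n \<Rightarrow> nat) set). ennreal ((10 * real n) ^ n * M / L * (\<Prod>j\<in>UNIV. p ^ g j)))"
      proof (rule sum_mono)
        fix g :: "'n \<Rightarrow> nat"
        have "(10 * real n) ^ n * M / (L * (\<Prod>j\<in>UNIV. (2 powr \<tau>) ^ g j)) = (10 * real n) ^ n * M / L * (\<Prod>j\<in>UNIV. p ^ g j)"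
          by (simp add: p_def powr_minus power_inverse prod_inversef divide_inverse flip: prod_inversef)
        then show "emeasure lborel (U g) \<le> ennreal ((10 * real n) ^ n * M / L * (\<Prod>j\<in>UNIV. p ^ g j))"
          using Ub[of g] by simp
      qed
      also have "\<dots> = ennreal ((10 * real n) ^ n * M / L * (\<Sum>g\<in>(exponents N :: ('n \<Rightarrow> nat) set). \<Prod>j\<in>UNIV. p ^ g j))"
        using L M p by (subst sum_ennreal) (auto simp: sum_distrib_left intro!: mult_nonneg_nonneg divide_nonneg_nonneg prod_nonneg)
      also have "\<dots> \<le> ennreal ((10 * real n) ^ n * M / L * E)"
        unfolding E_def n_def using L M p by (intro ennreal_leI mult_left_mono sum_exponents_le) auto
      also have "(10 * real n) ^ n * M / L * E = C * M / \<Lambda>"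
        by (simp add: C_def L_def)
      finally show ?thesis .
    qed
    show "\<exists>W\<in>sets borel. emeasure lborel W \<le> ennreal (C * measure \<nu> (space \<nu>) / \<Lambda>) \<and>
       (\<forall>x h. 0 < h \<longrightarrow> x \<notin> W \<longrightarrow> (\<integral>\<^sup>+t. ennreal (majorant \<sigma> h (x - t)) \<partial>\<nu>) \<le> ennreal \<Lambda>)"
    proof (intro bexI[of _ "\<Union>N. V N"] conjI allI impI)
      have "emeasure lborel (\<Union>N. V N) = (SUP N. emeasure lborel (V N))"
        using Vm inc by (intro SUP_emeasure_incseq[symmetric]) auto
      also have "\<dots> \<le> ennreal (C * M / \<Lambda>)" by (intro SUP_least Vb)
      finally show "emeasure lborel (\<Union>N. V N) \<le> ennreal (C * measure \<nu> (space \<nu>) / \<Lambda>)" by (simp add: M_def)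
      show "(\<Union>N. V N) \<in> sets borel" using Vm by auto
      fix x :: "real ^ 'n" and h :: real assume h: "0 < h" and x: "x \<notin> (\<Union>N. V N)"
      have "(\<integral>\<^sup>+t. ennreal (majorant \<sigma> h (x - t)) \<partial>\<nu>) \<le> ennreal ((2 powr (\<sigma> + 1)) ^ CARD('n) * L * (1 / (1 - 2 powr (\<tau> - \<sigma>))) ^ CARD('n))"
      proof (rule nn_integral_majorant_le[OF sets h \<sigma> \<tau>(1)])
        fix g :: "'n \<Rightarrow> nat"
        have "x \<notin> U g" using x unfolding Veq by blast
        from Us[OF h this] show "emeasure \<nu> (scaled_box (\<lambda>j. 2 ^ g j) x h)
        \<le> ennreal (L * (\<Prod>j\<in>UNIV. (2 powr \<tau>) ^ g j) * (h ^ CARD('n) * (\<Prod>j\<in>UNIV. 2 ^ g j)))"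
          by (simp add: emeasure_eq_measure ennreal_leI)
      qed (use L in auto)
      also have "(2 powr (\<sigma> + 1)) ^ CARD('n) * L * (1 / (1 - 2 powr (\<tau> - \<sigma>))) ^ CARD('n) = \<Lambda>"
        unfolding p' using D p by (simp add: L_def D_def E_def n_def)
      finally show "(\<integral>\<^sup>+t. ennreal (majorant \<sigma> h (x - t)) \<partial>\<nu>) \<le> ennreal \<Lambda>" .
    qed
  qed
qed

section \<open>Kernel bounds on restricted Stolz regions\<close>

text \<open>The argument of \<open>w\<close> is at most \<open>\<pi>\<close>, so the imaginary part of the exponent changes the modulus by a bounded factor only.\<close>

lemma norm_powr_bounds:
  fixes w c :: complex
  assumes w: "w \<noteq> 0"
  shows "norm w powr Re c * exp (- (pi * \<bar>Im c\<bar>)) \<le> norm (w powr c)"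
    and "norm (w powr c) \<le> norm w powr Re c * exp (pi * \<bar>Im c\<bar>)"
proof -
  have "\<bar>Im (Ln w)\<bar> \<le> pi" using mpi_less_Im_Ln[OF w] Im_Ln_le_pi[OF w] by (simp add: abs_le_iff)
  then have "\<bar>Im c * Im (Ln w)\<bar> \<le> \<bar>Im c\<bar> * pi" by (simp add: abs_mult mult_left_mono)
  then have b: "- (pi * \<bar>Im c\<bar>) \<le> - (Im c * Im (Ln w))" "- (Im c * Im (Ln w)) \<le> pi * \<bar>Im c\<bar>"
    by (auto simp: abs_le_iff mult.commute)
  have n: "norm (w powr c) = norm w powr Re c * exp (- (Im c * Im (Ln w)))"
    using w by (simp add: powr_def exp_diff exp_minus divide_inverse flip: exp_add)
  show "norm w powr Re c * exp (- (pi * \<bar>Im c\<bar>)) \<le> norm (w powr c)"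
     "norm (w powr c) \<le> norm w powr Re c * exp (pi * \<bar>Im c\<bar>)"
    unfolding n using b by (auto intro!: mult_left_mono)
qed

text \<open>The two bases in the denominator are complex conjugates, hence have the same modulus, and only the real parts of the exponents matter.\<close>

lemma norm_poisson_factor_le:
  fixes a b :: complex
  defines "s \<equiv> Re a + Re b + 1"
  assumes s: "0 < s"
  shows "\<exists>C\<ge>0. \<forall>z w. norm z < 1 \<longrightarrow> norm w = 1 \<longrightarrow>
    norm (poisson_factor a b z w) \<le> C * ((1 - norm z) powr s / norm (1 - z * cnj w) powr (s + 1))"
proof (intro exI conjI allI impI)
  let ?E = "exp (pi * \<bar>Im a\<bar>) * exp (pi * \<bar>Im b\<bar>)"
  let ?C = "norm (poisson_const a b) * 2 powr s * ?E"
  show "0 \<le> ?C" by simp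
  fix z w :: complex assume z: "norm z < 1" and w: "norm w = 1"
  define m where "m = norm (1 - z * cnj w)"
  have "1 - norm z \<le> m"
    using norm_triangle_ineq2[of 1 "z * cnj w"] w by (simp add: m_def norm_mult)
  then have m: "m > 0" using z by simp
  have nz: "1 - z * cnj w \<noteq> 0" using m by (auto simp: m_def)
  have "cnj (1 - z * cnj w) = 1 - cnj z * w" by simp
  then have m': "norm (1 - cnj z * w) = m" by (metis complex_mod_cnj m_def)
  have nz': "1 - cnj z * w \<noteq> 0" using m m' by auto
  have "norm z ^ 2 < 1" using z by (simp add: power_less_one_iff)
  then have "norm (complex_of_real (1 - (norm z)\<^sup>2) powr (a + b + 1)) = (1 - (norm z)\<^sup>2) powr s"
    by (subst norm_powr_real_powr) (auto simp: s_def)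
  also have "\<dots> \<le> (2 * (1 - norm z)) powr s"
  proof (rule powr_mono2)
    have "1 - (norm z)\<^sup>2 = (1 + norm z) * (1 - norm z)" by (simp add: power2_eq_square algebra_simps)
    also have "\<dots> \<le> 2 * (1 - norm z)" using z by (intro mult_right_mono) auto
    finally show "1 - (norm z)\<^sup>2 \<le> 2 * (1 - norm z)" .
    show "0 \<le> 1 - (norm z)\<^sup>2" using \<open>norm z ^ 2 < 1\<close> by simp
  qed (use s in auto)
  also have "\<dots> = 2 powr s * (1 - norm z) powr s" by (rule powr_mult)
  finally have num: "norm (complex_of_real (1 - (norm z)\<^sup>2) powr (a + b + 1)) \<le> 2 powr s * (1 - norm z) powr s" .
  have "m powr (s + 1) / ?E = (m powr Re (a + 1) * exp (- (pi * \<bar>Im (a + 1)\<bar>))) * (m powr Re (b + 1) * exp (- (pi * \<bar>Im (b + 1)\<bar>)))"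
    using m by (simp add: s_def exp_minus divide_inverse powr_add power2_eq_square algebra_simps)
  also have "\<dots> \<le> norm ((1 - z * cnj w) powr (a + 1)) * norm ((1 - cnj z * w) powr (b + 1))"
    using norm_powr_bounds(1)[OF nz, of "a + 1"] norm_powr_bounds(1)[OF nz', of "b + 1"]
    by (intro mult_mono) (auto simp: m_def[symmetric] m')
  finally have den: "m powr (s + 1) / ?E \<le> norm ((1 - z * cnj w) powr (a + 1)) * norm ((1 - cnj z * w) powr (b + 1))" .
  have "norm (poisson_factor a b z w) = norm (poisson_const a b) * (norm (complex_of_real (1 - (norm z)\<^sup>2) powr (a + b + 1)) /
      (norm ((1 - z * cnj w) powr (a + 1)) * norm ((1 - cnj z * w) powr (b + 1))))"
    by (simp only: poisson_factor_def norm_mult norm_divide)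
  also have "\<dots> \<le> norm (poisson_const a b) * ((2 powr s * (1 - norm z) powr s) / (m powr (s + 1) / ?E))"
    using m num den by (intro mult_left_mono frac_le) auto
  also have "\<dots> = ?C * ((1 - norm z) powr s / m powr (s + 1))" by simp
  finally show "norm (poisson_factor a b z w) \<le> ?C * ((1 - norm z) powr s / norm (1 - z * cnj w) powr (s + 1))"
    by (simp add: m_def)
qed

text \<open>On the interval \<open>\<bar>x\<bar> \<le> 2\<pi> - d\<close> the quotient of chord and arc is a continuous positive function, so it has a positive minimum.\<close>

lemma chord_ge_arc:
  fixes d :: real
  assumes d: "0 < d" "d \<le> pi"
  shows "\<exists>\<kappa>>0. \<forall>x. \<bar>x\<bar> \<le> 2 * pi - d \<longrightarrow> \<kappa> * \<bar>x\<bar> \<le> norm (1 - cis x)"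
proof -
  define e where "e = pi - d / 2"
  have e: "0 < e" "e < pi" using d by (auto simp: e_def)
  have "continuous_on {0..e} sinc"
    by (intro continuous_at_imp_continuous_on) (auto intro: isCont_sinc)
  then obtain y where y: "y \<in> {0..e}" "\<And>u. u \<in> {0..e} \<Longrightarrow> sinc y \<le> sinc u"
    using continuous_attains_inf[of "{0..e}" sinc] e by auto
  define \<kappa> where "\<kappa> = sinc y"
  have \<kappa>: "\<kappa> > 0" using y(1) e by (auto simp: \<kappa>_def sin_gt_zero)
  have "\<kappa> * \<bar>x\<bar> \<le> norm (1 - cis x)" if "\<bar>x\<bar> \<le> 2 * pi - d" for x
  proof -
    define u where "u = \<bar>x\<bar> / 2"
    have u: "u \<in> {0..e}" using that by (auto simp: u_def e_def)
    have "norm (1 - cis x) = 2 * \<bar>sin (x / 2)\<bar>"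
      using dist_exp_i_1[of x] by (simp add: cis_conv_exp norm_minus_commute)
    also have "\<bar>sin (x / 2)\<bar> = sin u"
    proof -
      have "\<bar>sin (x / 2)\<bar> = \<bar>sin u\<bar>" by (auto simp: u_def abs_if)
      moreover have "0 \<le> sin u" using u e by (intro sin_ge_zero) auto
      ultimately show ?thesis by simp
    qed
    finally have e: "norm (1 - cis x) = 2 * sin u" .
    have "\<kappa> * u \<le> sin u"
    proof (cases "u = 0")
      case False
      then show ?thesis using y(2)[OF u] u by (auto simp: \<kappa>_def field_simps)
    qed simp
    then show ?thesis unfolding e by (simp add: u_def)
  qed
  then show ?thesis using \<kappa> by blast
qed

lemma stolz_norm_less: "z \<in> stolz A w \<Longrightarrow> norm w = 1 \<Longrightarrow> norm z < 1"
  by (auto simp: stolz_def norm_mult)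

text \<open>In a Stolz region \<open>\<bar>1 - z e\<^bsup>-it\<^esup>\<bar>\<close> is bounded below by a multiple of \<open>(1 - \<bar>z\<bar>) + \<bar>\<phi> - t\<bar>\<close>: replacing \<open>z\<close> by its radial projection, and the
projection by \<open>e\<^bsup>i\<phi>\<^esup>\<close>, costs a multiple of \<open>1 - \<bar>z\<bar>\<close>, which is itself at most \<open>\<bar>1 - z e\<^bsup>-it\<^esup>\<bar>\<close>. The angle \<open>\<phi>\<close> stays
away from 0 and \<open>2\<pi>\<close>, so that the distance of \<open>\<phi>\<close> and \<open>t\<close> on the line, not on the circle,
can be used.\<close>

lemma stolz_distance_ge:
  fixes A d :: real
  assumes A: "0 < A" and d: "0 < d" "d \<le> pi"
  shows "\<exists>c>0. \<forall>\<phi> t z. d \<le> \<phi> \<longrightarrow> \<phi> \<le> 2 * pi - d \<longrightarrow> 0 \<le> t \<longrightarrow> t \<le> 2 * pi \<longrightarrow> z \<in> stolz A (cis \<phi>) \<longrightarrow>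
      c * ((1 - norm z) + \<bar>\<phi> - t\<bar>) \<le> norm (1 - z * cnj (cis t))"
proof -
  obtain \<kappa> where \<kappa>: "\<kappa> > 0" "\<And>x. \<bar>x\<bar> \<le> 2 * pi - d \<Longrightarrow> \<kappa> * \<bar>x\<bar> \<le> norm (1 - cis x)"
    using chord_ge_arc[OF d] by blast
  define D where "D = 1 + (2 + A) / \<kappa>"
  have D: "D > 0" using \<kappa> A by (simp add: D_def add_pos_pos)
  show ?thesis
  proof (intro exI[of _ "1 / D"] conjI allI impI)
    show "0 < 1 / D" using D by simp
    fix \<phi> t :: real and z
    assume \<phi>: "d \<le> \<phi>" "\<phi> \<le> 2 * pi - d" and t: "0 \<le> t" "t \<le> 2 * pi" and z: "z \<in> stolz A (cis \<phi>)"
    obtain r \<theta> where r: "0 \<le> r" "r < 1" and \<theta>: "\<bar>\<theta>\<bar> \<le> A * (1 - r)" and zeq: "z = of_real r * (cis \<phi> * cis (- \<theta>))"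
      using z by (auto simp: stolz_def)
    have nz: "norm z = r" using r by (simp add: zeq norm_mult)
    define s where "s = \<phi> - \<theta> - t"
    define N where "N = norm (1 - z * cnj (cis t))"
    have zs: "z * cnj (cis t) = of_real r * cis s"
      by (simp add: zeq cis_cnj cis_mult s_def mult.assoc)
    have hN: "1 - r \<le> N"
      using norm_triangle_ineq2[of 1 "z * cnj (cis t)"] r by (simp add: N_def zs norm_mult)
    have "norm (1 - cis s) \<le> norm (1 - of_real r * cis s) + norm (of_real r * cis s - cis s)"
      by (rule norm_diff_triangle_le) auto
    also have "of_real r * cis s - cis s = of_real (r - 1) * cis s" by (simp add: algebra_simps)
    also have "norm \<dots> = 1 - r" using r by (simp add: norm_mult del: of_real_diff)
    finally have 1: "norm (1 - cis s) \<le> 2 * N" using hN by (simp add: N_def zs)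
    have "cis s - cis (\<phi> - t) = cis (\<phi> - t) * (cis (- \<theta>) - 1)"
      by (simp add: algebra_simps cis_mult s_def)
    then have "norm (cis s - cis (\<phi> - t)) = norm (cis (- \<theta>) - 1)" by (simp add: norm_mult)
    also have "\<dots> = 2 * \<bar>sin (\<theta> / 2)\<bar>"
      using dist_exp_i_1[of "- \<theta>"] by (simp add: cis_conv_exp)
    also have "\<dots> \<le> \<bar>\<theta>\<bar>" using abs_sin_x_le_abs_x[of "\<theta> / 2"] by simp
    finally have 2: "norm (cis s - cis (\<phi> - t)) \<le> A * N"
      using \<theta> hN A by (smt (verit) mult_left_mono)
    have "\<kappa> * \<bar>\<phi> - t\<bar> \<le> norm (1 - cis (\<phi> - t))"
      using \<phi> t by (intro \<kappa>(2)) auto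
    also have "\<dots> \<le> norm (1 - cis s) + norm (cis s - cis (\<phi> - t))"
      by (rule norm_diff_triangle_le) auto
    also have "\<dots> \<le> (2 + A) * N" using 1 2 by (simp add: algebra_simps)
    finally have "\<bar>\<phi> - t\<bar> \<le> (2 + A) / \<kappa> * N" using \<kappa>(1) by (simp add: field_simps)
    then have "(1 - r) + \<bar>\<phi> - t\<bar> \<le> D * N" using hN by (simp add: D_def algebra_simps)
    then show "1 / D * ((1 - norm z) + \<bar>\<phi> - t\<bar>) \<le> norm (1 - z * cnj (cis t))"
      using D by (simp add: nz N_def field_simps)
  qed
qed

lemma restricted_stolzD:
  fixes \<phi> :: "real ^ 'n::finite"
  assumes "z \<in> restricted_stolz A B (cis_vec \<phi>)"
  shows "z $ j \<in> stolz A (cis (\<phi> $ j))" "norm (z $ j) < 1"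
    "1 - norm (z $ j) \<le> B * (1 - norm (z $ k))"
proof -
  show st: "z $ j \<in> stolz A (cis (\<phi> $ j))" for j using assms by (auto simp: restricted_stolz_def stolz_prod_def)
  show lt: "norm (z $ j) < 1" for j using stolz_norm_less[OF st[of j]] by simp
  have "(1 - norm (z $ j)) / (1 - norm (z $ k)) \<le> (MAX (j, k)\<in>UNIV. (1 - norm (z $ j)) / (1 - norm (z $ k)))"
    by (rule Max_ge) (auto intro!: image_eqI[where x = "(j, k)"])
  also have "\<dots> \<le> B" using assms by (simp add: restricted_stolz_def)
  finally show "1 - norm (z $ j) \<le> B * (1 - norm (z $ k))" using lt[of k] by (simp add: field_simps)
qed

text \<open>Passage from the scale \<open>h'\<close> and exponent \<open>s\<close> of one coordinate to a common comparable scale \<open>h\<close> and a smaller exponent \<open>\<sigma>\<close>. Lowering the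
exponent is harmless because \<open>h' / (h' + x) \<le> 1\<close>.\<close>

lemma scale_comparison:
  fixes \<sigma> s c B h h' x :: real
  assumes \<sigma>: "0 < \<sigma>" "\<sigma> \<le> s" and c: "0 < c" and B: "1 \<le> B" and h: "0 < h" "0 < h'"
    and hh: "h' \<le> B * h" "h \<le> B * h'" and x: "0 \<le> x" and m: "c * (h' + x) \<le> m"
  shows "h' powr s / m powr (s + 1) \<le> c powr (- (s + 1)) * B powr (2 * \<sigma> + 1) * (h powr \<sigma> / (h + x) powr (\<sigma> + 1))"
proof -
  have p: "h' + x > 0" "h + x > 0" using h x by auto
  have m0: "0 < m" using mult_pos_pos[OF c p(1)] m by linarith
  have "h' powr s / m powr (s + 1) \<le> h' powr s / (c * (h' + x)) powr (s + 1)"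
    using p c m m0 \<sigma> by (intro divide_left_mono powr_mono2 mult_pos_pos) auto
  also have "\<dots> = c powr (- (s + 1)) * ((h' / (h' + x)) powr s / (h' + x))"
  proof -
    define y where "y = h' + x"
    have y: "y > 0" using p by (simp add: y_def)
    have "(c * y) powr (s + 1) = c powr (s + 1) * (y powr s * y)"
      using y by (simp only: powr_mult powr_add powr_one) (simp add: mult_ac)
    then have "h' powr s / (c * y) powr (s + 1) = c powr (- (s + 1)) * ((h' / y) powr s / y)"
      unfolding powr_minus_divide using h y by (simp add: powr_divide)
    then show ?thesis unfolding y_def .
  qed
  also have "\<dots> \<le> c powr (- (s + 1)) * ((h' / (h' + x)) powr \<sigma> / (h' + x))"
    using p h x \<sigma> by (intro mult_left_mono divide_right_mono powr_mono') auto
  also have "(h' / (h' + x)) powr \<sigma> / (h' + x) = h' powr \<sigma> / (h' + x) powr (\<sigma> + 1)"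
    using p h by (simp add: powr_divide powr_add)
  also have "\<dots> \<le> (B * h) powr \<sigma> / ((h + x) / B) powr (\<sigma> + 1)"
  proof (rule frac_le)
    show "h' powr \<sigma> \<le> (B * h) powr \<sigma>" using hh h \<sigma> by (intro powr_mono2) auto
    have "h + x \<le> B * (h' + x)" using hh B x mult_right_mono[of 1 B x] by (simp add: algebra_simps)
    then have "(h + x) / B \<le> h' + x" using B by (simp add: field_simps)
    then show "((h + x) / B) powr (\<sigma> + 1) \<le> (h' + x) powr (\<sigma> + 1)"
      using p B \<sigma> by (intro powr_mono2) auto
  qed (use p B in auto)
  also have "\<dots> = B powr (2 * \<sigma> + 1) * (h powr \<sigma> / (h + x) powr (\<sigma> + 1))"
  proof -
    have e: "2 * \<sigma> + 1 = \<sigma> + (\<sigma> + 1)" by simp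
    show ?thesis unfolding e powr_add[of B \<sigma> "\<sigma> + 1"] using p B h by (simp add: powr_mult powr_divide)
  qed
  finally show ?thesis by (simp add: mult_left_mono mult.assoc)
qed

definition inner_cube :: "real \<Rightarrow> (real ^ 'n::finite) set" where
  "inner_cube d = {\<phi>. \<forall>j. d \<le> \<phi> $ j \<and> \<phi> $ j \<le> 2 * pi - d}"

text \<open>The scale is \<open>h = 1 - \<bar>z\<^sub>k\<bar>\<close> for an arbitrary fixed coordinate \<open>k\<close>; the restriction by \<open>B\<close> makes all other \<open>1 - \<bar>z\<^sub>j\<bar>\<close>
comparable to it.\<close>

lemma poisson_kernel_le_majorant:
  fixes \<alpha> \<beta> :: "complex ^ 'n::finite" and k :: 'n
  assumes s: "\<And>j. \<sigma> \<le> Re (\<alpha> $ j) + Re (\<beta> $ j) + 1" and \<sigma>: "0 < \<sigma>"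
    and A: "0 < A" and B: "1 \<le> B" and d: "0 < d" "d \<le> pi"
  shows "\<exists>C>0. \<forall>\<phi>\<in>inner_cube d. \<forall>z\<in>restricted_stolz A B (cis_vec \<phi>). \<forall>t\<in>cube.
    norm (poisson_kernel \<alpha> \<beta> z (cis_vec t)) \<le> C * majorant \<sigma> (1 - norm (z $ k)) (\<phi> - t)"
proof -
  obtain c where c: "c > 0" and cb: "\<And>\<phi> t z. d \<le> \<phi> \<Longrightarrow> \<phi> \<le> 2 * pi - d \<Longrightarrow> 0 \<le> t \<Longrightarrow> t \<le> 2 * pi \<Longrightarrow> z \<in> stolz A (cis \<phi>) \<Longrightarrow>
      c * ((1 - norm z) + \<bar>\<phi> - t\<bar>) \<le> norm (1 - z * cnj (cis t))"
    using stolz_distance_ge[OF A d] by metis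
  define S where "S j = Re (\<alpha> $ j) + Re (\<beta> $ j) + 1" for j
  have "\<forall>j. \<exists>C\<ge>0. \<forall>z w. norm z < 1 \<longrightarrow> norm w = 1 \<longrightarrow>
    norm (poisson_factor (\<alpha> $ j) (\<beta> $ j) z w) \<le> C * ((1 - norm z) powr S j / norm (1 - z * cnj w) powr (S j + 1))"
    unfolding S_def by (intro allI norm_poisson_factor_le) (use s \<sigma> in \<open>auto intro: less_le_trans\<close>)
  then obtain K where K: "\<And>j. K j \<ge> 0" "\<And>j z w. norm z < 1 \<Longrightarrow> norm w = 1 \<Longrightarrow>
    norm (poisson_factor (\<alpha> $ j) (\<beta> $ j) z w) \<le> K j * ((1 - norm z) powr S j / norm (1 - z * cnj w) powr (S j + 1))"
    by metis
  define C where "C j = (K j + 1) * (c powr (- (S j + 1)) * B powr (2 * \<sigma> + 1))" for j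
  show ?thesis
  proof (intro exI[of _ "\<Prod>j\<in>UNIV. C j"] conjI ballI)
    have "C j > 0" for j unfolding C_def using K(1)[of j] c B by (intro mult_pos_pos) auto
    then show "(\<Prod>j\<in>UNIV. C j) > 0" by (intro prod_pos) auto
    fix \<phi> t :: "real ^ 'n" and z assume \<phi>: "\<phi> \<in> inner_cube d" and z: "z \<in> restricted_stolz A B (cis_vec \<phi>)" and t: "t \<in> cube"
    note zD = restricted_stolzD[OF z]
    define h where "h = 1 - norm (z $ k)"
    have "norm (poisson_factor (\<alpha> $ j) (\<beta> $ j) (z $ j) (cis (t $ j))) \<le> C j * (h powr \<sigma> / (h + \<bar>\<phi> $ j - t $ j\<bar>) powr (\<sigma> + 1))" for j
    proof -
      define m where "m = norm (1 - z $ j * cnj (cis (t $ j)))"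
      define R where "R = h powr \<sigma> / (h + \<bar>\<phi> $ j - t $ j\<bar>) powr (\<sigma> + 1)"
      have "c * ((1 - norm (z $ j)) + \<bar>\<phi> $ j - t $ j\<bar>) \<le> m"
        unfolding m_def using \<phi> t by (intro cb zD) (auto simp: inner_cube_def mem_box_cart)
      then have sc: "(1 - norm (z $ j)) powr S j / m powr (S j + 1) \<le> c powr (- (S j + 1)) * B powr (2 * \<sigma> + 1) * R"
        unfolding R_def using zD(2)[of j] zD(2)[of k] zD(3)[of j k] zD(3)[of k j] \<sigma> s[of j] c B
        by (intro scale_comparison) (auto simp: S_def h_def)
      have "norm (poisson_factor (\<alpha> $ j) (\<beta> $ j) (z $ j) (cis (t $ j))) \<le> K j * ((1 - norm (z $ j)) powr S j / m powr (S j + 1))"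
        unfolding m_def by (intro K zD) simp
      also have "\<dots> \<le> (K j + 1) * (c powr (- (S j + 1)) * B powr (2 * \<sigma> + 1) * R)"
        using K(1)[of j] sc by (intro mult_mono) auto
      finally show ?thesis by (simp add: C_def R_def mult_ac)
    qed
    then have "norm (poisson_kernel \<alpha> \<beta> z (cis_vec t)) \<le> (\<Prod>j\<in>UNIV. C j * (h powr \<sigma> / (h + \<bar>\<phi> $ j - t $ j\<bar>) powr (\<sigma> + 1)))"
      unfolding poisson_kernel_eq_prod prod_norm[symmetric] by (intro prod_mono) auto
    also have "\<dots> = (\<Prod>j\<in>UNIV. C j) * majorant \<sigma> h (\<phi> - t)"
      by (simp only: prod.distrib majorant_def vector_minus_component)
    finally show "norm (poisson_kernel \<alpha> \<beta> z (cis_vec t)) \<le> (\<Prod>j\<in>UNIV. C j) * majorant \<sigma> (1 - norm (z $ k)) (\<phi> - t)"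
      by (simp add: h_def)
  qed
qed

definition cube_poisson :: "complex ^ 'n::finite \<Rightarrow> complex ^ 'n \<Rightarrow> (real ^ 'n \<Rightarrow> complex) \<Rightarrow> complex ^ 'n \<Rightarrow> complex" where
  "cube_poisson \<alpha> \<beta> F z = (\<integral>t. poisson_kernel \<alpha> \<beta> z (cis_vec t) * F t \<partial>cube_measure)"

lemma AE_in_cube: "AE t in (cube_measure :: (real ^ 'n::finite) measure). t \<in> cube"
  by (rule AE_uniform_measureI) auto

lemma integrable_poisson_kernel_mult:
  fixes z :: "complex ^ 'n::finite"
  assumes z: "\<And>j. norm (z $ j) < 1" and F: "integrable cube_measure F"
  shows "integrable cube_measure (\<lambda>t. poisson_kernel \<alpha> \<beta> z (cis_vec t) * F t)"
proof -
  have "compact ((\<lambda>t. poisson_kernel \<alpha> \<beta> z (cis_vec t)) ` cube)"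
    by (intro compact_continuous_image continuous_on_poisson_kernel_cis z) auto
  then have "bounded ((\<lambda>t. poisson_kernel \<alpha> \<beta> z (cis_vec t)) ` cube)" by (rule compact_imp_bounded)
  then obtain M where M: "\<And>t. t \<in> cube \<Longrightarrow> norm (poisson_kernel \<alpha> \<beta> z (cis_vec t)) \<le> M"
    by (auto simp: bounded_iff)
  have [measurable]: "(\<lambda>t :: real ^ 'n. poisson_kernel \<alpha> \<beta> z (cis_vec t)) \<in> borel_measurable borel"
    by (rule borel_measurable_poisson_kernel[OF z])
  have [measurable]: "F \<in> borel_measurable borel" using F by (simp cong: measurable_cong_sets)
  show ?thesis
  proof (rule Bochner_Integration.integrable_bound)
    show "integrable cube_measure (\<lambda>t. of_real M * F t)" using F by simp
    show "AE t in cube_measure. norm (poisson_kernel \<alpha> \<beta> z (cis_vec t) * F t) \<le> norm (of_real M * F t)"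
      using AE_in_cube
    proof eventually_elim
      case (elim t)
      have "norm (poisson_kernel \<alpha> \<beta> z (cis_vec t)) \<le> \<bar>M\<bar>" using M[OF elim] by linarith
      then show ?case by (simp add: norm_mult mult_right_mono)
    qed
  qed measurable
qed

text \<open>Stated with extended nonnegative integrals, because the integral on the right is the one that the maximal inequality controls.\<close>

lemma norm_cube_poisson_le:
  fixes \<alpha> \<beta> :: "complex ^ 'n::finite"
  assumes C: "0 \<le> C" and K: "\<And>t. t \<in> cube \<Longrightarrow> norm (poisson_kernel \<alpha> \<beta> z (cis_vec t)) \<le> C * majorant \<sigma> h (\<phi> - t)"
    and z: "\<And>j. norm (z $ j) < 1" and F: "integrable cube_measure F"
  shows "ennreal (norm (cube_poisson \<alpha> \<beta> F z)) \<le> ennreal C * (\<integral>\<^sup>+t. ennreal (majorant \<sigma> h (\<phi> - t)) * ennreal (norm (F t)) \<partial>cube_measure)"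
proof -
  have [measurable]: "F \<in> borel_measurable borel" using F by (simp cong: measurable_cong_sets)
  have "ennreal (norm (cube_poisson \<alpha> \<beta> F z)) \<le> (\<integral>\<^sup>+t. ennreal (norm (poisson_kernel \<alpha> \<beta> z (cis_vec t) * F t)) \<partial>cube_measure)"
    unfolding cube_poisson_def by (intro integral_norm_bound_ennreal integrable_poisson_kernel_mult z F)
  also have "\<dots> \<le> (\<integral>\<^sup>+t. ennreal C * (ennreal (majorant \<sigma> h (\<phi> - t)) * ennreal (norm (F t))) \<partial>cube_measure)"
  proof (rule nn_integral_mono_AE, rule AE_mp[OF AE_in_cube], rule AE_I2, rule impI)
    fix t :: "real ^ 'n" assume elim: "t \<in> cube"
    have "norm (poisson_kernel \<alpha> \<beta> z (cis_vec t) * F t) \<le> C * majorant \<sigma> h (\<phi> - t) * norm (F t)"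
      unfolding norm_mult by (intro mult_right_mono K elim) simp
    then show "ennreal (norm (poisson_kernel \<alpha> \<beta> z (cis_vec t) * F t)) \<le> ennreal C * (ennreal (majorant \<sigma> h (\<phi> - t)) * ennreal (norm (F t)))"
      using C majorant_nonneg[of \<sigma> h "\<phi> - t"] by (simp add: mult.assoc ennreal_leI flip: ennreal_mult')
  qed
  also have "\<dots> = ennreal C * (\<integral>\<^sup>+t. ennreal (majorant \<sigma> h (\<phi> - t)) * ennreal (norm (F t)) \<partial>cube_measure)"
    by (rule nn_integral_cmult) measurable
  finally show ?thesis .
qed

lemma nn_integral_cube_measure_le:
  fixes f :: "real ^ 'n::finite \<Rightarrow> ennreal"
  assumes [measurable]: "f \<in> borel_measurable borel"
  shows "(\<integral>\<^sup>+t. f t \<partial>cube_measure) \<le> (\<integral>\<^sup>+t. f t \<partial>lborel)"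
proof -
  have "(1::real) \<le> (2 * pi) ^ CARD('n)" using pi_gt3 by (intro one_le_power) auto
  then have le1: "ennreal (indicator cube t / (2 * pi) ^ CARD('n)) \<le> 1" for t :: "real ^ 'n"
    by (auto simp: indicator_def ennreal_le_1 divide_le_eq)
  have "(\<integral>\<^sup>+t. f t \<partial>cube_measure) = (\<integral>\<^sup>+t. ennreal (indicator cube t / (2 * pi) ^ CARD('n)) * f t \<partial>lborel)"
    unfolding cube_measure_eq_density by (rule nn_integral_density) measurable
  also have "\<dots> \<le> (\<integral>\<^sup>+t. 1 * f t \<partial>lborel)"
    by (intro nn_integral_mono mult_right_mono le1) auto
  finally show ?thesis by simp
qed

text \<open>Half of the decay in one coordinate that is at least \<open>e\<close> gives a factor that tends to 0 with \<open>h\<close>; what remains is the majorant with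
exponent \<open>\<sigma> / 2\<close>, whose mass is still bounded.\<close>

lemma majorant_off_diagonal:
  fixes x :: "real ^ 'n::finite"
  assumes h: "0 < h" and \<sigma>: "0 < \<sigma>" and e: "0 < e" "e \<le> \<bar>x $ i\<bar>"
  shows "majorant \<sigma> h x \<le> (h / e) powr (\<sigma> / 2) * majorant (\<sigma> / 2) h x"
proof -
  define f where "f j = (h / (h + \<bar>x $ j\<bar>)) powr (\<sigma> / 2)" for j
  define g where "g j = h powr (\<sigma> / 2) / (h + \<bar>x $ j\<bar>) powr (\<sigma> / 2 + 1)" for j
  have fg: "h powr \<sigma> / (h + \<bar>x $ j\<bar>) powr (\<sigma> + 1) = f j * g j" for j
  proof -
    have p: "h + \<bar>x $ j\<bar> \<ge> 0" using h by simp
    have 1: "h powr \<sigma> = h powr (\<sigma> / 2) * h powr (\<sigma> / 2)"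
      by (simp flip: powr_add)
    have "\<sigma> + 1 = \<sigma> / 2 + (\<sigma> / 2 + 1)" by simp
    then have 2: "(h + \<bar>x $ j\<bar>) powr (\<sigma> + 1) = (h + \<bar>x $ j\<bar>) powr (\<sigma> / 2) * (h + \<bar>x $ j\<bar>) powr (\<sigma> / 2 + 1)"
      by (metis powr_add)
    have 3: "f j = h powr (\<sigma> / 2) / (h + \<bar>x $ j\<bar>) powr (\<sigma> / 2)"
      unfolding f_def by (rule powr_divide)
    show ?thesis unfolding 1 2 3 g_def by (rule times_divide_times_eq[symmetric])
  qed
  have f1: "0 \<le> f j" "f j \<le> 1" for j
    unfolding f_def using h \<sigma> by (auto intro!: powr_le1 simp: divide_le_eq)
  have fi: "f i \<le> (h / e) powr (\<sigma> / 2)"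
    unfolding f_def using h \<sigma> e by (intro powr_mono2 divide_left_mono) auto
  have "(\<Prod>j\<in>UNIV. f j) = f i * (\<Prod>j\<in>UNIV - {i}. f j)" by (rule prod.remove) auto
  also have "\<dots> \<le> f i * 1" using f1 by (intro mult_left_mono prod_le_1) auto
  finally have "(\<Prod>j\<in>UNIV. f j) \<le> (h / e) powr (\<sigma> / 2)" using fi by simp
  moreover have "majorant \<sigma> h x = (\<Prod>j\<in>UNIV. f j) * majorant (\<sigma> / 2) h x"
    unfolding majorant_def fg prod.distrib g_def ..
  ultimately show ?thesis
    using majorant_nonneg[of "\<sigma> / 2" h x] by (simp add: mult_right_mono)
qed

section \<open>Convergence at points of continuity\<close>

lemma RNT_lim_cong:
  assumes "\<And>z. (\<And>j. norm (z $ j) < 1) \<Longrightarrow> u z = v z"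
  shows "RNT_lim u (cis_vec \<phi>) l \<longleftrightarrow> RNT_lim v (cis_vec \<phi>) l"
proof -
  have "u z = v z" if "z \<in> restricted_stolz A B (cis_vec \<phi>)" for z A B
    by (rule assms) (rule restricted_stolzD(2)[OF that])
  then show ?thesis unfolding RNT_lim_def by (simp cong: ball_cong)
qed

lemma RNT_lim_add:
  assumes "RNT_lim u \<eta> l" "RNT_lim v \<eta> m"
  shows "RNT_lim (\<lambda>z. u z + v z) \<eta> (l + m)"
  unfolding RNT_lim_def
proof (intro allI impI)
  fix A B e :: real assume *: "0 < A" "1 \<le> B" "0 < e"
  obtain d1 where d1: "d1 > 0" "\<And>z. z \<in> restricted_stolz A B \<eta> \<Longrightarrow> norm (z - \<eta>) < d1 \<Longrightarrow> norm (u z - l) < e / 2"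
    using assms(1) * unfolding RNT_lim_def by (meson half_gt_zero)
  obtain d2 where d2: "d2 > 0" "\<And>z. z \<in> restricted_stolz A B \<eta> \<Longrightarrow> norm (z - \<eta>) < d2 \<Longrightarrow> norm (v z - m) < e / 2"
    using assms(2) * unfolding RNT_lim_def by (meson half_gt_zero)
  show "\<exists>\<delta>>0. \<forall>z\<in>restricted_stolz A B \<eta>. norm (z - \<eta>) < \<delta> \<longrightarrow> norm (u z + v z - (l + m)) < e"
  proof (intro exI[of _ "min d1 d2"] conjI ballI impI)
    fix z assume "z \<in> restricted_stolz A B \<eta>" "norm (z - \<eta>) < min d1 d2"
    then have "norm (u z - l) < e / 2" "norm (v z - m) < e / 2" using d1 d2 by auto
    then show "norm (u z + v z - (l + m)) < e" using norm_triangle_ineq[of "u z - l" "v z - m"] by (simp add: algebra_simps)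
  qed (use d1 d2 in auto)
qed

lemma RNT_lim_cmult:
  assumes "RNT_lim u \<eta> l"
  shows "RNT_lim (\<lambda>z. c * u z) \<eta> (c * l)"
  unfolding RNT_lim_def
proof (intro allI impI)
  fix A B e :: real assume *: "0 < A" "1 \<le> B" "0 < e"
  have "0 < e / (norm c + 1)" using * by (simp add: add_nonneg_pos)
  then obtain d where d: "d > 0" "\<And>z. z \<in> restricted_stolz A B \<eta> \<Longrightarrow> norm (z - \<eta>) < d \<Longrightarrow> norm (u z - l) < e / (norm c + 1)"
    using assms * unfolding RNT_lim_def by meson
  show "\<exists>\<delta>>0. \<forall>z\<in>restricted_stolz A B \<eta>. norm (z - \<eta>) < \<delta> \<longrightarrow> norm (c * u z - c * l) < e"
  proof (intro exI[of _ d] conjI ballI impI)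
    fix z assume "z \<in> restricted_stolz A B \<eta>" "norm (z - \<eta>) < d"
    then have n: "norm (u z - l) < e / (norm c + 1)" by (rule d(2))
    have "norm (c * u z - c * l) = norm c * norm (u z - l)" by (simp add: norm_mult flip: right_diff_distrib)
    also have "\<dots> \<le> norm c * (e / (norm c + 1))" using n by (intro mult_left_mono) auto
    also have "\<dots> < e" using * by (simp add: divide_simps add_nonneg_pos)
    finally show "norm (c * u z - c * l) < e" .
  qed (use d in auto)
qed

lemma norm_ge_distance_to_torus:
  assumes "norm (z - cis_vec \<phi>) < d"
  shows "1 - d < norm (z $ j)"
proof -
  have "norm ((z - cis_vec \<phi>) $ j) \<le> norm (z - cis_vec \<phi>)" by (rule Finite_Cartesian_Product.norm_nth_le)
  then have "norm (z $ j - cis (\<phi> $ j)) < d" using assms by simp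
  moreover have "norm (cis (\<phi> $ j)) - norm (z $ j) \<le> norm (z $ j - cis (\<phi> $ j))"
    by (metis norm_minus_commute norm_triangle_ineq2)
  ultimately show ?thesis by simp
qed

lemma cube_poisson_add:
  assumes "\<And>j. norm (z $ j) < 1" "integrable cube_measure F" "integrable cube_measure G"
  shows "cube_poisson \<alpha> \<beta> (\<lambda>t. F t + G t) z = cube_poisson \<alpha> \<beta> F z + cube_poisson \<alpha> \<beta> G z"
  unfolding cube_poisson_def distrib_left
  by (intro Bochner_Integration.integral_add integrable_poisson_kernel_mult assms)

lemma cube_poisson_cmult: "cube_poisson \<alpha> \<beta> (\<lambda>t. c * F t) z = c * cube_poisson \<alpha> \<beta> F z"
  by (simp add: cube_poisson_def mult.left_commute[of _ c])

text \<open>The usual approximate identity argument for \<open>F - F(\<phi>)\<close>: near \<open>\<phi>\<close> the difference is small, and far from \<open>\<phi>\<close>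
the kernel is. The constant \<open>F(\<phi>)\<close> is reproduced up to the error of the total mass.\<close>

lemma RNT_lim_cube_poisson_continuity_point:
  fixes \<alpha> \<beta> :: "complex ^ 'n::finite" and F :: "real ^ 'n \<Rightarrow> complex"
  assumes ab: "\<And>j. Re (\<alpha> $ j) + Re (\<beta> $ j) > -1"
    and na: "\<And>j. \<alpha> $ j \<notin> {- of_nat k | k::nat. k \<ge> 1}"
    and nb: "\<And>j. \<beta> $ j \<notin> {- of_nat k | k::nat. k \<ge> 1}"
    and F: "integrable cube_measure F" and M: "\<And>t. norm (F t) \<le> M"
    and cont: "continuous (at \<phi>) F" and \<phi>: "\<phi> \<in> inner_cube d" and d: "0 < d" "d \<le> pi"
  shows "RNT_lim (cube_poisson \<alpha> \<beta> F) (cis_vec \<phi>) (F \<phi>)"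
  unfolding RNT_lim_def
proof (intro allI impI)
  fix A B \<epsilon> :: real assume A: "0 < A" and B: "1 \<le> B" and \<epsilon>: "0 < \<epsilon>"
  interpret prob_space "cube_measure :: (real ^ 'n) measure" by (rule prob_space_cube_measure)
  define \<sigma> where "\<sigma> = Min (range (\<lambda>j. Re (\<alpha> $ j) + Re (\<beta> $ j) + 1))"
  have s: "\<sigma> \<le> Re (\<alpha> $ j) + Re (\<beta> $ j) + 1" for j by (simp add: \<sigma>_def)
  have \<sigma>: "0 < \<sigma>"
  proof -
    have "0 < Re (\<alpha> $ j) + Re (\<beta> $ j) + 1" for j using ab[of j] by simp
    then show ?thesis unfolding \<sigma>_def by (subst Min_gr_iff) auto
  qed
  \<comment> \<open>An arbitrary coordinate; \<open>1 - \<bar>z\<^sub>k\<bar>\<close> serves as the scale.\<close>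
  obtain k :: 'n where True by blast
  have M0: "0 \<le> M" using M[of 0] norm_ge_zero order.trans by blast
  obtain C where C: "C > 0" and Cb: "\<And>z t. z \<in> restricted_stolz A B (cis_vec \<phi>) \<Longrightarrow> t \<in> cube \<Longrightarrow>
    norm (poisson_kernel \<alpha> \<beta> z (cis_vec t)) \<le> C * majorant \<sigma> (1 - norm (z $ k)) (\<phi> - t)"
    using poisson_kernel_le_majorant[OF s \<sigma> A B d] \<phi> by metis
  obtain C1 where C1: "C1 \<ge> 0" "\<And>(x :: real ^ 'n) h. 0 < h \<Longrightarrow> (\<integral>\<^sup>+t. ennreal (majorant \<sigma> h (x - t)) \<partial>lborel) \<le> ennreal C1"
    using nn_integral_majorant_lborel_bounded[OF \<sigma>] by metis
  obtain C2 where C2: "C2 \<ge> 0" "\<And>(x :: real ^ 'n) h. 0 < h \<Longrightarrow> (\<integral>\<^sup>+t. ennreal (majorant (\<sigma> / 2) h (x - t)) \<partial>lborel) \<le> ennreal C2"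
    using nn_integral_majorant_lborel_bounded[of "\<sigma> / 2"] \<sigma> by (metis half_gt_zero)
  define \<epsilon>1 where "\<epsilon>1 = \<epsilon> / (3 * (C * C1 + 1))"
  have \<epsilon>1: "\<epsilon>1 > 0" using \<epsilon> C C1 by (simp add: \<epsilon>1_def add_nonneg_pos)
  have e1: "C * (\<epsilon>1 * C1) < \<epsilon> / 3"
    using \<epsilon> C C1 by (simp add: \<epsilon>1_def divide_simps add_nonneg_pos)
  obtain r where r: "r > 0" "\<And>t. norm (t - \<phi>) < r \<Longrightarrow> norm (F t - F \<phi>) < \<epsilon>1"
    using cont \<epsilon>1 by (fastforce simp: continuous_at_eps_delta dist_norm)
  \<comment> \<open>A point at distance at least \<open>r\<close> has a coordinate at distance at least \<open>e\<close>.\<close>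
  define e where "e = r / (2 * real CARD('n))"
  have e: "e > 0" using r by (simp add: e_def)
  define q where "q = \<epsilon> / (3 * (C * (2 * M * C2) + 1))"
  have q: "q > 0" using \<epsilon> C C2 M0 by (simp add: q_def add_nonneg_pos)
  have e2: "C * (2 * M * q * C2) < \<epsilon> / 3"
    using \<epsilon> C C2 M0 by (simp add: q_def divide_simps add_nonneg_pos)
  \<comment> \<open>Chosen so that \<open>h < \<delta>1\<close> gives \<open>(h / e)\<^bsup>\<sigma>/2\<^esup> \<le> q\<close>.\<close>
  define \<delta>1 where "\<delta>1 = e * q powr (2 / \<sigma>)"
  have \<delta>1: "\<delta>1 > 0" using e q by (simp add: \<delta>1_def)
  obtain \<delta>2 where \<delta>2: "\<delta>2 > 0" and mass: "\<And>z. (\<And>j. 1 - \<delta>2 < norm (z $ j) \<and> norm (z $ j) < 1) \<Longrightarrow>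
     norm ((\<integral>t. poisson_kernel \<alpha> \<beta> z (cis_vec t) \<partial>cube_measure) - 1) < \<epsilon> / (3 * (M + 1))"
    using poisson_mass_tendsto[OF ab na nb, of "\<epsilon> / (3 * (M + 1))"] \<epsilon> M0 by (auto simp: add_nonneg_pos)
  define G where "G t = F t + (- F \<phi>)" for t
  have G: "integrable cube_measure G" unfolding G_def[abs_def] using F by simp
  have G2M: "norm (G t) \<le> 2 * M" for t
    unfolding G_def using norm_triangle_ineq4[of "F t" "F \<phi>"] M[of t] M[of \<phi>] by simp
  show "\<exists>\<delta>>0. \<forall>z\<in>restricted_stolz A B (cis_vec \<phi>). norm (z - cis_vec \<phi>) < \<delta> \<longrightarrow> norm (cube_poisson \<alpha> \<beta> F z - F \<phi>) < \<epsilon>"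
  proof (intro exI[of _ "min \<delta>1 \<delta>2"] conjI ballI impI)
    show "0 < min \<delta>1 \<delta>2" using \<delta>1 \<delta>2 by simp
    fix z assume z: "z \<in> restricted_stolz A B (cis_vec \<phi>)" and near: "norm (z - cis_vec \<phi>) < min \<delta>1 \<delta>2"
    have z1: "norm (z $ j) < 1" for j using restricted_stolzD(2)[OF z] .
    define h where "h = 1 - norm (z $ k)"
    have h: "0 < h" "h < \<delta>1"
      using z1[of k] norm_ge_distance_to_torus[of z \<phi> \<delta>1 k] near by (auto simp: h_def)
    have hq: "(h / e) powr (\<sigma> / 2) \<le> q"
    proof -
      have "(h / e) powr (\<sigma> / 2) \<le> (q powr (2 / \<sigma>)) powr (\<sigma> / 2)"
        using h e q \<sigma> by (intro powr_mono2) (auto simp: \<delta>1_def field_simps)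
      also have "\<dots> = q" using q \<sigma> by (simp add: powr_powr)
      finally show ?thesis .
    qed
    have point: "ennreal (majorant \<sigma> h (\<phi> - t)) * ennreal (norm (G t))
        \<le> ennreal \<epsilon>1 * ennreal (majorant \<sigma> h (\<phi> - t)) + ennreal (2 * M * q) * ennreal (majorant (\<sigma> / 2) h (\<phi> - t))" for t
    proof -
      have "majorant \<sigma> h (\<phi> - t) * norm (G t) \<le> \<epsilon>1 * majorant \<sigma> h (\<phi> - t) + (2 * M * q) * majorant (\<sigma> / 2) h (\<phi> - t)"
      proof (cases "norm (t - \<phi>) < r")
        case True
        then have "norm (G t) \<le> \<epsilon>1" using r(2)[of t] by (simp add: G_def)
        then have "majorant \<sigma> h (\<phi> - t) * norm (G t) \<le> \<epsilon>1 * majorant \<sigma> h (\<phi> - t)"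
          using majorant_nonneg[of \<sigma> h "\<phi> - t"] by (simp add: mult.commute mult_right_mono)
        moreover have "0 \<le> (2 * M * q) * majorant (\<sigma> / 2) h (\<phi> - t)"
          using M0 q majorant_nonneg by (intro mult_nonneg_nonneg) auto
        ultimately show ?thesis by linarith
      next
        case False
        have "\<exists>i. e \<le> \<bar>(\<phi> - t) $ i\<bar>"
        proof (rule ccontr)
          assume "\<not> ?thesis"
          then have "(\<Sum>i\<in>UNIV. \<bar>(\<phi> - t) $ i\<bar>) \<le> (\<Sum>i\<in>(UNIV :: 'n set). e)"
            by (intro sum_mono) (auto simp: not_le intro: less_imp_le)
          also have "\<dots> < r" using r by (simp add: e_def)
          finally have "norm (\<phi> - t) < r" using norm_le_l1_cart[of "\<phi> - t"] by linarith
          with False show False by (simp add: norm_minus_commute)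
        qed
        then obtain i where i: "e \<le> \<bar>(\<phi> - t) $ i\<bar>" by blast
        have "majorant \<sigma> h (\<phi> - t) * norm (G t) \<le> ((h / e) powr (\<sigma> / 2) * majorant (\<sigma> / 2) h (\<phi> - t)) * (2 * M)"
          by (intro mult_mono majorant_off_diagonal[OF h(1) \<sigma> e i] G2M) (auto simp: majorant_nonneg)
        also have "\<dots> \<le> (q * majorant (\<sigma> / 2) h (\<phi> - t)) * (2 * M)"
          using hq M0 majorant_nonneg by (intro mult_right_mono) auto
        finally show ?thesis using \<epsilon>1 majorant_nonneg[of \<sigma> h "\<phi> - t"] by (simp add: mult_ac add_increasing)
      qed
      then show ?thesis
        using \<epsilon>1 M0 q by (simp add: majorant_nonneg ennreal_leI flip: ennreal_mult' ennreal_plus)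
    qed
    have "ennreal (norm (cube_poisson \<alpha> \<beta> G z)) \<le> ennreal C * (\<integral>\<^sup>+t. ennreal (majorant \<sigma> h (\<phi> - t)) * ennreal (norm (G t)) \<partial>cube_measure)"
      using C by (intro norm_cube_poisson_le Cb[OF z, folded h_def] z1 G) auto
    also have "\<dots> \<le> ennreal C * (\<integral>\<^sup>+t. (ennreal \<epsilon>1 * ennreal (majorant \<sigma> h (\<phi> - t)) + ennreal (2 * M * q) * ennreal (majorant (\<sigma> / 2) h (\<phi> - t))) \<partial>cube_measure)"
      by (intro mult_left_mono nn_integral_mono point) auto
    also have "\<dots> \<le> ennreal C * (\<integral>\<^sup>+t. (ennreal \<epsilon>1 * ennreal (majorant \<sigma> h (\<phi> - t)) + ennreal (2 * M * q) * ennreal (majorant (\<sigma> / 2) h (\<phi> - t))) \<partial>lborel)"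
      by (intro mult_left_mono nn_integral_cube_measure_le) measurable
    also have "\<dots> = ennreal C * (ennreal \<epsilon>1 * (\<integral>\<^sup>+t. ennreal (majorant \<sigma> h (\<phi> - t)) \<partial>lborel) + ennreal (2 * M * q) * (\<integral>\<^sup>+t. ennreal (majorant (\<sigma> / 2) h (\<phi> - t)) \<partial>lborel))"
      by (simp add: nn_integral_add nn_integral_cmult)
    also have "\<dots> \<le> ennreal C * (ennreal \<epsilon>1 * ennreal C1 + ennreal (2 * M * q) * ennreal C2)"
      by (intro mult_left_mono add_mono C1(2) C2(2) h) auto
    also have "\<dots> = ennreal (C * (\<epsilon>1 * C1 + 2 * M * q * C2))"
      using C C1 C2 \<epsilon>1 M0 q by (simp add: ennreal_mult')
    finally have "norm (cube_poisson \<alpha> \<beta> G z) \<le> C * (\<epsilon>1 * C1 + 2 * M * q * C2)"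
      using C C1 C2 \<epsilon>1 M0 q by (subst (asm) ennreal_le_iff) auto
    then have nG: "norm (cube_poisson \<alpha> \<beta> G z) < 2 * (\<epsilon> / 3)"
      using e1 e2 by (simp add: distrib_left)
    define I where "I = (\<integral>t. poisson_kernel \<alpha> \<beta> z (cis_vec t) \<partial>cube_measure)"
    have "cube_poisson \<alpha> \<beta> F z = cube_poisson \<alpha> \<beta> (\<lambda>t. G t + F \<phi>) z" by (simp add: G_def)
    also have "\<dots> = cube_poisson \<alpha> \<beta> G z + cube_poisson \<alpha> \<beta> (\<lambda>t. F \<phi>) z"
      by (intro cube_poisson_add z1 G) simp
    also have "cube_poisson \<alpha> \<beta> (\<lambda>t. F \<phi>) z = I * F \<phi>"
      by (simp add: cube_poisson_def I_def)
    finally have eq: "cube_poisson \<alpha> \<beta> F z - F \<phi> = cube_poisson \<alpha> \<beta> G z + (I - 1) * F \<phi>"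
      by (simp add: algebra_simps)
    have "norm (I - 1) < \<epsilon> / (3 * (M + 1))"
      unfolding I_def using norm_ge_distance_to_torus[of z \<phi> \<delta>2] near z1 by (intro mass) auto
    then have "norm ((I - 1) * F \<phi>) \<le> \<epsilon> / (3 * (M + 1)) * M"
      unfolding norm_mult using \<epsilon> M0 by (intro mult_mono M) auto
    also have "\<dots> \<le> \<epsilon> / 3" using \<epsilon> M0 by (simp add: divide_simps add_nonneg_pos)
    finally show "norm (cube_poisson \<alpha> \<beta> F z - F \<phi>) < \<epsilon>"
      unfolding eq using nG norm_triangle_ineq[of "cube_poisson \<alpha> \<beta> G z" "(I - 1) * F \<phi>"] by linarith
  qed
qed

section \<open>Almost everywhere convergence on the cube\<close>

text \<open>The class of functions for which the theorem holds, in angular coordinates.\<close>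

definition fatou_property :: "complex ^ 'n::finite \<Rightarrow> complex ^ 'n \<Rightarrow> (real ^ 'n \<Rightarrow> complex) \<Rightarrow> bool" where
  "fatou_property \<alpha> \<beta> F \<longleftrightarrow> integrable cube_measure F \<and>
     (AE \<phi> in cube_measure. RNT_lim (cube_poisson \<alpha> \<beta> F) (cis_vec \<phi>) (F \<phi>))"

lemma sets_cube_measure: "sets (cube_measure :: (real ^ 'n::finite) measure) = sets borel"
  by simp

lemma integrable_cube_measureD: "integrable cube_measure F \<Longrightarrow> F \<in> borel_measurable borel"
  by (drule borel_measurable_integrable) (simp cong: measurable_cong_sets)

lemma fatou_property_add:
  assumes "fatou_property \<alpha> \<beta> F" "fatou_property \<alpha> \<beta> G"
  shows "fatou_property \<alpha> \<beta> (\<lambda>t. F t + G t)"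
  unfolding fatou_property_def
proof
  have F: "integrable cube_measure F" and G: "integrable cube_measure G" using assms by (auto simp: fatou_property_def)
  show "integrable cube_measure (\<lambda>t. F t + G t)" using F G by simp
  have "AE \<phi> in cube_measure. RNT_lim (cube_poisson \<alpha> \<beta> F) (cis_vec \<phi>) (F \<phi>)"
       "AE \<phi> in cube_measure. RNT_lim (cube_poisson \<alpha> \<beta> G) (cis_vec \<phi>) (G \<phi>)"
    using assms by (auto simp: fatou_property_def)
  then show "AE \<phi> in cube_measure. RNT_lim (cube_poisson \<alpha> \<beta> (\<lambda>t. F t + G t)) (cis_vec \<phi>) (F \<phi> + G \<phi>)"
  proof eventually_elim
    case (elim \<phi>)
    then have "RNT_lim (\<lambda>z. cube_poisson \<alpha> \<beta> F z + cube_poisson \<alpha> \<beta> G z) (cis_vec \<phi>) (F \<phi> + G \<phi>)" by (rule RNT_lim_add)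
    then show ?case by (subst RNT_lim_cong[OF cube_poisson_add[OF _ F G]])
  qed
qed

lemma fatou_property_cmult:
  assumes "fatou_property \<alpha> \<beta> F"
  shows "fatou_property \<alpha> \<beta> (\<lambda>t. c * F t)"
  using assms unfolding fatou_property_def cube_poisson_cmult by (auto elim!: eventually_mono intro: RNT_lim_cmult)

lemma one_over_Suc_le: "1 / real (Suc m) \<le> 1"
  by simp

text \<open>The kernel bound is uniform on each inner cube, and these exhaust the cube up to its faces.\<close>

lemma AE_in_some_inner_cube:
  "AE \<phi> in (cube_measure :: (real ^ 'n::finite) measure). \<exists>m::nat. \<phi> \<in> inner_cube (1 / Suc m)"
proof (rule AE_uniform_measureI)
  have "AE \<phi> in (lborel :: (real ^ 'n) measure). \<phi> $ j \<noteq> c" for j c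
    using AE_lborel_inner_neq[of "axis j 1 :: real ^ 'n" c] by (simp add: inner_axis)
  then have "AE \<phi> in (lborel :: (real ^ 'n) measure). \<forall>j. \<phi> $ j \<noteq> 0 \<and> \<phi> $ j \<noteq> 2 * pi"
    by (simp add: AE_all_countable AE_conj_iff)
  then show "AE \<phi> in (lborel :: (real ^ 'n) measure). \<phi> \<in> cube \<longrightarrow> (\<exists>m::nat. \<phi> \<in> inner_cube (1 / Suc m))"
  proof (eventually_elim, intro impI)
    fix \<phi> :: "real ^ 'n"
    assume ne: "\<forall>j. \<phi> $ j \<noteq> 0 \<and> \<phi> $ j \<noteq> 2 * pi" and c: "\<phi> \<in> cube"
    define e where "e = Min (range (\<lambda>j. min (\<phi> $ j) (2 * pi - \<phi> $ j)))"
    have "0 < min (\<phi> $ j) (2 * pi - \<phi> $ j)" for j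
      using ne[rule_format, of j] c by (auto simp: mem_box_cart less_le)
    then have "0 < e" unfolding e_def by (subst Min_gr_iff) auto
    then obtain m :: nat where m: "1 / Suc m < e" using nat_approx_posE by blast
    have "e \<le> min (\<phi> $ j) (2 * pi - \<phi> $ j)" for j unfolding e_def by (rule Min_le) auto
    then have "1 / Suc m \<le> \<phi> $ j \<and> \<phi> $ j \<le> 2 * pi - 1 / Suc m" for j using m by (smt (verit))
    then show "\<exists>m::nat. \<phi> \<in> inner_cube (1 / Suc m)" unfolding inner_cube_def by blast
  qed
qed auto

lemma restricted_stolz_mono:
  assumes "A \<le> A'" "B \<le> B'"
  shows "restricted_stolz A B \<eta> \<subseteq> restricted_stolz A' B' \<eta>"
proof -
  have "stolz A w \<subseteq> stolz A' w" for w
    unfolding stolz_def using assms(1) by (smt (verit, best) Collect_mono mult_right_mono)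
  then show ?thesis
    using assms(2) unfolding restricted_stolz_def stolz_prod_def by (blast intro: order.trans)
qed

text \<open>Countably many apertures and error bounds suffice, which makes the limit an almost everywhere statement that can be checked for each of
them separately.\<close>

lemma RNT_lim_nat:
  assumes "\<And>a p :: nat. \<exists>\<delta>>0. \<forall>z\<in>restricted_stolz (Suc a) (Suc a) \<eta>. norm (z - \<eta>) < \<delta> \<longrightarrow> norm (u z - l) < 1 / Suc p"
  shows "RNT_lim u \<eta> l"
  unfolding RNT_lim_def
proof (intro allI impI)
  fix A B e :: real assume *: "0 < A" "1 \<le> B" "0 < e"
  obtain a :: nat where a: "max A B < real a" using reals_Archimedean2 by blast
  obtain p :: nat where p: "1 / Suc p < e" using nat_approx_posE[OF *(3)] by blast
  have sub: "restricted_stolz A B \<eta> \<subseteq> restricted_stolz (Suc a) (Suc a) \<eta>"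
    by (rule restricted_stolz_mono) (use a in auto)
  show "\<exists>\<delta>>0. \<forall>z\<in>restricted_stolz A B \<eta>. norm (z - \<eta>) < \<delta> \<longrightarrow> norm (u z - l) < e"
    using assms[of a p] sub p by (meson less_trans subsetD)
qed

text \<open>Closedness under \<open>L\<^sup>1\<close> limits. For fixed aperture and error \<open>\<epsilon>\<close>, a point where the error persists lies, for every \<open>i\<close>, in the
exceptional set of the maximal inequality for \<open>\<bar>F - G\<^sub>i\<bar>\<close>, or in the set where \<open>\<bar>F - G\<^sub>i\<bar> \<ge> \<epsilon>/4\<close>, or in the null set where \<open>G\<^sub>i\<close> has no
limit. The measures of the first two tend to 0 with the \<open>L\<^sup>1\<close> distance. The exceptional sets enter through measurable
covers, since the set of bad points need not be measurable.\<close>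

lemma fatou_property_L1_limit:
  fixes \<alpha> \<beta> :: "complex ^ 'n::finite" and F :: "real ^ 'n \<Rightarrow> complex"
  assumes ab: "\<And>j. Re (\<alpha> $ j) + Re (\<beta> $ j) > -1"
    and F: "integrable cube_measure F"
    and G: "\<And>i :: nat. fatou_property \<alpha> \<beta> (G i)"
    and lim: "(\<lambda>i. \<integral>t. norm (F t - G i t) \<partial>cube_measure) \<longlonglongrightarrow> 0"
  shows "fatou_property \<alpha> \<beta> F"
proof -
  interpret prob_space "cube_measure :: (real ^ 'n) measure" by (rule prob_space_cube_measure)
  define \<sigma> where "\<sigma> = Min (range (\<lambda>j. Re (\<alpha> $ j) + Re (\<beta> $ j) + 1))"
  have s: "\<sigma> \<le> Re (\<alpha> $ j) + Re (\<beta> $ j) + 1" for j by (simp add: \<sigma>_def)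
  have \<sigma>: "0 < \<sigma>"
  proof -
    have "0 < Re (\<alpha> $ j) + Re (\<beta> $ j) + 1" for j using ab[of j] by simp
    then show ?thesis unfolding \<sigma>_def by (subst Min_gr_iff) auto
  qed
  \<comment> \<open>An arbitrary coordinate; \<open>1 - \<bar>z\<^sub>k\<bar>\<close> serves as the scale.\<close>
  obtain k :: 'n where True by blast
  have Gi: "integrable cube_measure (G i)" for i using G[of i] by (simp add: fatou_property_def)
  define H where "H i t = F t - G i t" for i t
  have Hi: "integrable cube_measure (H i)" for i unfolding H_def[abs_def] using F Gi by simp
  have Hm [measurable]: "H i \<in> borel_measurable borel" for i by (rule integrable_cube_measureD[OF Hi])
  define \<nu> where "\<nu> i = density cube_measure (\<lambda>t. ennreal (norm (H i t)))" for i
  define J where "J i = (\<integral>t. norm (H i t) \<partial>cube_measure)" for i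
  have J0: "J i \<ge> 0" for i unfolding J_def by simp
  have \<nu>s: "sets (\<nu> i) = sets borel" for i by (simp add: \<nu>_def)
  have \<nu>e: "emeasure (\<nu> i) (space (\<nu> i)) = ennreal (J i)" for i
  proof -
    have "emeasure (\<nu> i) (space (\<nu> i)) = (\<integral>\<^sup>+t. ennreal (norm (H i t)) \<partial>cube_measure)"
      by (simp add: \<nu>_def emeasure_density cong: nn_integral_cong)
    also have "\<dots> = ennreal (J i)"
      unfolding J_def by (intro nn_integral_eq_integral integrable_norm Hi) auto
    finally show ?thesis .
  qed
  have \<nu>f: "finite_measure (\<nu> i)" for i
    by (rule finite_measureI) (simp add: \<nu>e)
  have \<nu>M: "measure (\<nu> i) (space (\<nu> i)) = J i" for i
    using \<nu>e[of i] J0[of i] by (simp add: measure_def)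
  obtain C1 where C1: "C1 \<ge> 0" and weak: "\<And>(\<nu> :: (real ^ 'n) measure) \<Lambda>. finite_measure \<nu> \<Longrightarrow> sets \<nu> = sets borel \<Longrightarrow> 0 < \<Lambda> \<Longrightarrow>
    (\<exists>U\<in>sets borel. emeasure lborel U \<le> ennreal (C1 * measure \<nu> (space \<nu>) / \<Lambda>) \<and>
       (\<forall>x h. 0 < h \<longrightarrow> x \<notin> U \<longrightarrow> (\<integral>\<^sup>+t. ennreal (majorant \<sigma> h (x - t)) \<partial>\<nu>) \<le> ennreal \<Lambda>))"
    using majorant_weak_type[OF \<sigma>] by metis
  have "AE \<phi> in cube_measure. \<phi> \<in> inner_cube (1 / Suc m) \<longrightarrow>
      (\<exists>\<delta>>0. \<forall>z\<in>restricted_stolz (Suc a) (Suc a) (cis_vec \<phi>). norm (z - cis_vec \<phi>) < \<delta> \<longrightarrow> norm (cube_poisson \<alpha> \<beta> F z - F \<phi>) < 1 / Suc p)"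
    (is "AE \<phi> in _. ?P \<phi>") for m a p :: nat
  proof -
    define \<epsilon> where "\<epsilon> = 1 / real (Suc p)"
    have \<epsilon>: "\<epsilon> > 0" by (simp add: \<epsilon>_def)
    have d: "0 < 1 / real (Suc m)" "1 / real (Suc m) \<le> pi" using pi_gt3 one_over_Suc_le[of m] by (simp, linarith)
    obtain C where C: "C > 0" and Cb: "\<And>\<phi> z t. \<phi> \<in> inner_cube (1 / Suc m) \<Longrightarrow> z \<in> restricted_stolz (Suc a) (Suc a) (cis_vec \<phi>) \<Longrightarrow> t \<in> cube \<Longrightarrow>
      norm (poisson_kernel \<alpha> \<beta> z (cis_vec t)) \<le> C * majorant \<sigma> (1 - norm (z $ k)) (\<phi> - t)"
      using poisson_kernel_le_majorant[OF s \<sigma> _ _ d, where A = "Suc a" and B = "Suc a" and k = k] by (metis of_nat_0_less_iff of_nat_1 of_nat_le_iff zero_less_Suc Suc_le_mono One_nat_def le0)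
    \<comment> \<open>Outside the exceptional set at this level the Poisson integral of \<open>F - G\<^sub>i\<close> is at most \<open>\<epsilon> / 4\<close>.\<close>
    define \<Lambda> where "\<Lambda> = \<epsilon> / (4 * C)"
    have \<Lambda>: "\<Lambda> > 0" using \<epsilon> C by (simp add: \<Lambda>_def)
    have "\<forall>i. \<exists>U. U \<in> sets borel \<and> emeasure lborel U \<le> ennreal (C1 * J i / \<Lambda>) \<and>
       (\<forall>x h. 0 < h \<longrightarrow> x \<notin> U \<longrightarrow> (\<integral>\<^sup>+t. ennreal (majorant \<sigma> h (x - t)) \<partial>\<nu> i) \<le> ennreal \<Lambda>)"
      using weak[OF \<nu>f \<nu>s \<Lambda>] unfolding \<nu>M by blast
    then obtain U where U: "\<And>i. U i \<in> sets borel" "\<And>i. emeasure lborel (U i) \<le> ennreal (C1 * J i / \<Lambda>)"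
       and Ub: "\<And>i x h. 0 < h \<Longrightarrow> x \<notin> U i \<Longrightarrow> (\<integral>\<^sup>+t. ennreal (majorant \<sigma> h (x - t)) \<partial>\<nu> i) \<le> ennreal \<Lambda>"
      by metis
    define W where "W i = {t. \<epsilon> / 4 \<le> norm (H i t)}" for i
    have Wm: "W i \<in> sets borel" for i unfolding W_def by measurable
    define V where "V = (\<Inter>i. U i \<union> W i)"
    have Vm: "V \<in> sets cube_measure" unfolding V_def sets_cube_measure using U(1) Wm by auto
    have Vle: "emeasure cube_measure V \<le> ennreal (C1 * J i / \<Lambda> + 4 / \<epsilon> * J i)" for i
    proof -
      have "emeasure cube_measure V \<le> emeasure cube_measure (U i \<union> W i)"
        using U(1) Wm by (intro emeasure_mono) (auto simp: V_def)
      also have "\<dots> \<le> emeasure cube_measure (U i) + emeasure cube_measure (W i)"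
        using U(1) Wm by (intro emeasure_subadditive) auto
      also have "emeasure cube_measure (U i) \<le> emeasure lborel (U i)"
        using nn_integral_cube_measure_le[of "indicator (U i)"] U(1)[of i] by simp
      also have "emeasure lborel (U i) \<le> ennreal (C1 * J i / \<Lambda>)" by (rule U(2))
      also have "emeasure cube_measure (W i) \<le> ennreal (4 / \<epsilon> * J i)"
      proof -
        have "emeasure cube_measure (W i) = measure cube_measure (W i)" by (rule emeasure_eq_measure)
        also have "measure cube_measure {t \<in> space cube_measure. \<epsilon> / 4 \<le> norm (H i t)} \<le> J i / (\<epsilon> / 4)"
          unfolding J_def using \<epsilon> by (intro integral_Markov_inequality_measure[where A = "{}"] integrable_norm Hi) auto
        then have "measure cube_measure (W i) \<le> 4 / \<epsilon> * J i" by (simp add: W_def mult.commute)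
        finally show ?thesis using ennreal_leI by blast
      qed
      finally show ?thesis using C1 J0[of i] \<Lambda> \<epsilon> by (simp add: add_mono ennreal_plus)
    qed
    have "emeasure cube_measure V \<le> 0"
    proof (rule LIMSEQ_le_const)
      have "J \<longlonglongrightarrow> 0" using lim unfolding J_def H_def .
      then have "(\<lambda>i. C1 * J i / \<Lambda> + 4 / \<epsilon> * J i) \<longlonglongrightarrow> C1 * 0 / \<Lambda> + 4 / \<epsilon> * 0"
        using \<Lambda> \<epsilon> by (intro tendsto_intros) auto
      then show "(\<lambda>i. ennreal (C1 * J i / \<Lambda> + 4 / \<epsilon> * J i)) \<longlonglongrightarrow> 0"
        using tendsto_ennrealI by fastforce
    qed (use Vle in auto)
    then have Vnull: "V \<in> null_sets cube_measure" using Vm by (auto intro!: null_setsI)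
    have "AE \<phi> in cube_measure. \<forall>i. RNT_lim (cube_poisson \<alpha> \<beta> (G i)) (cis_vec \<phi>) (G i \<phi>)"
      using G by (simp add: AE_all_countable fatou_property_def)
    moreover have "AE \<phi> in cube_measure. \<phi> \<notin> V" using Vnull by (rule AE_not_in)
    ultimately show ?thesis
    proof (eventually_elim, intro impI)
      fix \<phi> assume R: "\<forall>i. RNT_lim (cube_poisson \<alpha> \<beta> (G i)) (cis_vec \<phi>) (G i \<phi>)" and V: "\<phi> \<notin> V"
        and \<phi>: "\<phi> \<in> inner_cube (1 / Suc m)"
      obtain i where i: "\<phi> \<notin> U i" "norm (H i \<phi>) < \<epsilon> / 4" using V by (auto simp: V_def W_def not_le)
      obtain \<delta> where \<delta>: "\<delta> > 0" "\<And>z. z \<in> restricted_stolz (Suc a) (Suc a) (cis_vec \<phi>) \<Longrightarrow> norm (z - cis_vec \<phi>) < \<delta> \<Longrightarrow> norm (cube_poisson \<alpha> \<beta> (G i) z - G i \<phi>) < \<epsilon> / 4"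
      proof -
        have "0 < real (Suc a)" "1 \<le> real (Suc a)" "0 < \<epsilon> / 4" using \<epsilon> by auto
        then show ?thesis using R[rule_format, of i] that unfolding RNT_lim_def by meson
      qed
      have "norm (cube_poisson \<alpha> \<beta> F z - F \<phi>) < \<epsilon>" if z: "z \<in> restricted_stolz (Suc a) (Suc a) (cis_vec \<phi>)" and near: "norm (z - cis_vec \<phi>) < \<delta>" for z
      proof -
        have z1: "norm (z $ j) < 1" for j using restricted_stolzD(2)[OF z] .
        have "ennreal (norm (cube_poisson \<alpha> \<beta> (H i) z)) \<le> ennreal C * (\<integral>\<^sup>+t. ennreal (majorant \<sigma> (1 - norm (z $ k)) (\<phi> - t)) * ennreal (norm (H i t)) \<partial>cube_measure)"
          using C by (intro norm_cube_poisson_le Cb[OF \<phi> z] z1 Hi) auto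
        also have "(\<integral>\<^sup>+t. ennreal (majorant \<sigma> (1 - norm (z $ k)) (\<phi> - t)) * ennreal (norm (H i t)) \<partial>cube_measure)
           = (\<integral>\<^sup>+t. ennreal (majorant \<sigma> (1 - norm (z $ k)) (\<phi> - t)) \<partial>\<nu> i)"
          unfolding \<nu>_def by (subst nn_integral_density) (auto simp: mult.commute)
        also have "\<dots> \<le> ennreal \<Lambda>" using z1[of k] i(1) by (intro Ub) auto
        finally have "ennreal (norm (cube_poisson \<alpha> \<beta> (H i) z)) \<le> ennreal (C * \<Lambda>)"
          using C \<Lambda> by (simp add: ennreal_mult' mult_left_mono)
        then have 1: "norm (cube_poisson \<alpha> \<beta> (H i) z) \<le> \<epsilon> / 4"
          using C \<epsilon> by (subst (asm) ennreal_le_iff) (auto simp: \<Lambda>_def)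
        have "cube_poisson \<alpha> \<beta> F z = cube_poisson \<alpha> \<beta> (\<lambda>t. H i t + G i t) z" by (simp add: H_def)
        also have "\<dots> = cube_poisson \<alpha> \<beta> (H i) z + cube_poisson \<alpha> \<beta> (G i) z"
          by (intro cube_poisson_add z1 Hi Gi)
        finally have "cube_poisson \<alpha> \<beta> F z - F \<phi> = cube_poisson \<alpha> \<beta> (H i) z + (cube_poisson \<alpha> \<beta> (G i) z - G i \<phi>) - H i \<phi>"
          by (simp add: H_def)
        also have "norm \<dots> \<le> norm (cube_poisson \<alpha> \<beta> (H i) z) + norm (cube_poisson \<alpha> \<beta> (G i) z - G i \<phi>) + norm (H i \<phi>)"
          by (intro order.trans[OF norm_triangle_ineq4] add_mono norm_triangle_ineq order.refl)
        also have "\<dots> < \<epsilon>" using 1 \<delta>(2)[OF z near] i(2) \<epsilon> by linarith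
        finally show ?thesis .
      qed
      then show "\<exists>\<delta>>0. \<forall>z\<in>restricted_stolz (Suc a) (Suc a) (cis_vec \<phi>). norm (z - cis_vec \<phi>) < \<delta> \<longrightarrow> norm (cube_poisson \<alpha> \<beta> F z - F \<phi>) < 1 / Suc p"
        using \<delta>(1) unfolding \<epsilon>_def by blast
    qed
  qed
  then have "AE \<phi> in cube_measure. \<forall>m a p :: nat. \<phi> \<in> inner_cube (1 / Suc m) \<longrightarrow>
      (\<exists>\<delta>>0. \<forall>z\<in>restricted_stolz (Suc a) (Suc a) (cis_vec \<phi>). norm (z - cis_vec \<phi>) < \<delta> \<longrightarrow> norm (cube_poisson \<alpha> \<beta> F z - F \<phi>) < 1 / Suc p)"
    unfolding AE_all_countable by blast
  with AE_in_some_inner_cube have "AE \<phi> in cube_measure. RNT_lim (cube_poisson \<alpha> \<beta> F) (cis_vec \<phi>) (F \<phi>)"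
  proof eventually_elim
    case (elim \<phi>)
    then show ?case by (intro RNT_lim_nat) blast
  qed
  with F show ?thesis by (simp add: fatou_property_def)
qed

lemma fatou_property_continuous_AE:
  fixes \<alpha> \<beta> :: "complex ^ 'n::finite" and F :: "real ^ 'n \<Rightarrow> complex"
  assumes ab: "\<And>j. Re (\<alpha> $ j) + Re (\<beta> $ j) > -1"
    and na: "\<And>j. \<alpha> $ j \<notin> {- of_nat k | k::nat. k \<ge> 1}"
    and nb: "\<And>j. \<beta> $ j \<notin> {- of_nat k | k::nat. k \<ge> 1}"
    and [measurable]: "F \<in> borel_measurable borel" and M: "\<And>t. norm (F t) \<le> M"
    and cont: "AE \<phi> in cube_measure. continuous (at \<phi>) F"
  shows "fatou_property \<alpha> \<beta> F"
proof -
  interpret prob_space "cube_measure :: (real ^ 'n) measure" by (rule prob_space_cube_measure)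
  have F: "integrable cube_measure F"
    by (rule integrable_const_bound[where B = M]) (auto simp: M)
  have "AE \<phi> in cube_measure. RNT_lim (cube_poisson \<alpha> \<beta> F) (cis_vec \<phi>) (F \<phi>)"
    using cont AE_in_some_inner_cube
  proof eventually_elim
    case (elim \<phi>)
    then obtain m :: nat where m: "\<phi> \<in> inner_cube (1 / Suc m)" by blast
    have "0 < 1 / real (Suc m)" "1 / real (Suc m) \<le> pi" using pi_gt3 one_over_Suc_le[of m] by (simp, linarith)
    with elim(1) m show ?case by (intro RNT_lim_cube_poisson_continuity_point[OF ab na nb F M])
  qed
  with F show ?thesis by (simp add: fatou_property_def)
qed

lemma AE_continuous_indicator_box:
  "AE \<phi> in (cube_measure :: (real ^ 'n::finite) measure). continuous (at \<phi>) (indicator (box a b) :: real ^ 'n \<Rightarrow> complex)"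
proof (rule AE_uniform_measureI)
  have "AE \<phi> in (lborel :: (real ^ 'n) measure). \<phi> $ j \<noteq> c" for j c
    using AE_lborel_inner_neq[of "axis j 1 :: real ^ 'n" c] by (simp add: inner_axis)
  then have "AE \<phi> in (lborel :: (real ^ 'n) measure). \<forall>j. \<phi> $ j \<noteq> a $ j \<and> \<phi> $ j \<noteq> b $ j"
    by (simp add: AE_all_countable AE_conj_iff)
  then show "AE \<phi> in (lborel :: (real ^ 'n) measure). \<phi> \<in> cube \<longrightarrow> continuous (at \<phi>) (indicator (box a b) :: real ^ 'n \<Rightarrow> complex)"
  proof (eventually_elim, intro impI)
    fix \<phi> :: "real ^ 'n" assume ne: "\<forall>j. \<phi> $ j \<noteq> a $ j \<and> \<phi> $ j \<noteq> b $ j"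
    have "\<phi> \<in> box a b \<or> \<phi> \<notin> cbox a b" using ne by (auto simp: mem_box_cart less_le) metis
    then have "\<phi> \<notin> frontier (box a b)"
      by (cases "box a b = {}") (auto simp: frontier_box)
    then have "continuous (at \<phi>) (\<lambda>t. complex_of_real (indicator (box a b) t))"
      by (intro continuous_of_real) (simp add: isCont_indicator)
    then show "continuous (at \<phi>) (indicator (box a b) :: real ^ 'n \<Rightarrow> complex)"
      by (simp add: of_real_indicator)
  qed
qed auto

text \<open>A Dynkin class argument: open boxes have null boundary, complements are differences with a constant, and disjoint unions are \<open>L\<^sup>1\<close>
limits of finite ones.\<close>

lemma fatou_property_indicator:
  fixes \<alpha> \<beta> :: "complex ^ 'n::finite" and S :: "(real ^ 'n) set"
  assumes ab: "\<And>j. Re (\<alpha> $ j) + Re (\<beta> $ j) > -1"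
    and na: "\<And>j. \<alpha> $ j \<notin> {- of_nat k | k::nat. k \<ge> 1}"
    and nb: "\<And>j. \<beta> $ j \<notin> {- of_nat k | k::nat. k \<ge> 1}"
    and S: "S \<in> sets borel"
  shows "fatou_property \<alpha> \<beta> (indicator S)"
proof -
  interpret prob_space "cube_measure :: (real ^ 'n) measure" by (rule prob_space_cube_measure)
  let ?E = "range (\<lambda>(a, b). box a b :: (real ^ 'n) set)"
  have const: "fatou_property \<alpha> \<beta> (\<lambda>_. c)" for c
    by (rule fatou_property_continuous_AE[OF ab na nb, where M = "norm c"]) auto
  have borel: "sigma_sets UNIV ?E = sets borel" by (simp add: borel_eq_box)
  have "Int_stable ?E"
    by (auto simp: Int_stable_def box_Int_box)
  moreover have "?E \<subseteq> Pow UNIV" by simp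
  moreover have "S \<in> sigma_sets UNIV ?E" using S by (simp add: borel)
  ultimately show ?thesis
  proof (induction rule: sigma_sets_induct_disjoint)
    case (basic A)
    then obtain a b where A: "A = box a b" by auto
    show ?case unfolding A
      by (rule fatou_property_continuous_AE[OF ab na nb, where M = 1])
        (auto intro: AE_continuous_indicator_box split: split_indicator)
  next
    case empty
    then show ?case using const[of 0] by (simp add: indicator_def)
  next
    case (compl A)
    have "(indicator (UNIV - A) :: real ^ 'n \<Rightarrow> complex) = (\<lambda>t. 1 + (-1) * indicator A t)"
      by (auto simp: indicator_def)
    with fatou_property_add[OF const[of 1] fatou_property_cmult[OF compl(2), of "-1"]] show ?case by metis
  next
    case (union A)
    have Am [measurable]: "A i \<in> sets borel" for i using union(2) by (auto simp: borel)
    define G where "G N t = (\<Sum>i<N. indicator (A i) t :: complex)" for N :: nat and t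
    have G: "fatou_property \<alpha> \<beta> (G N)" for N
    proof (induction N)
      case 0
      then show ?case using const[of 0] by (simp add: G_def[abs_def])
    next
      case (Suc N)
      then show ?case using fatou_property_add[OF Suc union(3)] by (simp add: G_def[abs_def])
    qed
    have Geq: "G N t = indicator (\<Union>i<N. A i) t" for N t
      unfolding G_def using union(1) by (subst indicator_UN_disjoint) (auto simp: disjoint_family_on_def)
    show ?case
    proof (rule fatou_property_L1_limit[OF ab _ G])
      show "integrable cube_measure (indicator (\<Union>i. A i) :: real ^ 'n \<Rightarrow> complex)"
        by (rule integrable_const_bound[where B = 1]) (auto simp: indicator_def)
      have "(\<lambda>N. \<integral>t. norm (indicator (\<Union>i. A i) t - G N t) \<partial>cube_measure) \<longlonglongrightarrow> (\<integral>t. 0 \<partial>(cube_measure :: (real ^ 'n) measure))"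
      proof (rule integral_dominated_convergence[where w = "\<lambda>_. 1"])
        show "AE t in cube_measure. (\<lambda>N. norm (indicator (\<Union>i. A i) t - G N t)) \<longlonglongrightarrow> 0"
        proof (rule AE_I2)
          fix t :: "real ^ 'n"
          have "\<forall>\<^sub>F N in sequentially. G N t = indicator (\<Union>i. A i) t"
          proof (cases "t \<in> (\<Union>i. A i)")
            case True
            then obtain i where "t \<in> A i" by blast
            then show ?thesis
              unfolding Geq by (intro eventually_sequentiallyI[of "Suc i"]) (auto simp: indicator_def)
          qed (auto simp: Geq indicator_def)
          then have "\<forall>\<^sub>F N in sequentially. norm (indicator (\<Union>i. A i) t - G N t) = 0"
            by eventually_elim simp
          then show "(\<lambda>N. norm (indicator (\<Union>i. A i) t - G N t)) \<longlonglongrightarrow> 0"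
            by (rule tendsto_eventually)
        qed
        show "AE t in cube_measure. norm (norm (indicator (\<Union>i. A i) t - G N t)) \<le> 1" for N
          by (rule AE_I2) (auto simp: Geq indicator_def)
      qed (auto simp: Geq)
      then show "(\<lambda>N. \<integral>t. norm (indicator (\<Union>i. A i) t - G N t) \<partial>cube_measure) \<longlonglongrightarrow> 0" by simp
    qed
  qed
qed

theorem fatou_property_integrable:
  fixes \<alpha> \<beta> :: "complex ^ 'n::finite" and F :: "real ^ 'n \<Rightarrow> complex"
  assumes ab: "\<And>j. Re (\<alpha> $ j) + Re (\<beta> $ j) > -1"
    and na: "\<And>j. \<alpha> $ j \<notin> {- of_nat k | k::nat. k \<ge> 1}"
    and nb: "\<And>j. \<beta> $ j \<notin> {- of_nat k | k::nat. k \<ge> 1}"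
    and F: "integrable cube_measure F"
  shows "fatou_property \<alpha> \<beta> F"
  using F
proof (induction rule: integrable_induct)
  case (base A c)
  have "A \<in> sets borel" using base by simp
  from fatou_property_cmult[OF fatou_property_indicator[OF ab na nb this], of c]
  moreover have "(\<lambda>t. c * indicator A t) = (\<lambda>t. indicator A t *\<^sub>R c)"
    by (auto simp: indicator_def)
  ultimately show ?case by simp
next
  case (add f g)
  then show ?case by (intro fatou_property_add)
next
  case (lim f s)
  have [measurable]: "f \<in> borel_measurable borel" "s i \<in> borel_measurable borel" for i
    using lim.hyps(1,4) by (auto intro: integrable_cube_measureD)
  have "(\<lambda>i. \<integral>t. norm (f t - s i t) \<partial>cube_measure) \<longlonglongrightarrow> (\<integral>t. 0 \<partial>(cube_measure :: (real ^ 'n) measure))"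
  proof (rule integral_dominated_convergence[where w = "\<lambda>t. 3 * norm (f t)"])
    show "integrable cube_measure (\<lambda>t. 3 * norm (f t))" using lim.hyps(4) by simp
    show "AE t in cube_measure. (\<lambda>i. norm (f t - s i t)) \<longlonglongrightarrow> 0"
    proof (rule AE_I2)
      fix t :: "real ^ 'n" assume "t \<in> space cube_measure"
      then have "(\<lambda>i. s i t) \<longlonglongrightarrow> f t" by (rule lim.hyps(2))
      from tendsto_norm[OF tendsto_diff[OF tendsto_const this, of "f t"]]
      show "(\<lambda>i. norm (f t - s i t)) \<longlonglongrightarrow> 0" by simp
    qed
    show "AE t in cube_measure. norm (norm (f t - s i t)) \<le> 3 * norm (f t)" for i
    proof (rule AE_I2)
      fix t :: "real ^ 'n" assume "t \<in> space cube_measure"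
      then have "norm (s i t) \<le> 2 * norm (f t)" by (rule lim.hyps(3))
      then show "norm (norm (f t - s i t)) \<le> 3 * norm (f t)" using norm_triangle_ineq4[of "f t" "s i t"] by simp
    qed
  qed auto
  then have "(\<lambda>i. \<integral>t. norm (f t - s i t) \<partial>cube_measure) \<longlonglongrightarrow> 0" by simp
  then show ?case by (rule fatou_property_L1_limit[OF ab lim.hyps(4) lim.IH])
qed

section \<open>Passage to the torus\<close>

abbreviation torus_measure :: "(complex ^ 'n::finite) measure" where
  "torus_measure \<equiv> distr cube_measure (restrict_space borel torus) cis_vec"

lemma haar_torus_eq: "haar_torus = completion torus_measure"
  by (simp add: haar_torus_def cis_vec_def[abs_def])

lemma measurable_cis_vec [measurable]: "cis_vec \<in> borel \<rightarrow>\<^sub>M restrict_space borel torus"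
  by (intro measurable_restrict_space2 borel_measurable_continuous_onI continuous_cis_vec)
    (auto simp: cis_vec_in_torus)

lemma borel_measurable_Arg2pi [measurable]: "Arg2pi \<in> borel_measurable borel"
  unfolding borel_measurable_iff_greater using open_Arg2pi2pi_gt by auto

text \<open>The set where \<open>P\<close> holds need not be measurable, so a null set in the cube must be carried to the torus by a measurable inverse of
\<open>cis_vec\<close>. The argument in \<open>[0, 2\<pi>)\<close> is such an inverse off the faces of the cube.\<close>

lemma AE_torus_measure:
  assumes "AE t in (cube_measure :: (real ^ 'n::finite) measure). P (cis_vec t)"
  shows "AE \<eta> in torus_measure. P \<eta>"
proof -
  define ang where "ang \<eta> = (\<chi> j. Arg2pi (\<eta> $ j))" for \<eta> :: "complex ^ 'n"
  have angm [measurable]: "ang \<in> restrict_space borel torus \<rightarrow>\<^sub>M borel"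
  proof (rule measurable_restrict_space1)
    show "ang \<in> borel \<rightarrow>\<^sub>M borel"
    proof (rule borel_measurable_euclidean_space[THEN iffD2], rule ballI)
      fix b :: "real ^ 'n" assume "b \<in> Basis"
      then obtain j where b: "b = axis j 1" by (auto simp: Basis_vec_def)
      have "(\<lambda>\<eta> :: complex ^ 'n. \<eta> $ j) \<in> borel_measurable borel"
        by (intro borel_measurable_continuous_onI continuous_intros)
      then have "(\<lambda>\<eta> :: complex ^ 'n. Arg2pi (\<eta> $ j)) \<in> borel_measurable borel"
        by measurable
      then show "(\<lambda>\<eta>. ang \<eta> \<bullet> b) \<in> borel_measurable borel"
        by (simp add: b inner_axis ang_def)
    qed
  qed
  have ang_inv: "cis_vec (ang \<eta>) = \<eta>" if "\<eta> \<in> torus" for \<eta>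
    using that by (simp add: vec_eq_iff ang_def torus_def cis_conv_exp complex_norm_eq_1_exp)
  have ang_cis: "ang (cis_vec t) = t" if "t \<in> inner_cube (1 / Suc m)" for t m
  proof -
    have "Arg2pi (cis (t $ j)) = t $ j" for j
    proof (rule Arg2pi_unique[of 1])
      have "0 < 1 / real (Suc m)" by simp
      moreover have "1 / real (Suc m) \<le> t $ j" "t $ j \<le> 2 * pi - 1 / real (Suc m)" using that by (auto simp: inner_cube_def)
      ultimately show "0 \<le> t $ j" "t $ j < 2 * pi" by linarith+
    qed (auto simp: cis_conv_exp)
    then show ?thesis by (simp add: ang_def vec_eq_iff)
  qed
  obtain N where N: "{t \<in> space cube_measure. \<not> P (cis_vec t)} \<subseteq> N" "N \<in> null_sets (cube_measure :: (real ^ 'n) measure)"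
    using assms by (auto elim!: AE_E3 simp: eventually_ae_filter)
  have [measurable]: "N \<in> sets borel" using N(2) by auto
  define N' where "N' = {\<eta> \<in> space torus_measure. ang \<eta> \<in> N}"
  have N'm: "N' \<in> sets torus_measure"
    unfolding N'_def by measurable
  have "emeasure torus_measure N' = emeasure cube_measure (cis_vec -` N' \<inter> space cube_measure)"
    using N'm by (intro emeasure_distr) (auto simp: cong: measurable_cong_sets)
  also have "\<dots> = 0"
  proof -
    have "AE t in cube_measure. t \<notin> N" using N(2) by (rule AE_not_in)
    with AE_in_some_inner_cube have "AE t in cube_measure. t \<notin> cis_vec -` N' \<inter> space cube_measure"
    proof eventually_elim
      case (elim t)
      then show ?case using ang_cis by (auto simp: N'_def)
    qed
    moreover have "cis_vec -` N' \<inter> space cube_measure \<in> sets cube_measure"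
      using N'm by (intro measurable_sets[where A = "restrict_space borel torus"]) (auto cong: measurable_cong_sets)
    ultimately show ?thesis by (metis AE_iff_null_sets null_setsD1)
  qed
  finally have "N' \<in> null_sets torus_measure" using N'm by (auto intro: null_setsI)
  then show ?thesis
  proof (rule AE_I')
    show "{\<eta> \<in> space torus_measure. \<not> P \<eta>} \<subseteq> N'"
    proof
      fix \<eta> assume \<eta>: "\<eta> \<in> {\<eta> \<in> space (torus_measure :: (complex ^ 'n) measure). \<not> P \<eta>}"
      then have "\<eta> \<in> torus" by (simp add: space_restrict_space)
      then have "\<not> P (cis_vec (ang \<eta>))" using \<eta> ang_inv by simp
      then have "ang \<eta> \<in> N" using N(1) by auto
      then show "\<eta> \<in> N'" using \<eta> by (simp add: N'_def)
    qed
  qed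
qed

text \<open>The Haar measure is completed, so \<open>f\<close> agrees with a Borel function off a null set.\<close>

lemma borel_representative:
  fixes f :: "complex ^ 'n::finite \<Rightarrow> complex"
  assumes f: "integrable haar_torus f"
  shows "\<exists>g. g \<in> borel_measurable torus_measure \<and> (AE \<eta> in torus_measure. f \<eta> = g \<eta>)"
proof -
  have fm [measurable]: "f \<in> borel_measurable (completion torus_measure)" using f by (simp add: haar_torus_eq)
  obtain r where r: "r \<in> borel_measurable torus_measure" "AE \<eta> in torus_measure. Re (f \<eta>) = r \<eta>"
    using completion_ex_borel_measurable_real[of "\<lambda>\<eta>. Re (f \<eta>)" torus_measure] by auto
  obtain i where i: "i \<in> borel_measurable torus_measure" "AE \<eta> in torus_measure. Im (f \<eta>) = i \<eta>"
    using completion_ex_borel_measurable_real[of "\<lambda>\<eta>. Im (f \<eta>)" torus_measure] by auto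
  have "(\<lambda>\<eta>. Complex (r \<eta>) (i \<eta>)) \<in> borel_measurable torus_measure"
    using r(1) i(1) by (simp add: borel_measurable_complex_iff)
  moreover have "AE \<eta> in torus_measure. f \<eta> = Complex (r \<eta>) (i \<eta>)"
    using r(2) i(2) by eventually_elim (simp add: complex_eq_iff)
  ultimately show ?thesis by blast
qed

theorem theorem4p8:
  fixes \<alpha> \<beta> :: "complex ^ 'n::finite" and f :: "complex ^ 'n \<Rightarrow> complex"
  assumes "\<And>j. Re (\<alpha> $ j) + Re (\<beta> $ j) > -1"
    and "\<And>j. \<alpha> $ j \<notin> {- of_nat k | k::nat. k \<ge> 1}"
    and "\<And>j. \<beta> $ j \<notin> {- of_nat k | k::nat. k \<ge> 1}"
    and "integrable haar_torus f"
  shows "AE \<eta> in haar_torus. RNT_lim (poisson_integral \<alpha> \<beta> f) \<eta> (f \<eta>)"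
proof -
  obtain g where g: "g \<in> borel_measurable torus_measure" and fg: "AE \<eta> in torus_measure. f \<eta> = g \<eta>"
    using borel_representative[OF assms(4)] by blast
  have gm: "g \<in> borel_measurable (restrict_space borel torus)" using g by simp
  have fm: "f \<in> borel_measurable haar_torus" using assms(4) by simp
  have fg': "AE \<eta> in haar_torus. f \<eta> = g \<eta>" unfolding haar_torus_eq using fg by (rule AE_completion)
  have gm': "g \<in> borel_measurable haar_torus" unfolding haar_torus_eq using g by (rule measurable_completion)
  have "integrable haar_torus g"
    using assms(4) integrable_cong_AE[OF fm gm' fg'] by simp
  then have "integrable torus_measure g"
    using g by (simp add: haar_torus_eq integrable_completion)
  then have int: "integrable cube_measure (\<lambda>t. g (cis_vec t))"
    by (subst (asm) integrable_distr_eq) (auto simp: gm cong: measurable_cong_sets)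
  have eq: "cube_poisson \<alpha> \<beta> (\<lambda>t. g (cis_vec t)) z = poisson_integral \<alpha> \<beta> f z" if z: "\<And>j. norm (z $ j) < 1" for z
  proof -
    have Km: "poisson_kernel \<alpha> \<beta> z \<in> borel_measurable (restrict_space borel torus)"
      by (rule borel_measurable_continuous_on_restrict[OF continuous_on_poisson_kernel[OF z]])
    then have Km': "poisson_kernel \<alpha> \<beta> z \<in> borel_measurable torus_measure" by simp
    then have Kmh: "poisson_kernel \<alpha> \<beta> z \<in> borel_measurable haar_torus"
      unfolding haar_torus_eq by (rule measurable_completion)
    have "poisson_integral \<alpha> \<beta> f z = (\<integral>\<zeta>. poisson_kernel \<alpha> \<beta> z \<zeta> * g \<zeta> \<partial>haar_torus)"
      unfolding poisson_integral_def
    proof (rule integral_cong_AE)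
      show "AE \<zeta> in haar_torus. poisson_kernel \<alpha> \<beta> z \<zeta> * f \<zeta> = poisson_kernel \<alpha> \<beta> z \<zeta> * g \<zeta>"
        using fg' by eventually_elim simp
    qed (intro borel_measurable_times Kmh fm gm')+
    also have "\<dots> = (\<integral>\<zeta>. poisson_kernel \<alpha> \<beta> z \<zeta> * g \<zeta> \<partial>torus_measure)"
      unfolding haar_torus_eq by (intro integral_completion borel_measurable_times Km' g)
    also have "\<dots> = cube_poisson \<alpha> \<beta> (\<lambda>t. g (cis_vec t)) z"
      unfolding cube_poisson_def
      by (intro integral_distr borel_measurable_times Km gm) (simp cong: measurable_cong_sets)
    finally show ?thesis by simp
  qed
  have "fatou_property \<alpha> \<beta> (\<lambda>t. g (cis_vec t))"
    by (rule fatou_property_integrable[OF assms(1-3) int])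
  moreover have "RNT_lim (cube_poisson \<alpha> \<beta> (\<lambda>t. g (cis_vec t))) (cis_vec \<phi>) l \<longleftrightarrow>
      RNT_lim (poisson_integral \<alpha> \<beta> f) (cis_vec \<phi>) l" for \<phi> l
    by (rule RNT_lim_cong) (rule eq)
  ultimately have "AE t in cube_measure. RNT_lim (poisson_integral \<alpha> \<beta> f) (cis_vec t) (g (cis_vec t))"
    by (simp add: fatou_property_def)
  then have "AE \<eta> in torus_measure. RNT_lim (poisson_integral \<alpha> \<beta> f) \<eta> (g \<eta>)"
    by (rule AE_torus_measure)
  with fg have "AE \<eta> in torus_measure. RNT_lim (poisson_integral \<alpha> \<beta> f) \<eta> (f \<eta>)"
    by eventually_elim simp
  then show ?thesis unfolding haar_torus_eq by (rule AE_completion)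
qed

end
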